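(* Let $k$ be a positive integer, let $G$ be a graph (multiple edges and loops allowed) and let $T \subseteq V(G)$. If every edge-cut in $G$ separating $T$ has size at least $5k+4$, then $G$ contains $k$ pairwise edge-disjoint $T$-Steiner trees.
   Context: An edge-cut of $G$ is a set of edges of the form $\delta(X)$ (all edges with exactly one end in $X$) for some $\emptyset \neq X \subsetneq V(G)$. An edge-cut $C$ separates $T$ if at least two components of $G \setminus C$ contain vertices of $T$. A $T$-Steiner tree is a subgraph of $G$ which is a tree and whose vertex set contains $T$. *)

theory Defs
  imports Main
begin

text \<open>
  Undirected multigraphs. Parallel edges are distinct elements of \<open>edges\<close> with the same
  value of \<open>ends\<close>; a loop is an edge whose set of ends is a singleton.
\<close>

record ('v, 'e) mgraph =
  vertices :: "'v set"
  edges :: "'e set"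
  ends :: "'e \<Rightarrow> 'v set"

text \<open>
  As usual in graph theory, a graph is finite and has at least one vertex.
\<close>

definition is_mgraph :: "('v, 'e) mgraph \<Rightarrow> bool" where
  "is_mgraph G \<longleftrightarrow>
     finite (vertices G) \<and> vertices G \<noteq> {} \<and> finite (edges G) \<and>
     (\<forall>e\<in>edges G. \<exists>u\<in>vertices G. \<exists>v\<in>vertices G. ends G e = {u, v})"

text \<open>
  The functions \<open>ends\<close> are required to agree everywhere, not only on the edges of \<open>H\<close>, so that a
  subgraph is determined by its vertices and edges; otherwise counting distinct
  components would be meaningless.
\<close>

definition msubgraph :: "('v, 'e) mgraph \<Rightarrow> ('v, 'e) mgraph \<Rightarrow> bool" where
  "msubgraph H G \<longleftrightarrow>
     is_mgraph H \<and> vertices H \<subseteq> vertices G \<and> edges H \<subseteq> edges G \<and> ends H = ends G"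

definition adjacency :: "('v, 'e) mgraph \<Rightarrow> ('v \<times> 'v) set" where
  "adjacency G = {(u, v). \<exists>e\<in>edges G. ends G e = {u, v}}"

definition mconnected :: "('v, 'e) mgraph \<Rightarrow> bool" where
  "mconnected G \<longleftrightarrow> (\<forall>u\<in>vertices G. \<forall>v\<in>vertices G. (u, v) \<in> (adjacency G)\<^sup>*)"

definition is_component :: "('v, 'e) mgraph \<Rightarrow> ('v, 'e) mgraph \<Rightarrow> bool" where
  "is_component K G \<longleftrightarrow>
     msubgraph K G \<and> mconnected K \<and>
     (\<forall>L. msubgraph L G \<and> mconnected L \<and> msubgraph K L \<longrightarrow> L = K)"

text \<open>
  A cycle is given by its cyclic sequences of distinct vertices and distinct edges. A loop is a
  cycle of length 1, and two parallel edges form a cycle of length 2.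
\<close>

definition is_cycle :: "('v, 'e) mgraph \<Rightarrow> 'v list \<Rightarrow> 'e list \<Rightarrow> bool" where
  "is_cycle G vs es \<longleftrightarrow>
     vs \<noteq> [] \<and> length es = length vs \<and> distinct vs \<and> distinct es \<and>
     set vs \<subseteq> vertices G \<and> set es \<subseteq> edges G \<and>
     (\<forall>i<length vs. ends G (es ! i) = {vs ! i, vs ! (Suc i mod length vs)})"

definition is_tree :: "('v, 'e) mgraph \<Rightarrow> bool" where
  "is_tree G \<longleftrightarrow> is_mgraph G \<and> mconnected G \<and> (\<nexists>vs es. is_cycle G vs es)"

definition steiner_tree :: "('v, 'e) mgraph \<Rightarrow> 'v set \<Rightarrow> ('v, 'e) mgraph \<Rightarrow> bool" where
  "steiner_tree G T H \<longleftrightarrow> msubgraph H G \<and> is_tree H \<and> T \<subseteq> vertices H"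

text \<open>Both ends of a loop coincide, so a loop never lies in \<open>edge_boundary G X\<close>.\<close>

definition edge_boundary :: "('v, 'e) mgraph \<Rightarrow> 'v set \<Rightarrow> 'e set" where
  "edge_boundary G X = {e \<in> edges G. \<exists>u v. ends G e = {u, v} \<and> u \<in> X \<and> v \<notin> X}"

definition edge_cut :: "('v, 'e) mgraph \<Rightarrow> 'e set \<Rightarrow> bool" where
  "edge_cut G C \<longleftrightarrow> (\<exists>X. X \<noteq> {} \<and> X \<subset> vertices G \<and> C = edge_boundary G X)"

definition delete_edges :: "('v, 'e) mgraph \<Rightarrow> 'e set \<Rightarrow> ('v, 'e) mgraph" where
  "delete_edges G C = G\<lparr>edges := edges G - C\<rparr>"

definition cut_separates :: "('v, 'e) mgraph \<Rightarrow> 'e set \<Rightarrow> 'v set \<Rightarrow> bool" where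
  "cut_separates G C T \<longleftrightarrow>
     (\<exists>K L. is_component K (delete_edges G C) \<and> is_component L (delete_edges G C) \<and> K \<noteq> L \<and>
            vertices K \<inter> T \<noteq> {} \<and> vertices L \<inter> T \<noteq> {})"

end

theory Submission
  imports Defs "HOL-Library.Disjoint_Sets"
begin

text \<open>
  The proof goes through a stronger statement about extending colourings. At a terminal \<open>v\<close> of
  degree \<open>5k + 4\<close> some of the edges, at most \<open>4k + 4\<close> of them, are coloured with the \<open>k\<close> colours,
  all of which occur. This colouring extends to all edges so that every colour class without its
  edges at \<open>v\<close> connects the other terminals and the other ends of its edges at \<open>v\<close>, and so that every
  further terminal of degree \<open>5k + 4\<close> meets at most \<open>4k + 4\<close> coloured edges. The bound \<open>4k + 4\<close> makes
  an induction possible: both sides of a tight cut can be contracted, and the colours found on one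
  side are prescribed on the other. Deleting edges in no tight cut and splitting off pairs of edges
  at nonterminals leaves a graph whose nonterminals have degree three, that is, a hypergraph on the
  terminals with links of size at most three.

  For the hypergraph one needs a sparse trimming with \<open>k(|N| - 1)\<close> links, which is a union of \<open>k\<close>
  spanning trees by the theorem of Nash-Williams and Tutte, in which the degrees are bounded as
  well. A trimming with least total violation of the degree bounds is taken. If it violates some of
  them, then the vertices at which no local change yields a smaller degree, together with the
  maximal rigid sets of the remaining vertices, form a partition that too few links cross for all
  its parts to have boundary at least \<open>5k + 4\<close>.
\<close>

section \<open>Forests in multigraphs\<close>

text \<open>Gluing along a tight cut dictates the stronger statement. When the side \<open>Z\<close>
  has been contracted to a terminal \<open>z\<close>, the classes pass through \<open>z\<close>; to
  expand \<open>z\<close> again, each class must connect, inside \<open>Z\<close>, the terminals and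
  the ends of its cut edges. This is the clause on a class without its edges at \<open>v\<close>,
  read in the graph whose contracted side is \<open>v\<close>. As the coloured edges at
  \<open>z\<close> become a prescription there, the bound 4k + 4 has to be a conclusion at the other
  terminals and not only a hypothesis at \<open>v\<close>. The constants meet in counting links
  across a partition of the terminals other than \<open>v\<close> into p parts. The boundaries add
  up to at least (5k + 4)p, to which \<open>v\<close> contributes at most 5k + 4, the coloured links
  at most 4k + 4 more, and each uncoloured link at most 3. For p >= 3 this leaves k(p - 1)
  uncoloured links, as a base needs. For p = 2 it may not, and the deficit is filled by coloured
  links, which must then end up in different trees. Size three of the links is used beyond counting:
  two disjoint trimmed values do not fit into one link, so changes in disjoint rigid sets never
  interfere.\<close>

text \<open>Only values with one or two elements contribute, and singletons act as loops; a coloured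
  link attached to a single vertex is therefore harmless in its class.\<close>

definition linked :: "('l \<Rightarrow> 'a set) \<Rightarrow> 'l set \<Rightarrow> ('a \<times> 'a) set" where
  "linked A F = {(x, y). \<exists>f\<in>F. A f = {x, y}}\<^sup>*"

lemma linked_refl [simp]: "(x, x) \<in> linked A F"
  by (simp add: linked_def)

lemma linked_edge: "f \<in> F \<Longrightarrow> A f = {x, y} \<Longrightarrow> (x, y) \<in> linked A F"
  by (auto simp: linked_def)

lemma linked_trans: "(x, y) \<in> linked A F \<Longrightarrow> (y, z) \<in> linked A F \<Longrightarrow> (x, z) \<in> linked A F"
  by (simp add: linked_def)

lemma linked_sym: "(x, y) \<in> linked A F \<Longrightarrow> (y, x) \<in> linked A F"
proof -
  have "sym {(x, y). \<exists>f\<in>F. A f = {x, y}}"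
    by (auto simp: sym_def insert_commute)
  then show "(x, y) \<in> linked A F \<Longrightarrow> (y, x) \<in> linked A F"
    unfolding linked_def by (meson sym_rtrancl symD)
qed

lemma linked_mono: "F \<subseteq> G \<Longrightarrow> linked A F \<subseteq> linked A G"
  unfolding linked_def by (rule rtrancl_mono) auto

lemma linked_subset:
  assumes "\<And>x. (x, x) \<in> R" and "\<And>x y z. (x, y) \<in> R \<Longrightarrow> (y, z) \<in> R \<Longrightarrow> (x, z) \<in> R"
    and "\<And>f x y. f \<in> F \<Longrightarrow> A f = {x, y} \<Longrightarrow> (x, y) \<in> R"
  shows "linked A F \<subseteq> R"
proof
  fix p assume "p \<in> linked A F"
  then obtain x y where p: "p = (x, y)" and "(x, y) \<in> {(x, y). \<exists>f\<in>F. A f = {x, y}}\<^sup>*"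
    by (cases p) (auto simp: linked_def)
  from this(2) have "(x, y) \<in> R"
    by (induction rule: rtrancl_induct) (use assms in auto)
  with p show "p \<in> R" by simp
qed

lemma linked_idem: "(\<And>f x y. f \<in> F \<Longrightarrow> A f = {x, y} \<Longrightarrow> (x, y) \<in> linked A G) \<Longrightarrow> linked A F \<subseteq> linked A G"
  by (rule linked_subset) (auto intro: linked_trans)

text \<open>A shortest walk uses the new edge at most once, in one of two directions; the union of
  these possibilities is already a transitive relation.\<close>

lemma linked_insertE:
  assumes "(x, y) \<in> linked A (insert f F)" and f: "A f = {a, b}"
  obtains "(x, y) \<in> linked A F"
    | "(x, a) \<in> linked A F" "(b, y) \<in> linked A F"
    | "(x, b) \<in> linked A F" "(a, y) \<in> linked A F"
proof -
  let ?R = "{(x, y). (x, y) \<in> linked A F \<or> (x, a) \<in> linked A F \<and> (b, y) \<in> linked A F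
     \<or> (x, b) \<in> linked A F \<and> (a, y) \<in> linked A F}"
  have "linked A (insert f F) \<subseteq> ?R"
  proof (rule linked_subset)
    fix x y z assume "(x, y) \<in> ?R" "(y, z) \<in> ?R"
    then show "(x, z) \<in> ?R"
      by (auto intro: linked_trans linked_sym)
  next
    fix g x y assume "g \<in> insert f F" "A g = {x, y}"
    then show "(x, y) \<in> ?R"
      using f by (auto intro: linked_edge simp: doubleton_eq_iff)
  qed simp
  then show thesis using assms(1) that by auto
qed

lemma linked_inside:
  assumes "(x, y) \<in> linked A F" "x \<in> U" "\<And>f. f \<in> F \<Longrightarrow> A f \<subseteq> U"
  shows "y \<in> U"
proof -
  have "linked A F \<subseteq> {(x, y). x \<in> U \<longrightarrow> y \<in> U}"
    by (rule linked_subset) (use assms(3) in auto)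
  then show ?thesis using assms by auto
qed

text \<open>Acyclicity in the form that every member is a bridge, so that no cycles have to be
  handled.\<close>

definition forest :: "('l \<Rightarrow> 'a set) \<Rightarrow> 'l set \<Rightarrow> bool" where
  "forest A F \<longleftrightarrow> (\<forall>f\<in>F. \<forall>a b. A f = {a, b} \<longrightarrow> (a, b) \<notin> linked A (F - {f}))"

lemma forest_subset: "forest A F \<Longrightarrow> G \<subseteq> F \<Longrightarrow> forest A G"
  unfolding forest_def using linked_mono[of "G - {f}" "F - {f}" for f] by blast

text \<open>If an old member ceased to be a bridge, the detour would pass through \<open>e\<close>,
  and together with that member it would link \<open>x\<close> to \<open>y\<close> inside
  \<open>F\<close>.\<close>

lemma forest_insert:
  assumes "forest A F" "A e = {x, y}" "(x, y) \<notin> linked A F"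
  shows "forest A (insert e F)"
  unfolding forest_def
proof (intro ballI allI impI notI)
  fix f a b assume f: "f \<in> insert e F" and ab: "A f = {a, b}"
    and l: "(a, b) \<in> linked A (insert e F - {f})"
  show False
  proof (cases "f = e")
    case True
    have "(a, b) \<in> linked A F"
      using l True linked_mono[of "insert e F - {e}" F A] by auto
    moreover have "(a, b) = (x, y) \<or> (a, b) = (y, x)"
      using ab True assms(2) by (auto simp: doubleton_eq_iff)
    ultimately show False using assms(3) linked_sym by fastforce
  next
    case False
    then have fF: "f \<in> F" using f by simp
    have eq: "insert e F - {f} = insert e (F - {f})" using False by auto
    have n: "(a, b) \<notin> linked A (F - {f})" using assms(1) fF ab by (auto simp: forest_def)
    have m: "linked A (F - {f}) \<subseteq> linked A F" by (rule linked_mono) auto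
    have ba: "(b, a) \<in> linked A F" "(a, b) \<in> linked A F"
      using linked_edge[OF fF, of A a b] ab linked_sym by auto
    from l[unfolded eq] assms(2) show False
    proof (cases rule: linked_insertE)
      case 2
      then have "(x, y) \<in> linked A F" using m ba by (meson linked_sym linked_trans subsetD)
      then show False using assms(3) by simp
    next
      case 3
      then have "(x, y) \<in> linked A F" using m ba by (meson linked_sym linked_trans subsetD)
      then show False using assms(3) by simp
    qed (use n in simp)
  qed
qed

text \<open>Deleting a member \<open>ab\<close> leaves the vertices reachable from \<open>a\<close>
  and the rest, with no remaining member between them. Both sides are smaller, so induction on the
  number of vertices applies.\<close>

lemma forest_card:
  assumes "finite U" "U \<noteq> {}" "finite F" "forest A F" "\<And>f. f \<in> F \<Longrightarrow> A f \<subseteq> U \<and> card (A f) = 2"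
  shows "card F + 1 \<le> card U"
  using assms
proof (induction "card U" arbitrary: U F rule: less_induct)
  case less
  show ?case
  proof (cases "F = {}")
    case True
    then show ?thesis using less.prems by (simp add: Suc_leI card_gt_0_iff)
  next
    case False
    then obtain f where f: "f \<in> F" by auto
    obtain a b where ab: "A f = {a, b}" "a \<noteq> b" using less.prems(5)[OF f] by (auto simp: card_2_iff)
    let ?G = "F - {f}"
    define X where "X = {y. (a, y) \<in> linked A ?G}"
    have nab: "(a, b) \<notin> linked A ?G" using less.prems(4) f ab by (auto simp: forest_def)
    have aU: "a \<in> U" "b \<in> U" using less.prems(5)[OF f] ab by auto
    have XU: "X \<subseteq> U" unfolding X_def
      using linked_inside[of a _ A ?G U] aU less.prems(5) by auto
    have aX: "a \<in> X" "b \<notin> X" using nab by (auto simp: X_def)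
    have cl: "A g \<subseteq> X \<or> A g \<subseteq> U - X" if g: "g \<in> ?G" for g
    proof -
      obtain x y where xy: "A g = {x, y}" using less.prems(5)[of g] g by (auto simp: card_2_iff)
      have e1: "(x, y) \<in> linked A ?G" "(y, x) \<in> linked A ?G"
        using linked_edge[of g ?G A x y] that xy linked_sym[of x y] by auto
      have "x \<in> X \<longleftrightarrow> y \<in> X"
        using e1 unfolding X_def by (auto intro: linked_trans linked_sym)
      then show ?thesis using xy less.prems(5)[of g] that by auto
    qed
    have "card X < card U" using XU aX aU less.prems(1) by (intro psubset_card_mono) auto
    moreover have "card (U - X) < card U" using XU aX aU less.prems(1) by (intro psubset_card_mono) auto
    moreover have fin: "finite X" using XU less.prems(1) finite_subset by auto
    moreover have "card {g \<in> ?G. A g \<subseteq> X} + 1 \<le> card X"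
      by (rule less.hyps) (use calculation less.prems aX in \<open>auto intro: forest_subset\<close>)
    moreover have "card {g \<in> ?G. A g \<subseteq> U - X} + 1 \<le> card (U - X)"
      by (rule less.hyps) (use calculation less.prems aX aU in \<open>auto intro: forest_subset\<close>)
    moreover have "card ?G \<le> card {g \<in> ?G. A g \<subseteq> X} + card {g \<in> ?G. A g \<subseteq> U - X}"
    proof -
      have "?G \<subseteq> {g \<in> ?G. A g \<subseteq> X} \<union> {g \<in> ?G. A g \<subseteq> U - X}" using cl by auto
      then have "card ?G \<le> card ({g \<in> ?G. A g \<subseteq> X} \<union> {g \<in> ?G. A g \<subseteq> U - X})"
        by (rule card_mono[rotated]) (use less.prems in auto)
      also have "\<dots> \<le> card {g \<in> ?G. A g \<subseteq> X} + card {g \<in> ?G. A g \<subseteq> U - X}" by (rule card_Un_le)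
      finally show ?thesis .
    qed
    moreover have "card U = card X + card (U - X)"
      using XU less.prems(1) fin by (metis card_Diff_subset card_mono le_add_diff_inverse)
    moreover have "card F = card ?G + 1" using f less.prems(3) by (metis Suc_eq_plus1 card_Suc_Diff1)
    ultimately show ?thesis by linarith
  qed
qed

text \<open>Two unlinked vertices would split the forest into two parts, and
  \<open>forest_card\<close> applied to both of them would give one member less than there
  are.\<close>

lemma forest_spanning:
  assumes U: "finite U" and F: "finite F" "forest A F" "\<And>f. f \<in> F \<Longrightarrow> A f \<subseteq> U \<and> card (A f) = 2"
    and c: "card U \<le> card F + 1" and xy: "x \<in> U" "y \<in> U"
  shows "(x, y) \<in> linked A F"
proof (rule ccontr)
  assume n: "(x, y) \<notin> linked A F"
  define X where "X = {y. (x, y) \<in> linked A F}"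
  have XU: "X \<subseteq> U" unfolding X_def using linked_inside[of x _ A F U] xy F by auto
  have aX: "x \<in> X" "y \<notin> X" using n by (auto simp: X_def)
  have cl: "A g \<subseteq> X \<or> A g \<subseteq> U - X" if g: "g \<in> F" for g
  proof -
    obtain x' y' where xy: "A g = {x', y'}" using F(3)[OF g] by (auto simp: card_2_iff)
    have e1: "(x', y') \<in> linked A F" "(y', x') \<in> linked A F"
      using linked_edge[of g F A x' y'] that xy linked_sym[of x' y'] by auto
    have "x' \<in> X \<longleftrightarrow> y' \<in> X"
      using e1 unfolding X_def by (auto intro: linked_trans linked_sym)
    then show ?thesis using xy F(3)[of g] that by auto
  qed
  have fin: "finite X" using XU U finite_subset by auto
  have 1: "card {g \<in> F. A g \<subseteq> X} + 1 \<le> card X"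
    by (rule forest_card) (use fin F aX in \<open>auto intro: forest_subset\<close>)
  have 2: "card {g \<in> F. A g \<subseteq> U - X} + 1 \<le> card (U - X)"
    by (rule forest_card) (use U F aX xy in \<open>auto intro: forest_subset\<close>)
  have "F \<subseteq> {g \<in> F. A g \<subseteq> X} \<union> {g \<in> F. A g \<subseteq> U - X}" using cl by auto
  then have "card F \<le> card ({g \<in> F. A g \<subseteq> X} \<union> {g \<in> F. A g \<subseteq> U - X})"
    by (rule card_mono[rotated]) (use F in auto)
  also have "\<dots> \<le> card {g \<in> F. A g \<subseteq> X} + card {g \<in> F. A g \<subseteq> U - X}" by (rule card_Un_le)
  finally have 3: "card F \<le> card {g \<in> F. A g \<subseteq> X} + card {g \<in> F. A g \<subseteq> U - X}" .
  have "card U = card X + card (U - X)"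
    using XU U fin by (metis card_Diff_subset card_mono le_add_diff_inverse)
  with 1 2 3 c show False by linarith
qed

text \<open>A vertex set grown from \<open>r\<close> along members that leave it gains at least one
  new member with every vertex.\<close>

lemma linked_card:
  assumes U: "finite U" "r \<in> U" and F: "finite F" "\<And>f. f \<in> F \<Longrightarrow> card (A f) = 2"
    and l: "\<And>x. x \<in> U \<Longrightarrow> (r, x) \<in> linked A {f \<in> F. A f \<subseteq> U}"
  shows "card U \<le> card {f \<in> F. A f \<subseteq> U} + 1"
proof -
  have "\<exists>W. r \<in> W \<and> W \<subseteq> U \<and> card W = n + 1 \<and> n \<le> card {f \<in> F. A f \<subseteq> W}" if "n + 1 \<le> card U" for n
    using that
  proof (induction n)
    case 0
    then show ?case using U by (intro exI[of _ "{r}"]) auto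
  next
    case (Suc n)
    then obtain W where W: "r \<in> W" "W \<subseteq> U" "card W = n + 1" "n \<le> card {f \<in> F. A f \<subseteq> W}" by auto
    have "W \<noteq> U" using W Suc.prems by auto
    then obtain x where x: "x \<in> U" "x \<notin> W" using W by auto
    have "\<exists>f\<in>F. A f \<subseteq> U \<and> A f \<inter> W \<noteq> {} \<and> \<not> A f \<subseteq> W"
    proof (rule ccontr)
      assume "\<not> ?thesis"
      then have h: "\<And>f. f \<in> F \<Longrightarrow> A f \<subseteq> U \<Longrightarrow> A f \<inter> W \<noteq> {} \<Longrightarrow> A f \<subseteq> W" by auto
      have "linked A {f \<in> F. A f \<subseteq> U} \<subseteq> {(x, y). x \<in> W \<longrightarrow> y \<in> W}"
        proof (rule linked_subset)
        fix f x y assume f: "f \<in> {f \<in> F. A f \<subseteq> U}" "A f = {x, y}"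
        then show "(x, y) \<in> {(x, y). x \<in> W \<longrightarrow> y \<in> W}" using h[of f] by auto
      qed auto
      then show False using l[OF x(1)] x W by auto
    qed
    then obtain f where f: "f \<in> F" "A f \<subseteq> U" "A f \<inter> W \<noteq> {}" "\<not> A f \<subseteq> W" by auto
    obtain p q where pq: "A f = {p, q}" using F(2)[OF f(1)] by (auto simp: card_2_iff)
    obtain a b where ab: "A f = {a, b}" "a \<in> W" "b \<notin> W"
      using f pq that[of p q] that[of q p] by (auto simp: insert_commute)
    have fW: "finite W" using W U finite_subset by auto
    have "insert f {f \<in> F. A f \<subseteq> W} \<subseteq> {f \<in> F. A f \<subseteq> insert b W}" using f ab by auto
    then have "card (insert f {f \<in> F. A f \<subseteq> W}) \<le> card {f \<in> F. A f \<subseteq> insert b W}"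
      by (rule card_mono[rotated]) (use F in auto)
    then have "Suc n \<le> card {f \<in> F. A f \<subseteq> insert b W}" using W f F by auto
    then show ?case using W f ab fW by (intro exI[of _ "insert b W"]) auto
  qed
  moreover have cU: "card U > 0" using U card_gt_0_iff by blast
  then have "card U - 1 + 1 \<le> card U" by simp
  ultimately obtain W where W: "W \<subseteq> U" "card W = card U - 1 + 1"
     "card U - 1 \<le> card {f \<in> F. A f \<subseteq> W}" by blast
  then have "W = U" using U cU card_subset_eq[of U W] by simp
  with W show ?thesis by simp
qed

section \<open>Exchanges between forests and the decomposition of sparse multigraphs\<close>

lemma forest_exchange:
  assumes "forest A F" "\<And>f. f \<in> F \<Longrightarrow> card (A f) = 2" "finite F"
    and xy: "(x, y) \<in> linked A F" "(x, y) \<notin> linked A G" "G \<subseteq> F"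
  obtains e where "e \<in> F - G" "(x, y) \<notin> linked A (F - {e})"
proof -
  \<comment> \<open>A minimal linking subset of \<open>F\<close> is the path from \<open>x\<close>
    to \<open>y\<close>. It is not contained in \<open>G\<close>, and since the path in a forest is
    unique, each of its members separates \<open>x\<close> from \<open>y\<close> when
    removed.\<close>
  define PP where "PP = {P. P \<subseteq> F \<and> (x, y) \<in> linked A P}"
  have "F \<in> PP" "finite PP" using xy assms(3) by (auto simp: PP_def)
  then obtain P where P: "P \<in> PP" "\<And>Q. Q \<in> PP \<Longrightarrow> Q \<subseteq> P \<Longrightarrow> Q = P"
    using finite_has_minimal[of PP] by auto
  have "\<not> P \<subseteq> G" using P xy linked_mono[of P G A] by (auto simp: PP_def)
  then obtain e where e: "e \<in> P" "e \<notin> G" by auto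
  have eF: "e \<in> F" using e P by (auto simp: PP_def)
  obtain a b where ab: "A e = {a, b}" using assms(2)[OF eF] by (auto simp: card_2_iff)
  have n: "(x, y) \<notin> linked A (P - {e})" using P(2)[of "P - {e}"] e P(1) by (fastforce simp: PP_def)
  have m: "linked A (P - {e}) \<subseteq> linked A (F - {e})" using P by (intro linked_mono) (auto simp: PP_def)
  have "(x, y) \<in> linked A (insert e (P - {e}))" using P e by (simp add: PP_def insert_absorb)
  then have d: "((x, a) \<in> linked A (P - {e}) \<and> (b, y) \<in> linked A (P - {e})) \<or>
     ((x, b) \<in> linked A (P - {e}) \<and> (a, y) \<in> linked A (P - {e}))"
    using ab n by (elim linked_insertE) auto
  have "(x, y) \<notin> linked A (F - {e})"
  proof
    assume "(x, y) \<in> linked A (F - {e})"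
    then have "(a, b) \<in> linked A (F - {e})" using d m by (meson linked_sym linked_trans subsetD)
    then show False using assms(1) eF ab by (auto simp: forest_def)
  qed
  then show thesis using that e eF by auto
qed

text \<open>The successive refinements of the trivial partition of the vertices into the components of
  one colour class inside each block, the classes being used cyclically. The uncoloured edge of a
  partial decomposition into forests is brought to ever earlier levels by exchanges.\<close>

fun level :: "('l \<Rightarrow> 'a set) \<Rightarrow> nat \<Rightarrow> 'l set \<Rightarrow> ('l \<Rightarrow> nat) \<Rightarrow> nat \<Rightarrow> ('a \<times> 'a) set" where
  "level A k M c 0 = UNIV"
| "level A k M c (Suc s) = linked A {f \<in> M. c f = s mod k \<and> A f \<times> A f \<subseteq> level A k M c s}"

lemma level_refl [simp]: "(x, x) \<in> level A k M c s"
  by (cases s) auto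

lemma level_sym: "(x, y) \<in> level A k M c s \<Longrightarrow> (y, x) \<in> level A k M c s"
  by (cases s) (auto intro: linked_sym)

lemma level_trans: "(x, y) \<in> level A k M c s \<Longrightarrow> (y, z) \<in> level A k M c s \<Longrightarrow> (x, z) \<in> level A k M c s"
  by (cases s) (auto intro: linked_trans)

lemma level_Suc_subset: "level A k M c (Suc s) \<subseteq> level A k M c s"
  unfolding level.simps(2)
  by (rule linked_subset) (auto intro: level_trans)

lemma level_edge: "A f = {x, y} \<Longrightarrow> A f \<times> A f \<subseteq> level A k M c s \<longleftrightarrow> (x, y) \<in> level A k M c s"
  by (auto intro: level_sym)

definition forest_colouring :: "('l \<Rightarrow> 'a set) \<Rightarrow> nat \<Rightarrow> 'l set \<Rightarrow> ('l \<Rightarrow> nat) \<Rightarrow> bool" where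
  "forest_colouring A k M c \<longleftrightarrow> (\<forall>f\<in>M. c f < k) \<and> (\<forall>i<k. forest A {f \<in> M. c f = i})"

text \<open>At the first level that separates \<open>x\<close> and \<open>y\<close>, of colour
  \<open>i\<close> say, either the whole class \<open>i\<close> leaves them unlinked and
  \<open>e\<close> takes this colour, or their path in the class has a member \<open>e'\<close>
  whose ends are already separated one level earlier. Then \<open>e\<close> replaces
  \<open>e'\<close>, which is now the uncoloured edge, separated at a smaller level.\<close>

lemma forest_augment:
  assumes L: "finite L" "\<And>f. f \<in> L \<Longrightarrow> card (A f) = 2" and k: "k > 0"
    and "e \<in> L" "A e = {x, y}" "forest_colouring A k (L - {e}) c" "(x, y) \<notin> level A k (L - {e}) c t"
  shows "\<exists>c. forest_colouring A k L c"
  using assms(4-7)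
proof (induction t arbitrary: e x y c rule: less_induct)
  case (less t)
  let ?M = "L - {e}"
  have fo: "forest A {f \<in> ?M. c f = i}" if "i < k" for i
    using less.prems(3) that by (auto simp: forest_colouring_def)
  show ?case
  proof (cases "\<exists>t'<t. (x, y) \<notin> level A k ?M c t'")
    case True
    then show ?thesis using less by blast
  next
    case False
    then have lo: "\<And>s. s < t \<Longrightarrow> (x, y) \<in> level A k ?M c s" by auto
    have "t \<noteq> 0" using less.prems(4) by (cases t) auto
    then obtain s where t: "t = Suc s" by (cases t) auto
    define i where "i = s mod k"
    have ik: "i < k" using k by (simp add: i_def)
    define F where "F = {f \<in> ?M. c f = i}"
    define G where "G = {f \<in> ?M. c f = i \<and> A f \<times> A f \<subseteq> level A k ?M c s}"
    have n: "(x, y) \<notin> linked A G" using less.prems(4) by (simp add: t G_def i_def)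
    have GF: "G \<subseteq> F" by (auto simp: G_def F_def)
    show ?thesis
    proof (cases "(x, y) \<in> linked A F")
      case False
      have "forest A {f \<in> L. (c(e := i)) f = j}" if "j < k" for j
      proof (cases "j = i")
        case True
        have "{f \<in> L. (c(e := i)) f = j} = insert e F" using True less.prems(1) by (auto simp: F_def)
        moreover have "forest A (insert e F)"
          using forest_insert[OF _ less.prems(2) False] fo[OF ik] by (simp add: F_def)
        ultimately show ?thesis by simp
      next
        case False
        have "{f \<in> L. (c(e := i)) f = j} = {f \<in> ?M. c f = j}" using False by auto
        then show ?thesis using fo[OF that] by simp
      qed
      moreover have "\<forall>f\<in>L. (c(e := i)) f < k" using less.prems(3) ik by (auto simp: forest_colouring_def)
      ultimately show ?thesis unfolding forest_colouring_def by blast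
    next
      case True
      have "forest A F" "finite F" "\<And>f. f \<in> F \<Longrightarrow> card (A f) = 2"
        using fo[OF ik] L by (auto simp: F_def)
      then obtain e' where e': "e' \<in> F" "e' \<notin> G" and ne': "(x, y) \<notin> linked A (F - {e'})"
        using forest_exchange[OF _ _ _ True n GF] by blast
      obtain a b where ab: "A e' = {a, b}" using e' L(2)[of e'] by (auto simp: F_def card_2_iff)
      have abs: "(a, b) \<notin> level A k ?M c s"
        using e' level_edge[of A e' a b k ?M c s] ab by (auto simp: F_def G_def)
      have e'L: "e' \<in> L" "e' \<noteq> e" "c e' = i" using e' by (auto simp: F_def)
      define c' where "c' = c(e := i)"
      let ?M' = "L - {e'}"
      have cl: "{f \<in> ?M'. c' f = i} = insert e (F - {e'})"
        using e'L less.prems(1) by (auto simp: F_def c'_def)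
      have cl': "{f \<in> ?M'. c' f = j} = {f \<in> ?M. c f = j}" if "j \<noteq> i" for j
        using e'L less.prems(1) that by (auto simp: F_def c'_def)
      have "forest A {f \<in> ?M'. c' f = j}" if "j < k" for j
      proof (cases "j = i")
        case True
        have "forest A (insert e (F - {e'}))"
          using forest_insert[OF forest_subset[OF fo[OF ik]] less.prems(2) ne'] by (auto simp: F_def)
        then show ?thesis using cl True by simp
      next
        case False
        then show ?thesis using cl' fo[OF that] by simp
      qed
      moreover have "\<forall>f\<in>?M'. c' f < k" using less.prems(3) ik by (auto simp: forest_colouring_def c'_def)
      ultimately have fc: "forest_colouring A k ?M' c'" unfolding forest_colouring_def by blast
      \<comment> \<open>The swap leaves the levels up to \<open>s\<close> intact. In colour
        \<open>i\<close>, the path between \<open>x\<close> and \<open>y\<close> runs inside each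
        such block and contains \<open>e'\<close>, so \<open>e\<close> and the rest of the path link
        the same vertices as before.\<close>
      have lev: "level A k ?M' c' j = level A k ?M c j" if "j \<le> s" for j
        using that
      proof (induction j)
        case (Suc j)
        let ?R = "level A k ?M c j"
        have IH: "level A k ?M' c' j = ?R" using Suc by simp
        have xyR: "(x, y) \<in> ?R" using lo Suc.prems t by simp
        show ?case
        proof (cases "j mod k = i")
          case False
          have "{f \<in> ?M'. c' f = j mod k \<and> A f \<times> A f \<subseteq> ?R} = {f \<in> ?M. c f = j mod k \<and> A f \<times> A f \<subseteq> ?R}"
            using cl'[OF False] by blast
          then show ?thesis by (simp add: IH)
        next
          case True
          define H where "H = {f \<in> F. A f \<times> A f \<subseteq> ?R}"
          have old: "level A k ?M c (Suc j) = linked A H"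
            using True by (simp add: H_def F_def conj_assoc)
          have eR: "A e \<times> A e \<subseteq> ?R" using xyR less.prems(2) level_edge by metis
          have "{f \<in> ?M'. c' f = j mod k \<and> A f \<times> A f \<subseteq> ?R} = {f \<in> {f \<in> ?M'. c' f = i}. A f \<times> A f \<subseteq> ?R}"
            using True by auto
          also have "\<dots> = {f \<in> insert e (F - {e'}). A f \<times> A f \<subseteq> ?R}" by (simp only: cl)
          also have "\<dots> = insert e (H - {e'})" using eR by (auto simp: H_def)
          finally have new: "level A k ?M' c' (Suc j) = linked A (insert e (H - {e'}))" by (simp add: IH)
          have xyH: "(x, y) \<in> linked A H" using lo[of "Suc j"] Suc.prems t old by simp
          have HF: "H - {e'} \<subseteq> F - {e'}" by (auto simp: H_def)
          have nH: "(x, y) \<notin> linked A (H - {e'})" using ne' linked_mono[OF HF] by blast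
          then have eH: "e' \<in> H" using xyH by (cases "e' \<in> H") auto
          then have "(x, y) \<in> linked A (insert e' (H - {e'}))" using xyH by (simp add: insert_absorb)
          then have d: "((x, a) \<in> linked A (H - {e'}) \<and> (b, y) \<in> linked A (H - {e'})) \<or>
              ((x, b) \<in> linked A (H - {e'}) \<and> (a, y) \<in> linked A (H - {e'}))"
            using ab nH by (elim linked_insertE) auto
          have m: "linked A (H - {e'}) \<subseteq> linked A (insert e (H - {e'}))" by (rule linked_mono) auto
          have "(x, y) \<in> linked A (insert e (H - {e'}))" by (rule linked_edge[of e]) (simp_all add: less.prems(2))
          then have ab': "(a, b) \<in> linked A (insert e (H - {e'}))"
            using d m by (meson linked_sym linked_trans subsetD)
          have "linked A H \<subseteq> linked A (insert e (H - {e'}))"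
          proof (rule linked_idem)
            fix f p q assume "f \<in> H" "A f = {p, q}"
            then show "(p, q) \<in> linked A (insert e (H - {e'}))"
              using ab ab' linked_sym
              by (cases "f = e'") (auto simp: doubleton_eq_iff intro: linked_edge)
          qed
          moreover have "linked A (insert e (H - {e'})) \<subseteq> linked A H"
          proof (rule linked_idem)
            fix f p q assume "f \<in> insert e (H - {e'})" "A f = {p, q}"
            then show "(p, q) \<in> linked A H"
              using xyH less.prems(2) linked_sym
              by (cases "f = e") (auto simp: doubleton_eq_iff intro: linked_edge)
          qed
          ultimately show ?thesis using old new by simp
        qed
      qed simp
      have "(a, b) \<notin> level A k ?M' c' s" using lev[of s] abs by simp
      then show ?thesis using less.IH[of s e' a b c'] t e'L ab fc by blast
    qed
  qed
qed

lemma card_colour_classes: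
  assumes "finite F" "\<And>f. f \<in> F \<Longrightarrow> c f < (k::nat)"
  shows "card F = (\<Sum>i<k. card {f \<in> F. c f = i})"
proof -
  have "card F = card (\<Union>i\<in>{..<k}. {f \<in> F. c f = i})"
    by (rule arg_cong[where f = card]) (use assms in auto)
  also have "\<dots> = (\<Sum>i<k. card {f \<in> F. c f = i})"
    by (rule card_UN_disjoint) (use assms in auto)
  finally show ?thesis .
qed

text \<open>Nash-Williams' arboricity theorem, by inserting edges one at a time. If no level
  separates the ends of the new edge, the block around \<open>x\<close> becomes constant, so each of
  the \<open>k\<close> classes connects this block inside itself. This takes
  \<open>k * (card U - 1)\<close> edges, and the new one exceeds the bound.\<close>

theorem sparse_forest_colouring:
  assumes N: "finite N" and k: "k > 0" and L: "finite L" "\<And>f. f \<in> L \<Longrightarrow> A f \<subseteq> N \<and> card (A f) = 2"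
    and sp: "\<And>U. U \<subseteq> N \<Longrightarrow> U \<noteq> {} \<Longrightarrow> card {f \<in> L. A f \<subseteq> U} + k \<le> k * card U"
  shows "\<exists>c. forest_colouring A k L c"
  using L sp
proof (induction L rule: finite_induct)
  case empty
  then show ?case by (auto simp: forest_colouring_def forest_def)
next
  case (insert e M)
  have "card {f \<in> M. A f \<subseteq> U} + k \<le> k * card U" if "U \<subseteq> N" "U \<noteq> {}" for U
  proof -
    have "card {f \<in> M. A f \<subseteq> U} \<le> card {f \<in> insert e M. A f \<subseteq> U}"
      by (rule card_mono) (use insert in auto)
    then show ?thesis using insert.prems(2)[OF that] by linarith
  qed
  then obtain c where c: "forest_colouring A k M c" using insert by auto
  obtain x y where xy: "A e = {x, y}" "x \<noteq> y" using insert.prems(1)[of e] by (auto simp: card_2_iff)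
  have xN: "x \<in> N" "y \<in> N" using insert.prems(1)[of e] xy by auto
  have M: "insert e M - {e} = M" using insert by auto
  have "\<exists>t. (x, y) \<notin> level A k M c t"
  proof (rule ccontr)
    assume "\<nexists>t. (x, y) \<notin> level A k M c t"
    then have all: "\<And>t. (x, y) \<in> level A k M c t" by auto
    define B where "B t = {z. (x, z) \<in> level A k M c t}" for t
    have anti: "B (Suc t) \<subseteq> B t" for t using level_Suc_subset by (fastforce simp: B_def)
    have anti': "B t \<subseteq> B s" if "s \<le> t" for s t
      using that anti by (induction t) (auto simp: le_Suc_eq)
    have "B 1 \<subseteq> N"
    proof -
      have "z \<in> N" if "(x, z) \<in> linked A {f \<in> M. c f = 0 mod k \<and> A f \<times> A f \<subseteq> UNIV}" for z
        by (rule linked_inside[OF that xN(1)]) (use insert.prems in auto)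
      then show ?thesis by (auto simp: B_def)
    qed
    have fin: "finite (B t)" if "t \<ge> 1" for t
      by (rule finite_subset[OF order_trans[OF anti'[OF that] \<open>B 1 \<subseteq> N\<close>] N])
    \<comment> \<open>Level 0 is \<open>UNIV\<close>, possibly infinite, so a least block is sought
      from level 1 on, where the blocks lie in \<open>N\<close>.\<close>
    obtain t where t: "t \<ge> 1" "\<And>s. s \<ge> 1 \<Longrightarrow> card (B t) \<le> card (B s)"
      using ex_has_least_nat[of "\<lambda>s. s \<ge> 1" 1 "\<lambda>s. card (B s)"] by auto
    have st: "B s = B t" if "s \<ge> t" for s
      by (rule card_seteq[OF fin[OF t(1)] anti'[OF that] t(2)]) (use that t in simp)
    define U where "U = B t"
    have UN: "U \<subseteq> N" using anti'[OF t(1)] \<open>B 1 \<subseteq> N\<close> by (simp add: U_def)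
    have fU: "finite U" using UN N finite_subset by auto
    have xU: "x \<in> U" "y \<in> U" using all by (auto simp: U_def B_def)
    have conn: "card U \<le> card {f \<in> M. c f = i \<and> A f \<subseteq> U} + 1" if i: "i < k" for i
    proof -
      \<comment> \<open>Beyond the stable level every colour still has its turn;
        \<open>t * k + i\<close> is such a level because \<open>k > 0\<close>.\<close>
      obtain s where s: "s \<ge> t" "s mod k = i"
        using i k by (intro that[of "t * k + i"]) (auto intro: trans_le_add1)
      have "(x, z) \<in> linked A {f \<in> {f \<in> M. c f = i}. A f \<subseteq> U}" if "z \<in> U" for z
      proof -
        let ?F = "{f \<in> M. c f = i \<and> A f \<times> A f \<subseteq> level A k M c s}"
        have "z \<in> B (Suc s)" using st[of "Suc s"] s that by (simp add: U_def)
        then have xz: "(x, z) \<in> linked A ?F" using s by (simp add: B_def)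
        have "linked A ?F \<subseteq> {(p, q). p \<in> U \<longrightarrow> q \<in> U \<and> (p, q) \<in> linked A {f \<in> {f \<in> M. c f = i}. A f \<subseteq> U}}"
        proof (rule linked_subset)
          fix f p q assume f: "f \<in> ?F" "A f = {p, q}"
          have "U = B s" using st[OF s(1)] by (simp add: U_def)
          then have "p \<in> U \<Longrightarrow> q \<in> U"
            using f level_trans unfolding B_def by fastforce
          then show "(p, q) \<in> {(p, q). p \<in> U \<longrightarrow> q \<in> U \<and> (p, q) \<in> linked A {f \<in> {f \<in> M. c f = i}. A f \<subseteq> U}}"
            using f by (auto intro: linked_edge)
        qed (auto intro: linked_trans)
        then show ?thesis using xz xU by auto
      qed
      then have "card U \<le> card {f \<in> {f \<in> M. c f = i}. A f \<subseteq> U} + 1"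
        by (intro linked_card[of _ x]) (use fU xU insert in auto)
      moreover have "{f \<in> {f \<in> M. c f = i}. A f \<subseteq> U} = {f \<in> M. c f = i \<and> A f \<subseteq> U}" by auto
      ultimately show ?thesis by simp
    qed
    have "card {f \<in> M. A f \<subseteq> U} = (\<Sum>i<k. card {f \<in> {f \<in> M. A f \<subseteq> U}. c f = i})"
      by (rule card_colour_classes) (use insert c in \<open>auto simp: forest_colouring_def\<close>)
    also have "\<dots> = (\<Sum>i<k. card {f \<in> M. c f = i \<and> A f \<subseteq> U})"
      by (intro sum.cong refl arg_cong[where f = card]) auto
    also have "\<dots> \<ge> (\<Sum>i<k. card U - 1)" using conn by (intro sum_mono) (auto simp: le_diff_conv)
    finally have "k * (card U - 1) \<le> card {f \<in> M. A f \<subseteq> U}" by simp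
    moreover have "k * card U = k * (card U - 1) + k"
      using fU xU by (cases "card U") auto
    moreover have "card {f \<in> insert e M. A f \<subseteq> U} = Suc (card {f \<in> M. A f \<subseteq> U})"
    proof -
      have "{f \<in> insert e M. A f \<subseteq> U} = insert e {f \<in> M. A f \<subseteq> U}" using xy xU by auto
      then show ?thesis using insert by simp
    qed
    moreover have "card {f \<in> insert e M. A f \<subseteq> U} + k \<le> k * card U"
      by (rule insert.prems(2)) (use UN xU in auto)
    ultimately show False by linarith
  qed
  then obtain t where "(x, y) \<notin> level A k M c t" by auto
  then show ?case
    by (intro forest_augment[of "insert e M" A k e x y c t]) (use insert k xy c M in auto)
qed

section \<open>Sparse trimmings of hypergraphs\<close>

text \<open>A configuration \<open>\<tau>\<close> trims every link \<open>h\<close> to a subset of \<open>A h\<close> with at least two elements,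
  or leaves it unused; then \<open>\<tau> h\<close> is empty.\<close>

locale link_system =
  fixes N :: "'a set" and L :: "'l set" and A :: "'l \<Rightarrow> 'a set" and k :: nat
  assumes finite_N: "finite N" and N_nonempty: "N \<noteq> {}" and finite_L: "finite L"
    and A_sub: "h \<in> L \<Longrightarrow> A h \<subseteq> N"
    and A_card: "h \<in> L \<Longrightarrow> 2 \<le> card (A h) \<and> card (A h) \<le> 3"
    and k_pos: "k > 0"
begin

definition inn :: "('l \<Rightarrow> 'a set) \<Rightarrow> 'a set \<Rightarrow> 'l set" where
  "inn \<tau> U = {h \<in> L. \<tau> h \<noteq> {} \<and> \<tau> h \<subseteq> U}"

definition config :: "('l \<Rightarrow> 'a set) \<Rightarrow> bool" where
  "config \<tau> \<longleftrightarrow> (\<forall>h\<in>L. \<tau> h = {} \<or> \<tau> h \<subseteq> A h \<and> 2 \<le> card (\<tau> h))"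

text \<open>The independence condition for \<open>k\<close> edge-disjoint forests. Rigid sets attain
  equality, and for two-element links a base is a union of \<open>k\<close> edge-disjoint spanning
  trees.\<close>

definition sparse :: "('l \<Rightarrow> 'a set) \<Rightarrow> bool" where
  "sparse \<tau> \<longleftrightarrow> (\<forall>U. U \<subseteq> N \<and> U \<noteq> {} \<longrightarrow> card (inn \<tau> U) + k \<le> k * card U)"

definition rigid :: "('l \<Rightarrow> 'a set) \<Rightarrow> 'a set \<Rightarrow> bool" where
  "rigid \<tau> U \<longleftrightarrow> U \<subseteq> N \<and> U \<noteq> {} \<and> card (inn \<tau> U) + k = k * card U"

definition base :: "('l \<Rightarrow> 'a set) \<Rightarrow> bool" where
  "base \<tau> \<longleftrightarrow> config \<tau> \<and> sparse \<tau> \<and> rigid \<tau> N"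

lemma finite_inn [simp]: "finite (inn \<tau> U)"
  using finite_L by (simp add: inn_def)

lemma finite_sub_N: "U \<subseteq> N \<Longrightarrow> finite U"
  using finite_N finite_subset by auto

lemma finite_A: "h \<in> L \<Longrightarrow> finite (A h)"
  using A_sub finite_sub_N by blast

lemma inn_mono: "U \<subseteq> V \<Longrightarrow> inn \<tau> U \<subseteq> inn \<tau> V"
  by (auto simp: inn_def)

lemma sparseD: "sparse \<tau> \<Longrightarrow> U \<subseteq> N \<Longrightarrow> U \<noteq> {} \<Longrightarrow> card (inn \<tau> U) + k \<le> k * card U"
  by (auto simp: sparse_def)

lemma config_sub: "config \<tau> \<Longrightarrow> h \<in> L \<Longrightarrow> \<tau> h \<subseteq> A h"
  by (auto simp: config_def)

lemma config_sub_N: "config \<tau> \<Longrightarrow> h \<in> L \<Longrightarrow> \<tau> h \<subseteq> N"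
  using config_sub A_sub by blast

lemma config_two:
  assumes "config \<tau>" "h \<in> L" "\<tau> h \<noteq> {}"
  obtains a b where "a \<in> \<tau> h" "b \<in> \<tau> h" "a \<noteq> b"
proof -
  have "2 \<le> card (\<tau> h)" using assms by (auto simp: config_def)
  then obtain S where "S \<subseteq> \<tau> h" "card S = 2" using obtain_subset_with_card_n by metis
  then show thesis using that by (auto simp: card_2_iff)
qed

lemma inn_singleton: "config \<tau> \<Longrightarrow> inn \<tau> {x} = {}"
  unfolding inn_def by (auto elim!: config_two)

lemma rigid_singleton: "config \<tau> \<Longrightarrow> x \<in> N \<Longrightarrow> rigid \<tau> {x}"
  by (simp add: rigid_def inn_singleton)

text \<open>Supermodularity with its exact defect, the links of the union that lie in neither set.
  For rigid sets that meet, the defect vanishes.\<close>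

lemma card_inn_Un:
  "card (inn \<tau> U) + card (inn \<tau> V) + card (inn \<tau> (U \<union> V) - inn \<tau> U - inn \<tau> V)
     = card (inn \<tau> (U \<union> V)) + card (inn \<tau> (U \<inter> V))"
proof -
  have i: "inn \<tau> U \<inter> inn \<tau> V = inn \<tau> (U \<inter> V)" by (auto simp: inn_def)
  have s: "inn \<tau> U \<union> inn \<tau> V \<subseteq> inn \<tau> (U \<union> V)" by (auto simp: inn_def)
  have "card (inn \<tau> U) + card (inn \<tau> V) = card (inn \<tau> U \<union> inn \<tau> V) + card (inn \<tau> (U \<inter> V))"
    using card_Un_Int[of "inn \<tau> U" "inn \<tau> V"] by (simp add: i)
  moreover have "card (inn \<tau> (U \<union> V)) = card (inn \<tau> U \<union> inn \<tau> V) + card (inn \<tau> (U \<union> V) - (inn \<tau> U \<union> inn \<tau> V))"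
    using card_Diff_subset[OF _ s] card_mono[OF _ s] by simp
  moreover have "inn \<tau> (U \<union> V) - (inn \<tau> U \<union> inn \<tau> V) = inn \<tau> (U \<union> V) - inn \<tau> U - inn \<tau> V" by auto
  ultimately show ?thesis by simp
qed

lemma k_card_Un:
  assumes "U \<subseteq> N" "V \<subseteq> N"
  shows "k * card U + k * card V = k * card (U \<union> V) + k * card (U \<inter> V)"
  using card_Un_Int[of U V] assms finite_sub_N by (metis distrib_left)

text \<open>Sparsity of the union and of the intersection squeezes the count, so equality holds
  throughout and no link of the union lies across.\<close>

lemma rigid_union_inter:
  assumes "sparse \<tau>" "rigid \<tau> U" "rigid \<tau> V" "U \<inter> V \<noteq> {}"
  shows "rigid \<tau> (U \<union> V)" "rigid \<tau> (U \<inter> V)" "inn \<tau> (U \<union> V) \<subseteq> inn \<tau> U \<union> inn \<tau> V"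
proof -
  have UV: "U \<subseteq> N" "V \<subseteq> N" "U \<union> V \<noteq> {}" using assms by (auto simp: rigid_def)
  have 1: "card (inn \<tau> (U \<union> V)) + k \<le> k * card (U \<union> V)" by (rule sparseD) (use assms UV in auto)
  have 2: "card (inn \<tau> (U \<inter> V)) + k \<le> k * card (U \<inter> V)" by (rule sparseD) (use assms UV in auto)
  have 3: "card (inn \<tau> U) + k = k * card U" "card (inn \<tau> V) + k = k * card V"
    using assms by (auto simp: rigid_def)
  note c = card_inn_Un[of \<tau> U V] k_card_Un[OF UV(1,2)]
  show "rigid \<tau> (U \<union> V)" unfolding rigid_def using UV 1 2 3 c by auto
  show "rigid \<tau> (U \<inter> V)" unfolding rigid_def using UV 1 2 3 c assms by auto
  have "card (inn \<tau> (U \<union> V) - inn \<tau> U - inn \<tau> V) = 0" using 1 2 3 c by linarith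
  then show "inn \<tau> (U \<union> V) \<subseteq> inn \<tau> U \<union> inn \<tau> V" by (simp add: card_eq_0_iff) blast
qed

lemma inn_update:
  "h \<in> L \<Longrightarrow> inn (\<tau>(h := S)) U = (inn \<tau> U - {h}) \<union> (if S \<noteq> {} \<and> S \<subseteq> U then {h} else {})"
  by (auto simp: inn_def)

text \<open>One changed link raises a spanned count by at most one, so a violated set was rigid
  before and has newly received \<open>h\<close>.\<close>

lemma sparse_updateD:
  assumes "sparse \<tau>" "h \<in> L" "\<not> sparse (\<tau>(h := S))"
  obtains U where "rigid \<tau> U" "S \<subseteq> U" "h \<notin> inn \<tau> U"
proof -
  obtain U where U: "U \<subseteq> N" "U \<noteq> {}" "k * card U < card (inn (\<tau>(h := S)) U) + k"
    using assms(3) by (auto simp: sparse_def not_le)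
  have sp: "card (inn \<tau> U) + k \<le> k * card U" by (rule sparseD) (use assms U in auto)
  have SU: "S \<noteq> {} \<and> S \<subseteq> U"
  proof (rule ccontr)
    assume "\<not> ?thesis"
    then have "card (inn (\<tau>(h := S)) U) \<le> card (inn \<tau> U)"
      using assms(2) by (intro card_mono) (auto simp: inn_update)
    then show False using U sp by linarith
  qed
  have eq: "inn (\<tau>(h := S)) U = insert h (inn \<tau> U)" using SU assms(2) by (auto simp: inn_update)
  have h: "h \<notin> inn \<tau> U"
  proof
    assume "h \<in> inn \<tau> U"
    then show False using U(3) sp eq by (simp add: insert_absorb)
  qed
  then have "card (inn (\<tau>(h := S)) U) = card (inn \<tau> U) + 1" using eq by simp
  then have "rigid \<tau> U" unfolding rigid_def using U sp by auto
  then show thesis using that SU h by auto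
qed

section \<open>Trimming links to pairs and packing spanning trees\<close>

text \<open>Two of the three pairs suffice as candidates. If \<open>{a, b}\<close> and
  \<open>{b, c}\<close> were both blocked, the blocking rigid sets would meet in \<open>b\<close>,
  and their union would contain the link while neither of them does.\<close>

lemma trim_one:
  assumes "config \<tau>" "sparse \<tau>" "h \<in> L" "card (\<tau> h) = 3"
  obtains S where "S \<subseteq> \<tau> h" "card S = 2" "sparse (\<tau>(h := S))"
proof -
  obtain a b c where abc: "\<tau> h = {a, b, c}" "a \<noteq> b" "b \<noteq> c" "a \<noteq> c"
    using assms(4) by (auto simp: card_3_iff)
  show thesis
  proof (rule ccontr)
    assume n: "\<not> thesis"
    have "\<not> sparse (\<tau>(h := {a, b}))" using n that[of "{a, b}"] abc by auto
    then obtain U where U: "rigid \<tau> U" "{a, b} \<subseteq> U" "h \<notin> inn \<tau> U"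
      using sparse_updateD assms by metis
    have "\<not> sparse (\<tau>(h := {b, c}))" using n that[of "{b, c}"] abc by auto
    then obtain V where V: "rigid \<tau> V" "{b, c} \<subseteq> V" "h \<notin> inn \<tau> V"
      using sparse_updateD assms by metis
    have "h \<in> inn \<tau> (U \<union> V)" using U V abc assms by (auto simp: inn_def)
    moreover have "inn \<tau> (U \<union> V) \<subseteq> inn \<tau> U \<union> inn \<tau> V"
      by (rule rigid_union_inter) (use U V assms in auto)
    ultimately show False using U V by auto
  qed
qed

lemma card_config_le: "config \<tau> \<Longrightarrow> h \<in> L \<Longrightarrow> card (\<tau> h) \<le> 3"
  using card_mono[OF finite_A config_sub, of h \<tau>] A_card[of h] by force

lemma trim_all:
  assumes "base \<tau>"
  obtains \<sigma> where "base \<sigma>" "\<And>h. h \<in> L \<Longrightarrow> \<sigma> h \<subseteq> \<tau> h"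
    "\<And>h. h \<in> L \<Longrightarrow> \<sigma> h = {} \<longleftrightarrow> \<tau> h = {}" "\<And>h. h \<in> L \<Longrightarrow> \<sigma> h \<noteq> {} \<Longrightarrow> card (\<sigma> h) = 2"
proof -
  have "\<exists>\<sigma>. base \<sigma> \<and> (\<forall>h\<in>L. \<sigma> h \<subseteq> \<tau> h \<and> (\<sigma> h = {} \<longleftrightarrow> \<tau> h = {}) \<and> (\<sigma> h \<noteq> {} \<longrightarrow> card (\<sigma> h) = 2))"
    using assms
  proof (induction "card {h \<in> L. card (\<tau> h) = 3}" arbitrary: \<tau> rule: less_induct)
    case less
    have cf: "config \<tau>" "sparse \<tau>" "rigid \<tau> N" using less.prems by (auto simp: base_def)
    show ?case
    proof (cases "\<exists>h\<in>L. card (\<tau> h) = 3")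
      case False
      have "card (\<tau> h) = 2" if h: "h \<in> L" "\<tau> h \<noteq> {}" for h
      proof -
        have "2 \<le> card (\<tau> h)" using cf(1) h by (auto simp: config_def)
        then show ?thesis using card_config_le[OF cf(1) h(1)] False h by force
      qed
      then show ?thesis using less.prems by blast
    next
      case True
      then obtain h where h: "h \<in> L" "card (\<tau> h) = 3" by auto
      obtain S where S: "S \<subseteq> \<tau> h" "card S = 2" "sparse (\<tau>(h := S))" using trim_one cf h by metis
      let ?t = "\<tau>(h := S)"
      have ne: "S \<noteq> {}" "\<tau> h \<noteq> {}" using S h by auto
      have "config ?t" using cf S h config_sub[OF cf(1) h(1)] by (auto simp: config_def)
      moreover have "inn ?t N = inn \<tau> N" using S h ne config_sub_N[OF cf(1)] by (auto simp: inn_def)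
      ultimately have b: "base ?t" using S cf by (auto simp: base_def rigid_def)
      have "{g \<in> L. card (?t g) = 3} \<subset> {h \<in> L. card (\<tau> h) = 3}" using S h by auto
      then have "card {g \<in> L. card (?t g) = 3} < card {h \<in> L. card (\<tau> h) = 3}"
        by (rule psubset_card_mono[rotated]) (use finite_L in auto)
      from less.hyps[OF this b] obtain \<sigma> where \<sigma>: "base \<sigma>" and
        s0: "\<forall>g\<in>L. \<sigma> g \<subseteq> ?t g \<and> (\<sigma> g = {} \<longleftrightarrow> ?t g = {}) \<and> (\<sigma> g \<noteq> {} \<longrightarrow> card (\<sigma> g) = 2)"
        by (elim exE conjE)
      note s = bspec[OF s0]
      have "\<sigma> g \<subseteq> \<tau> g \<and> (\<sigma> g = {} \<longleftrightarrow> \<tau> g = {}) \<and> (\<sigma> g \<noteq> {} \<longrightarrow> card (\<sigma> g) = 2)" if "g \<in> L" for g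
        using s[OF that] S ne by (cases "g = h") auto
      then show ?thesis using \<sigma> by blast
    qed
  qed
  then show thesis using that by metis
qed

text \<open>A base has \<open>k * (card N - 1)\<close> links, and a forest on \<open>N\<close> has
  at most \<open>card N - 1\<close> edges, so each of the \<open>k\<close> forests must be a
  spanning tree.\<close>

theorem base_tree_packing:
  assumes "base \<tau>"
  obtains \<sigma> c where "\<And>h. h \<in> L \<Longrightarrow> \<sigma> h \<subseteq> \<tau> h" "\<And>h. h \<in> L \<Longrightarrow> \<sigma> h = {} \<longleftrightarrow> \<tau> h = {}"
    "\<And>h. h \<in> L \<Longrightarrow> \<sigma> h \<noteq> {} \<Longrightarrow> card (\<sigma> h) = 2 \<and> c h < k"
    "\<And>i x y. i < k \<Longrightarrow> x \<in> N \<Longrightarrow> y \<in> N \<Longrightarrow> (x, y) \<in> linked \<sigma> {h \<in> L. \<sigma> h \<noteq> {} \<and> c h = i}"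
proof -
  obtain \<sigma> where \<sigma>: "base \<sigma>" "\<And>h. h \<in> L \<Longrightarrow> \<sigma> h \<subseteq> \<tau> h"
    "\<And>h. h \<in> L \<Longrightarrow> \<sigma> h = {} \<longleftrightarrow> \<tau> h = {}" "\<And>h. h \<in> L \<Longrightarrow> \<sigma> h \<noteq> {} \<Longrightarrow> card (\<sigma> h) = 2"
    using trim_all[OF assms] by blast
  define M where "M = {h \<in> L. \<sigma> h \<noteq> {}}"
  have M: "{h \<in> M. \<sigma> h \<subseteq> U} = inn \<sigma> U" for U by (auto simp: M_def inn_def)
  have cf: "config \<sigma>" "sparse \<sigma>" "rigid \<sigma> N" using \<sigma> by (auto simp: base_def)
  have MN: "\<sigma> h \<subseteq> N \<and> card (\<sigma> h) = 2" if "h \<in> M" for h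
    using that config_sub_N[OF cf(1), of h] \<sigma>(4)[of h] by (auto simp: M_def)
  have fM: "finite M" using finite_L by (simp add: M_def)
  have "\<exists>c. forest_colouring \<sigma> k M c"
    by (rule sparse_forest_colouring[OF finite_N k_pos fM MN])
      (use sparseD[OF cf(2)] in \<open>simp_all add: M\<close>)
  then obtain c where c: "forest_colouring \<sigma> k M c" by auto
  have fo: "forest \<sigma> {h \<in> M. c h = i}" if "i < k" for i using c that by (auto simp: forest_colouring_def)
  have le: "card {h \<in> M. c h = i} + 1 \<le> card N" if "i < k" for i
    by (rule forest_card[OF finite_N N_nonempty _ fo[OF that]]) (use fM MN in auto)
  have "inn \<sigma> N = M" using MN by (auto simp: M_def inn_def)
  then have "card M + k = k * card N" using cf(3) by (simp add: rigid_def)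
  moreover have "card M = (\<Sum>i<k. card {h \<in> M. c h = i})"
    by (rule card_colour_classes) (use fM c in \<open>auto simp: forest_colouring_def\<close>)
  ultimately have tot: "(\<Sum>i<k. card {h \<in> M. c h = i} + 1) = (\<Sum>i<k. card N)"
    by (simp add: sum_Suc)
  have eq: "card {h \<in> M. c h = i} + 1 = card N" if i: "i < k" for i
  proof (rule ccontr)
    assume "card {h \<in> M. c h = i} + 1 \<noteq> card N"
    then have "card {h \<in> M. c h = i} + 1 < card N" using le[OF i] by simp
    then have "(\<Sum>i<k. card {h \<in> M. c h = i} + 1) < (\<Sum>i<k. card N)"
      using i le by (intro sum_strict_mono_ex1) auto
    then show False using tot by simp
  qed
  have "(x, y) \<in> linked \<sigma> {h \<in> L. \<sigma> h \<noteq> {} \<and> c h = i}" if "i < k" "x \<in> N" "y \<in> N" for i x y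
  proof -
    have "(x, y) \<in> linked \<sigma> {h \<in> M. c h = i}"
      by (rule forest_spanning[OF finite_N _ fo[OF that(1)] _ _ that(2,3)]) (use fM MN eq[OF that(1)] in auto)
    moreover have "{h \<in> M. c h = i} = {h \<in> L. \<sigma> h \<noteq> {} \<and> c h = i}" by (auto simp: M_def)
    ultimately show ?thesis by simp
  qed
  moreover have "card (\<sigma> h) = 2 \<and> c h < k" if "h \<in> L" "\<sigma> h \<noteq> {}" for h
    using that \<sigma>(4) c by (auto simp: M_def forest_colouring_def)
  ultimately show thesis using that \<sigma> by blast
qed

section \<open>Maximal rigid sets and the existence of bases\<close>

text \<open>By uncrossing, rigid sets through a common vertex have a rigid union; for a vertex of
  \<open>N - S\<close> this is therefore the largest rigid set around it that avoids
  \<open>S\<close>.\<close>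

definition cls :: "('l \<Rightarrow> 'a set) \<Rightarrow> 'a set \<Rightarrow> 'a \<Rightarrow> 'a set" where
  "cls \<tau> S x = \<Union>{U. rigid \<tau> U \<and> x \<in> U \<and> U \<inter> S = {}}"

definition classes :: "('l \<Rightarrow> 'a set) \<Rightarrow> 'a set \<Rightarrow> 'a set set" where
  "classes \<tau> S = cls \<tau> S ` (N - S)"

lemma rigid_Union:
  assumes "sparse \<tau>" "finite \<U>" "\<U> \<noteq> {}" "\<And>U. U \<in> \<U> \<Longrightarrow> rigid \<tau> U \<and> x \<in> U"
  shows "rigid \<tau> (\<Union>\<U>)"
  using assms(2-4)
proof (induction \<U> rule: finite_ne_induct)
  case (insert U \<U>)
  have "rigid \<tau> (U \<union> \<Union>\<U>)"
    by (rule rigid_union_inter) (use insert assms(1) in auto)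
  then show ?case by simp
qed simp

lemma
  assumes "config \<tau>" "sparse \<tau>" "x \<in> N - S"
  shows rigid_cls: "rigid \<tau> (cls \<tau> S x)" and cls_refl: "x \<in> cls \<tau> S x"
    and cls_disjoint: "cls \<tau> S x \<inter> S = {}"
proof -
  let ?\<U> = "{U. rigid \<tau> U \<and> x \<in> U \<and> U \<inter> S = {}}"
  have x: "{x} \<in> ?\<U>" using assms rigid_singleton by auto
  have "?\<U> \<subseteq> Pow N" by (auto simp: rigid_def)
  then have "finite ?\<U>" using finite_N finite_subset by auto
  then show "rigid \<tau> (cls \<tau> S x)" unfolding cls_def using x
    by (intro rigid_Union[of _ _ x]) (use assms in auto)
  show "x \<in> cls \<tau> S x" unfolding cls_def using x by blast
  show "cls \<tau> S x \<inter> S = {}" unfolding cls_def by blast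
qed

lemma cls_upper: "rigid \<tau> U \<Longrightarrow> x \<in> U \<Longrightarrow> U \<inter> S = {} \<Longrightarrow> U \<subseteq> cls \<tau> S x"
  unfolding cls_def by blast

lemma cls_eq:
  assumes "config \<tau>" "sparse \<tau>" "x \<in> N - S" "y \<in> cls \<tau> S x"
  shows "cls \<tau> S y = cls \<tau> S x"
proof -
  have y: "y \<in> N - S" using rigid_cls[OF assms(1-3)] cls_disjoint[OF assms(1-3)] assms(4)
    by (auto simp: rigid_def)
  have sub: "cls \<tau> S x \<subseteq> cls \<tau> S y"
    by (rule cls_upper) (use rigid_cls cls_disjoint assms in auto)
  moreover have "cls \<tau> S y \<subseteq> cls \<tau> S x"
    by (rule cls_upper) (use rigid_cls[OF assms(1,2) y] cls_disjoint[OF assms(1,2) y] cls_refl[OF assms(1-3)] sub in auto)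
  ultimately show ?thesis by simp
qed

lemma partition_classes:
  assumes "config \<tau>" "sparse \<tau>" "S \<subseteq> N"
  shows "partition_on (N - S) (classes \<tau> S)"
proof (rule partition_onI)
  have "cls \<tau> S x \<subseteq> N - S \<and> x \<in> cls \<tau> S x" if "x \<in> N - S" for x
    using cls_refl[OF assms(1,2) that] rigid_cls[OF assms(1,2) that] cls_disjoint[OF assms(1,2) that]
    by (auto simp: rigid_def)
  then show "\<Union> (classes \<tau> S) = N - S"
    unfolding classes_def by blast
next
  fix p q assume "p \<in> classes \<tau> S" "q \<in> classes \<tau> S" "p \<noteq> q"
  then obtain x y where xy: "x \<in> N - S" "p = cls \<tau> S x" "y \<in> N - S" "q = cls \<tau> S y"
    by (auto simp: classes_def)
  have "z \<notin> q" if "z \<in> p" for z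
  proof
    assume "z \<in> q"
    then have "p = q"
      using cls_eq[OF assms(1,2) xy(1), of z] cls_eq[OF assms(1,2) xy(3), of z] that xy by simp
    with \<open>p \<noteq> q\<close> show False by simp
  qed
  then show "disjnt p q" by (auto simp: disjnt_def)
next
  show "{} \<notin> classes \<tau> S" using cls_refl[OF assms(1,2)] by (force simp: classes_def)
qed

lemma classes_rigid: "config \<tau> \<Longrightarrow> sparse \<tau> \<Longrightarrow> D \<in> classes \<tau> S \<Longrightarrow> rigid \<tau> D"
  unfolding classes_def using rigid_cls by blast

lemma finite_classes: "finite (classes \<tau> S)"
  using finite_N by (simp add: classes_def)

text \<open>The used links that survive when every class is contracted to a point, the vertices of
  \<open>S\<close> remaining points of their own.\<close>

definition active :: "('l \<Rightarrow> 'a set) \<Rightarrow> 'a set \<Rightarrow> 'l set" where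
  "active \<tau> S = {h \<in> inn \<tau> N. \<forall>D\<in>classes \<tau> S. \<not> \<tau> h \<subseteq> D}"

text \<open>Contracting a class \<open>D\<close> removes exactly \<open>k * (card D - 1)\<close>
  links. For a base, \<open>k * (card S + card (classes \<tau> S) - 1)\<close> links are thus
  active.\<close>

lemma card_active:
  assumes "config \<tau>" "sparse \<tau>" "S \<subseteq> N"
  shows "card (active \<tau> S) + k * card (N - S) = card (inn \<tau> N) + k * card (classes \<tau> S)"
proof -
  let ?C = "classes \<tau> S"
  note part = partition_classes[OF assms]
  have rg: "rigid \<tau> D" if "D \<in> ?C" for D using classes_rigid assms that by blast
  have dis: "D \<inter> D' = {}" if "D \<in> ?C" "D' \<in> ?C" "D \<noteq> D'" for D D'
    using part that unfolding partition_on_def disjoint_def by blast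
  have "inn \<tau> N = active \<tau> S \<union> (\<Union>D\<in>?C. inn \<tau> D)"
    using rg by (auto simp: active_def inn_def rigid_def)
  moreover have "active \<tau> S \<inter> (\<Union>D\<in>?C. inn \<tau> D) = {}"
    by (auto simp: active_def inn_def)
  moreover have "finite (active \<tau> S)" by (simp add: active_def)
  ultimately have "card (inn \<tau> N) = card (active \<tau> S) + card (\<Union>D\<in>?C. inn \<tau> D)"
    using finite_classes by (simp add: card_Un_disjoint)
  also have "card (\<Union>D\<in>?C. inn \<tau> D) = (\<Sum>D\<in>?C. card (inn \<tau> D))"
  proof (rule card_UN_disjoint[OF finite_classes], intro ballI finite_inn, intro ballI impI)
    fix D D' assume "D \<in> ?C" "D' \<in> ?C" "D \<noteq> D'"
    then show "inn \<tau> D \<inter> inn \<tau> D' = {}" using dis[of D D'] by (auto simp: inn_def)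
  qed
  finally have 1: "card (inn \<tau> N) = card (active \<tau> S) + (\<Sum>D\<in>?C. card (inn \<tau> D))" .
  have "(\<Sum>D\<in>?C. card (inn \<tau> D)) + k * card ?C = (\<Sum>D\<in>?C. card (inn \<tau> D) + k)"
    by (simp add: sum.distrib)
  also have "\<dots> = (\<Sum>D\<in>?C. k * card D)" using rg by (intro sum.cong) (auto simp: rigid_def)
  also have "\<dots> = k * (\<Sum>D\<in>?C. card D)" by (simp add: sum_distrib_left)
  also have "(\<Sum>D\<in>?C. card D) = card (N - S)"
  proof -
    have "card (\<Union>?C) = sum card ?C"
      by (rule card_Union_disjoint)
        (use part rg finite_sub_N in \<open>auto simp: partition_on_def rigid_def pairwise_def disjnt_def disjoint_def\<close>)
    then show ?thesis using part by (simp add: partition_on_def)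
  qed
  finally show ?thesis using 1 by linarith
qed

theorem base_exists:
  assumes "\<And>P. partition_on N P \<Longrightarrow> k * card P \<le> card {h \<in> L. \<forall>D\<in>P. \<not> A h \<subseteq> D} + k"
  obtains \<tau> where "base \<tau>"
proof -
  \<comment> \<open>A link is taken whole or not at all: the hypothesis speaks of the untrimmed
    \<open>A h\<close>, and trimming is left to \<open>trim_all\<close>.\<close>
  define Q where "Q \<tau> \<longleftrightarrow> (\<forall>h\<in>L. \<tau> h = {} \<or> \<tau> h = A h) \<and> sparse \<tau>" for \<tau>
  have "inn (\<lambda>h. {}) U = {}" for U by (auto simp: inn_def)
  then have "Q (\<lambda>h. {})"
    using finite_sub_N by (auto simp: Q_def sparse_def card_gt_0_iff Suc_le_eq)
  moreover have "\<forall>\<tau>. Q \<tau> \<longrightarrow> card (inn \<tau> N) < Suc (card L)"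
    using finite_L by (auto intro!: card_mono simp: inn_def less_Suc_eq_le)
  ultimately obtain \<tau> where \<tau>: "Q \<tau>" and mx: "\<And>\<sigma>. Q \<sigma> \<Longrightarrow> card (inn \<sigma> N) \<le> card (inn \<tau> N)"
    using ex_has_greatest_nat[of Q "\<lambda>h. {}" "\<lambda>\<tau>. card (inn \<tau> N)" "Suc (card L)"] by metis
  have cf: "config \<tau>" "sparse \<tau>" using \<tau> A_card by (force simp: Q_def config_def)+
  let ?C = "classes \<tau> {}"
  have part: "partition_on N ?C" using partition_classes[OF cf, of "{}"] by simp
  have "{h \<in> L. \<forall>D\<in>?C. \<not> A h \<subseteq> D} \<subseteq> active \<tau> {}"
  proof
    fix h assume h: "h \<in> {h \<in> L. \<forall>D\<in>?C. \<not> A h \<subseteq> D}"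
    have ne: "A h \<noteq> {}" using A_card[of h] h by auto
    have "\<tau> h \<noteq> {}"
    proof
      assume e: "\<tau> h = {}"
      let ?s = "\<tau>(h := A h)"
      have "inn ?s N = insert h (inn \<tau> N)" using h A_sub ne by (auto simp: inn_update)
      moreover have "h \<notin> inn \<tau> N" using e by (simp add: inn_def)
      ultimately have "\<not> Q ?s" using mx[of ?s] by auto
      moreover have "\<forall>g\<in>L. ?s g = {} \<or> ?s g = A g" using \<tau> by (simp add: Q_def)
      ultimately have ns: "\<not> sparse ?s" by (auto simp only: Q_def)
      obtain U where U: "rigid \<tau> U" "A h \<subseteq> U"
        by (rule sparse_updateD[OF cf(2) _ ns]) (use h in auto)
      obtain x where x: "x \<in> A h" using ne by auto
      then have "x \<in> N" using h A_sub by auto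
      moreover have "A h \<subseteq> cls \<tau> {} x" using U cls_upper[of \<tau> U x "{}"] x by auto
      ultimately show False using h by (auto simp: classes_def)
    qed
    then have "\<tau> h = A h" using \<tau> h by (auto simp: Q_def)
    then show "h \<in> active \<tau> {}" using h ne A_sub by (auto simp: active_def inn_def)
  qed
  then have "card {h \<in> L. \<forall>D\<in>?C. \<not> A h \<subseteq> D} \<le> card (active \<tau> {})"
    by (rule card_mono[rotated]) (simp add: active_def)
  with assms[OF part] card_active[OF cf, of "{}"] have "k * card N \<le> card (inn \<tau> N) + k" by simp
  with sparseD[OF cf(2), of N] have "rigid \<tau> N" using N_nonempty by (simp add: rigid_def)
  with cf show thesis using that by (simp add: base_def)
qed

end

section \<open>Sparse trimmings with bounded degrees\<close>

locale capped_link_system = link_system N L A k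
  for N :: "'a set" and L :: "'l set" and A :: "'l \<Rightarrow> 'a set" and k :: nat +
  fixes cap :: "'a \<Rightarrow> nat"
begin

section \<open>Loads, and exchanges confined to a rigid set\<close>

definition load :: "('l \<Rightarrow> 'a set) \<Rightarrow> 'a \<Rightarrow> nat" where
  "load \<tau> x = card {h \<in> L. x \<in> \<tau> h}"

definition bad :: "('l \<Rightarrow> 'a set) \<Rightarrow> 'a set" where
  "bad \<tau> = {x \<in> N. cap x < load \<tau> x}"

definition excess :: "('l \<Rightarrow> 'a set) \<Rightarrow> nat" where
  "excess \<tau> = (\<Sum>x\<in>N. load \<tau> x - cap x)"

definition loc :: "('l \<Rightarrow> 'a set) \<Rightarrow> 'a set \<Rightarrow> ('l \<Rightarrow> 'a set) \<Rightarrow> bool" where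
  "loc \<tau> D \<sigma> \<longleftrightarrow> base \<sigma> \<and> (\<forall>h\<in>L. \<sigma> h = \<tau> h \<or> \<tau> h \<subseteq> D \<and> \<sigma> h \<subseteq> D)"

lemma base_sparse: "base \<tau> \<Longrightarrow> sparse \<tau>" and base_config: "base \<tau> \<Longrightarrow> config \<tau>"
  and base_rigid: "base \<tau> \<Longrightarrow> rigid \<tau> N"
  by (auto simp: base_def)

lemma loc_base: "loc \<tau> D \<sigma> \<Longrightarrow> base \<sigma>"
  by (simp add: loc_def)

lemma locD: "loc \<tau> D \<sigma> \<Longrightarrow> h \<in> L \<Longrightarrow> \<sigma> h = \<tau> h \<or> \<tau> h \<subseteq> D \<and> \<sigma> h \<subseteq> D"
  by (simp add: loc_def)

lemma loc_refl: "base \<tau> \<Longrightarrow> loc \<tau> D \<tau>"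
  by (simp add: loc_def)

lemma loc_sym: "base \<tau> \<Longrightarrow> loc \<tau> D \<sigma> \<Longrightarrow> loc \<sigma> D \<tau>"
  by (auto simp: loc_def)

lemma loc_trans: "loc \<tau> D \<sigma> \<Longrightarrow> loc \<sigma> D \<rho> \<Longrightarrow> loc \<tau> D \<rho>"
  unfolding loc_def by metis

lemma loc_mono: "loc \<tau> D \<sigma> \<Longrightarrow> D \<subseteq> E \<Longrightarrow> loc \<tau> E \<sigma>"
  unfolding loc_def by blast

lemma loc_load:
  assumes "loc \<tau> D \<sigma>" "x \<notin> D"
  shows "load \<sigma> x = load \<tau> x"
proof -
  have "{h \<in> L. x \<in> \<sigma> h} = {h \<in> L. x \<in> \<tau> h}"
    using locD[OF assms(1)] assms(2) by blast
  then show ?thesis by (simp add: load_def)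
qed

lemma inn_disjoint_eq:
  assumes "\<And>h. h \<in> L \<Longrightarrow> \<sigma> h = \<tau> h \<or> \<tau> h \<subseteq> D \<and> \<sigma> h \<subseteq> D" "D \<inter> U = {}"
  shows "inn \<sigma> U = inn \<tau> U"
  unfolding inn_def using assms by blast

text \<open>A set disjoint from \<open>D\<close> spans the same links as before. For a set
  containing \<open>D\<close>, the links it does not span are unchanged, and both bases have the
  same total.\<close>

lemma loc_rigid:
  assumes "base \<tau>" "loc \<tau> D \<sigma>" "D \<subseteq> U \<or> D \<inter> U = {}"
  shows "rigid \<sigma> U \<longleftrightarrow> rigid \<tau> U"
proof (cases "U \<subseteq> N")
  case UN: True
  have "card (inn \<sigma> U) = card (inn \<tau> U)"
  proof (cases "D \<inter> U = {}")
    case True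
    then show ?thesis using inn_disjoint_eq locD[OF assms(2)] by metis
  next
    case False
    then have DU: "D \<subseteq> U" using assms(3) by auto
    have eq: "inn \<sigma> N - inn \<sigma> U = inn \<tau> N - inn \<tau> U"
      using locD[OF assms(2)] DU UN unfolding inn_def by blast
    have c: "card (inn \<rho> N) = card (inn \<rho> U) + card (inn \<rho> N - inn \<rho> U)" for \<rho>
      using inn_mono[OF UN, of \<rho>] card_mono[OF finite_inn inn_mono[OF UN, of \<rho>]]
      by (simp add: card_Diff_subset)
    have "card (inn \<sigma> N) = card (inn \<tau> N)"
      using base_rigid[OF assms(1)] base_rigid[OF loc_base[OF assms(2)]] by (simp add: rigid_def)
    then show ?thesis using c[of \<sigma>] c[of \<tau>] eq by simp
  qed
  then show ?thesis by (simp add: rigid_def)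
qed (simp add: rigid_def)

text \<open>Sparsity has to be tested only inside \<open>D\<close>: the links spanned by
  \<open>U\<close> but not by \<open>D\<close> are unchanged, and rigidity of \<open>D\<close>
  bounds their number by \<open>k * card (U \<union> D) - k * card D\<close>.\<close>

lemma loc_intro:
  assumes b: "base \<tau>" and D: "rigid \<tau> D" and \<sigma>: "config \<sigma>"
    and p: "\<And>h. h \<in> L \<Longrightarrow> \<sigma> h = \<tau> h \<or> \<tau> h \<subseteq> D \<and> \<sigma> h \<subseteq> D"
    and c: "card (inn \<sigma> D) = card (inn \<tau> D)"
    and s: "\<And>U. U \<subseteq> D \<Longrightarrow> U \<noteq> {} \<Longrightarrow> card (inn \<sigma> U) + k \<le> k * card U"
  shows "loc \<tau> D \<sigma>"
proof -
  have DN: "D \<subseteq> N" and D0: "D \<noteq> {}" and Dc: "card (inn \<tau> D) + k = k * card D"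
    using D by (auto simp: rigid_def)
  have split: "card (inn \<rho> U) = card (inn \<rho> (U \<inter> D)) + card (inn \<rho> U - inn \<rho> D)" for \<rho> U
  proof -
    have "inn \<rho> U = inn \<rho> (U \<inter> D) \<union> (inn \<rho> U - inn \<rho> D)" by (auto simp: inn_def)
    moreover have "inn \<rho> (U \<inter> D) \<inter> (inn \<rho> U - inn \<rho> D) = {}" by (auto simp: inn_def)
    ultimately show ?thesis by (metis card_Un_disjoint finite_Diff finite_inn)
  qed
  have out: "inn \<sigma> U - inn \<sigma> D = inn \<tau> U - inn \<tau> D" for U
    using p unfolding inn_def by blast
  have "card (inn \<sigma> U) + k \<le> k * card U" if U: "U \<subseteq> N" "U \<noteq> {}" for U
  proof (cases "D \<inter> U = {}")
    case True
    then have "inn \<sigma> U = inn \<tau> U" using inn_disjoint_eq p by metis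
    then show ?thesis using sparseD[OF base_sparse[OF b] U] by simp
  next
    case False
    have 1: "card (inn \<sigma> (U \<inter> D)) + k \<le> k * card (U \<inter> D)" by (rule s) (use False in auto)
    have "(inn \<tau> U - inn \<tau> D) \<union> inn \<tau> D \<subseteq> inn \<tau> (U \<union> D)" by (auto simp: inn_def)
    then have "card ((inn \<tau> U - inn \<tau> D) \<union> inn \<tau> D) \<le> card (inn \<tau> (U \<union> D))"
      by (rule card_mono[OF finite_inn])
    then have 2: "card (inn \<tau> U - inn \<tau> D) + card (inn \<tau> D) \<le> card (inn \<tau> (U \<union> D))"
      by (subst (asm) card_Un_disjoint) auto
    have 3: "card (inn \<tau> (U \<union> D)) + k \<le> k * card (U \<union> D)"
      by (rule sparseD[OF base_sparse[OF b]]) (use U DN in auto)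
    show ?thesis using 1 2 3 Dc split[of \<sigma> U] k_card_Un[OF U(1) DN] by (simp add: out)
  qed
  then have "sparse \<sigma>" by (simp add: sparse_def)
  moreover have "rigid \<sigma> N"
  proof -
    have "card (inn \<sigma> N) = card (inn \<tau> N)"
      using split[of \<sigma> N] split[of \<tau> N] out[of N] c DN by (simp add: Int_absorb1)
    then show ?thesis using base_rigid[OF b] by (simp add: rigid_def)
  qed
  ultimately show ?thesis using \<sigma> p by (simp add: loc_def base_def)
qed

lemma loc_combine_aux:
  assumes b: "base \<tau>" and D: "rigid \<tau> D2" "D1 \<inter> D2 = {}"
    and l: "loc \<tau> D1 \<sigma>1" "loc \<tau> D2 \<sigma>2"
    and c: "\<And>h. h \<in> L \<Longrightarrow> \<sigma>1 h = \<tau> h \<and> \<sigma> h = \<sigma>2 h \<or> \<sigma>2 h = \<tau> h \<and> \<sigma> h = \<sigma>1 h"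
  shows "loc \<sigma>1 D2 \<sigma>"
proof (rule loc_intro)
  show b1: "base \<sigma>1" using l by (simp add: loc_def)
  show r: "rigid \<sigma>1 D2" using loc_rigid[OF b l(1)] D by simp
  have b2: "base \<sigma>2" using l by (simp add: loc_def)
  show "config \<sigma>" using base_config[OF b1] base_config[OF b2] c unfolding config_def by metis
  show "\<sigma> h = \<sigma>1 h \<or> \<sigma>1 h \<subseteq> D2 \<and> \<sigma> h \<subseteq> D2" if "h \<in> L" for h
    using c[OF that] locD[OF l(2) that] by auto
  have eq: "inn \<sigma> U = inn \<sigma>2 U" if "U \<subseteq> D2" for U
  proof -
    have "\<sigma> h \<noteq> {} \<and> \<sigma> h \<subseteq> U \<longleftrightarrow> \<sigma>2 h \<noteq> {} \<and> \<sigma>2 h \<subseteq> U" if "h \<in> L" for h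
      using c[OF that] locD[OF l(1) that] D(2) \<open>U \<subseteq> D2\<close> by blast
    then show ?thesis by (auto simp: inn_def)
  qed
  have "rigid \<sigma>2 D2" using loc_rigid[OF b l(2)] D by simp
  then show "card (inn \<sigma> D2) = card (inn \<sigma>1 D2)" using r by (simp add: eq rigid_def)
  show "card (inn \<sigma> U) + k \<le> k * card U" if U: "U \<subseteq> D2" "U \<noteq> {}" for U
  proof -
    have "U \<subseteq> N" using U D by (auto simp: rigid_def)
    then show ?thesis using sparseD[OF base_sparse[OF b2]] U eq by simp
  qed
qed

lemma loc_combine:
  assumes b: "base \<tau>" and D: "rigid \<tau> D1" "rigid \<tau> D2" "D1 \<inter> D2 = {}"
    and l: "loc \<tau> D1 \<sigma>1" "loc \<tau> D2 \<sigma>2"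
  obtains \<sigma> where "loc \<sigma>1 D2 \<sigma>" "loc \<sigma>2 D1 \<sigma>"
    "\<And>h. h \<in> L \<Longrightarrow> \<sigma>1 h = \<tau> h \<and> \<sigma> h = \<sigma>2 h \<or> \<sigma>2 h = \<tau> h \<and> \<sigma> h = \<sigma>1 h"
proof -
  define \<sigma> where "\<sigma> h = (if \<sigma>1 h \<noteq> \<tau> h then \<sigma>1 h else \<sigma>2 h)" for h
  have nc: "\<sigma>1 h = \<tau> h \<or> \<sigma>2 h = \<tau> h" if h: "h \<in> L" for h
  proof (rule ccontr)
    assume n: "\<not> ?thesis"
    then have s: "\<sigma>1 h \<subseteq> D1" "\<sigma>2 h \<subseteq> D2" "\<tau> h \<subseteq> D1" "\<tau> h \<subseteq> D2"
      using locD[OF l(1) h] locD[OF l(2) h] by auto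
    then have "\<tau> h = {}" using D(3) by auto
    then have ne: "\<sigma>1 h \<noteq> {}" "\<sigma>2 h \<noteq> {}" using n by auto
    have cf: "config \<sigma>1" "config \<sigma>2" using l base_config by (auto simp: loc_def)
    have "2 \<le> card (\<sigma>1 h)" "2 \<le> card (\<sigma>2 h)" using cf ne h by (auto simp: config_def)
    moreover have sub: "\<sigma>1 h \<union> \<sigma>2 h \<subseteq> A h" using config_sub cf h by auto
    moreover have "finite (\<sigma>1 h)" "finite (\<sigma>2 h)" using finite_A[OF h] sub finite_subset by auto
    then have "card (\<sigma>1 h \<union> \<sigma>2 h) = card (\<sigma>1 h) + card (\<sigma>2 h)"
      using s D(3) by (intro card_Un_disjoint) auto
    ultimately show False using A_card[OF h] card_mono[OF finite_A[OF h] sub] by linarith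
  qed
  have c: "\<sigma>1 h = \<tau> h \<and> \<sigma> h = \<sigma>2 h \<or> \<sigma>2 h = \<tau> h \<and> \<sigma> h = \<sigma>1 h" if "h \<in> L" for h
    using nc[OF that] by (auto simp: \<sigma>_def)
  have 1: "loc \<sigma>1 D2 \<sigma>" by (rule loc_combine_aux[OF b D(2,3) l c])
  have 2: "loc \<sigma>2 D1 \<sigma>"
    by (rule loc_combine_aux[OF b D(1) _ l(2,1)]) (use D(3) c in auto)
  show thesis using that[OF 1 2 c] .
qed

section \<open>Vertices with room and optimal trimmings\<close>

text \<open>A certificate that one more link may end at \<open>x\<close>: the change stays in a
  rigid set off \<open>S\<close> and leaves no vertex of that set overloaded.\<close>

definition room :: "('l \<Rightarrow> 'a set) \<Rightarrow> 'a set \<Rightarrow> 'a \<Rightarrow> bool" where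
  "room \<tau> S x \<longleftrightarrow> (\<exists>D \<sigma>. rigid \<tau> D \<and> x \<in> D \<and> D \<inter> S = {} \<and> loc \<tau> D \<sigma> \<and>
     (\<forall>y\<in>D. load \<sigma> y \<le> cap y) \<and> load \<sigma> x < cap x)"

text \<open>A set is valid if it is reached from the overloaded vertices by successively adding
  vertices without room.\<close>

definition valid :: "('l \<Rightarrow> 'a set) \<Rightarrow> 'a set \<Rightarrow> bool" where
  "valid \<tau> S \<longleftrightarrow> bad \<tau> \<subseteq> S \<and> S \<subseteq> N \<and> (\<forall>S'. bad \<tau> \<subseteq> S' \<and> S' \<subset> S \<longrightarrow> (\<exists>x\<in>S - S'. \<not> room \<tau> S' x))"

text \<open>Counting pairs in common classes makes every proper refinement of the classes a strict
  gain.\<close>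

definition same :: "('l \<Rightarrow> 'a set) \<Rightarrow> 'a set \<Rightarrow> ('a \<times> 'a) set" where
  "same \<tau> S = {(x, y). \<exists>U. rigid \<tau> U \<and> U \<inter> S = {} \<and> x \<in> U \<and> y \<in> U}"

lemma finite_same: "finite (same \<tau> S)"
proof -
  have "same \<tau> S \<subseteq> N \<times> N" by (auto simp: same_def rigid_def)
  then show ?thesis using finite_N finite_subset by blast
qed

lemma room_mono: "room \<tau> S x \<Longrightarrow> S' \<subseteq> S \<Longrightarrow> room \<tau> S' x"
  unfolding room_def by blast

lemma loc_bad:
  assumes "loc \<tau> D \<sigma>" "D \<inter> bad \<tau> = {}" "\<And>y. y \<in> D \<Longrightarrow> load \<sigma> y \<le> cap y"
  shows "bad \<sigma> = bad \<tau>" "excess \<sigma> = excess \<tau>"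
proof -
  have e: "load \<sigma> y - cap y = load \<tau> y - cap y \<and> (cap y < load \<sigma> y \<longleftrightarrow> cap y < load \<tau> y)" if "y \<in> N" for y
  proof (cases "y \<in> D")
    case True
    then have "\<not> cap y < load \<tau> y" using assms(2) that by (auto simp: bad_def)
    then show ?thesis using assms(3)[OF True] by auto
  qed (use loc_load[OF assms(1)] in simp)
  show "bad \<sigma> = bad \<tau>" using e by (auto simp: bad_def)
  show "excess \<sigma> = excess \<tau>" unfolding excess_def using e by (intro sum.cong) auto
qed

text \<open>If the two rigid sets meet, the composed change lives in their union, which is again
  rigid and avoids \<open>S'\<close>. If not, the changes are independent and the second one can be
  made alone.\<close>

lemma room_loc:
  assumes b: "base \<tau>" and D: "rigid \<tau> D" "D \<inter> S = {}" and l: "loc \<tau> D \<tau>'"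
    and cp: "\<And>y. y \<in> D \<Longrightarrow> load \<tau>' y \<le> cap y"
    and r: "room \<tau>' S' x" and S': "S' \<subseteq> S"
  shows "room \<tau> S' x"
proof -
  have b': "base \<tau>'" using l loc_base by blast
  obtain D' \<sigma> where D': "rigid \<tau>' D'" "x \<in> D'" "D' \<inter> S' = {}" "loc \<tau>' D' \<sigma>"
    and c': "\<And>y. y \<in> D' \<Longrightarrow> load \<sigma> y \<le> cap y" "load \<sigma> x < cap x"
    using r by (auto simp: room_def)
  have rD: "rigid \<tau>' D" using loc_rigid[OF b l, of D] D by simp
  show ?thesis
  proof (cases "D' \<inter> D = {}")
    case False
    let ?M = "D' \<union> D"
    have "rigid \<tau>' ?M" by (rule rigid_union_inter[OF base_sparse[OF b'] D'(1) rD False])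
    then have M: "rigid \<tau> ?M" using loc_rigid[OF b l, of ?M] by auto
    have "loc \<tau> ?M \<sigma>" using loc_trans[OF loc_mono[OF l] loc_mono[OF D'(4)]] by auto
    moreover have "load \<sigma> y \<le> cap y" if "y \<in> ?M" for y
      using that c' cp loc_load[OF D'(4), of y] by (cases "y \<in> D'") auto
    moreover have "?M \<inter> S' = {}" using D' D S' by auto
    ultimately show ?thesis unfolding room_def using M D' c' by blast
  next
    case True
    have rD': "rigid \<tau> D'" using loc_rigid[OF b l, of D'] D' True by auto
    obtain \<rho> where \<rho>: "loc \<tau> D' \<rho>" "loc \<sigma> D \<rho>"
      using loc_combine[OF b' rD D'(1) _ loc_sym[OF b l] D'(4)] True by (metis inf_commute)
    have "load \<rho> y = load \<sigma> y" if "y \<in> D'" for y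
      using loc_load[OF \<rho>(2)] that True by auto
    then show ?thesis unfolding room_def using rD' D' \<rho> c' by (intro exI[of _ D'] exI[of _ \<rho>]) auto
  qed
qed

text \<open>By \<open>room_loc\<close> a vertex without room does not gain any, which preserves
  validity. A rigid set that meets \<open>D\<close> can be enlarged by \<open>D\<close>, so no new
  pairs arise.\<close>

lemma valid_loc:
  assumes b: "base \<tau>" and v: "valid \<tau> S" and D: "rigid \<tau> D" "D \<inter> S = {}" and l: "loc \<tau> D \<tau>'"
    and cp: "\<And>y. y \<in> D \<Longrightarrow> load \<tau>' y \<le> cap y"
  shows "valid \<tau>' S" "same \<tau>' S \<subseteq> same \<tau> S" "excess \<tau>' = excess \<tau>"
proof -
  have "D \<inter> bad \<tau> = {}" using v D by (auto simp: valid_def)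
  note lb = loc_bad[OF l this cp]
  show "excess \<tau>' = excess \<tau>" by (rule lb)
  have "\<exists>x\<in>S - S'. \<not> room \<tau>' S' x" if "bad \<tau> \<subseteq> S'" "S' \<subset> S" for S'
    using v that room_loc[OF b D l cp, of S'] unfolding valid_def by (meson psubset_imp_subset)
  then show "valid \<tau>' S" using v lb unfolding valid_def by metis
  show "same \<tau>' S \<subseteq> same \<tau> S"
  proof
    fix p assume "p \<in> same \<tau>' S"
    then obtain x y U where U: "p = (x, y)" "rigid \<tau>' U" "U \<inter> S = {}" "x \<in> U" "y \<in> U"
      by (auto simp: same_def)
    show "p \<in> same \<tau> S"
    proof (cases "U \<inter> D = {}")
      case True
      then have "rigid \<tau> U" using loc_rigid[OF b l, of U] U by auto
      then show ?thesis using U by (auto simp: same_def)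
    next
      case False
      have "rigid \<tau>' D" using loc_rigid[OF b l, of D] D by simp
      then have "rigid \<tau>' (U \<union> D)"
        using rigid_union_inter[OF base_sparse[OF loc_base[OF l]] U(2) _ False] by simp
      then have "rigid \<tau> (U \<union> D)" using loc_rigid[OF b l, of "U \<union> D"] by auto
      then show ?thesis using U D unfolding same_def by blast
    qed
  qed
qed

text \<open>Lexicographic choice: least excess, then a largest valid set, then as few pairs as possible
  in common classes.\<close>

definition opt :: "('l \<Rightarrow> 'a set) \<Rightarrow> 'a set \<Rightarrow> bool" where
  "opt \<tau> S \<longleftrightarrow> base \<tau> \<and> valid \<tau> S \<and> (\<forall>\<sigma>. base \<sigma> \<longrightarrow> excess \<tau> \<le> excess \<sigma>) \<and>
     (\<forall>\<sigma> S'. base \<sigma> \<and> valid \<sigma> S' \<and> excess \<sigma> = excess \<tau> \<longrightarrow> card S' \<le> card S) \<and>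
     (\<forall>\<sigma> S'. base \<sigma> \<and> valid \<sigma> S' \<and> excess \<sigma> = excess \<tau> \<and> card S' = card S \<longrightarrow>
        card (same \<tau> S) \<le> card (same \<sigma> S'))"

lemma opt_exists:
  assumes "base \<tau>0"
  obtains \<tau> S where "opt \<tau> S"
proof -
  obtain \<tau>1 where \<tau>1: "base \<tau>1" "\<And>\<sigma>. base \<sigma> \<Longrightarrow> excess \<tau>1 \<le> excess \<sigma>"
    using ex_has_least_nat[of base \<tau>0 excess] assms by auto
  define Q where "Q p \<longleftrightarrow> base (fst p) \<and> valid (fst p) (snd p) \<and> excess (fst p) = excess \<tau>1" for p
  have "valid \<tau>1 (bad \<tau>1)" by (auto simp: valid_def bad_def)
  then have "Q (\<tau>1, bad \<tau>1)" using \<tau>1 by (simp add: Q_def)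
  moreover have "\<forall>p. Q p \<longrightarrow> card (snd p) < Suc (card N)"
    using finite_N by (auto simp: Q_def valid_def less_Suc_eq_le intro: card_mono)
  ultimately obtain p where p: "Q p" "\<And>q. Q q \<Longrightarrow> card (snd q) \<le> card (snd p)"
    using ex_has_greatest_nat[of Q _ "\<lambda>p. card (snd p)" "Suc (card N)"] by metis
  obtain q where q: "Q q \<and> card (snd q) = card (snd p)"
    "\<And>r. Q r \<and> card (snd r) = card (snd p) \<Longrightarrow> card (same (fst q) (snd q)) \<le> card (same (fst r) (snd r))"
    using ex_has_least_nat[of "\<lambda>r. Q r \<and> card (snd r) = card (snd p)" p "\<lambda>r. card (same (fst r) (snd r))"] p
    by metis
  have Qi: "Q (\<sigma>, S)" if "base \<sigma>" "valid \<sigma> S" "excess \<sigma> = excess (fst q)" for \<sigma> S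
    using that q(1) by (simp add: Q_def)
  have "opt (fst q) (snd q)"
    unfolding opt_def
  proof (intro conjI allI impI)
    show "base (fst q)" "valid (fst q) (snd q)" using q(1) by (auto simp: Q_def)
    show "excess (fst q) \<le> excess \<sigma>" if "base \<sigma>" for \<sigma>
      using \<tau>1(2)[OF that] q(1) by (simp add: Q_def)
    show "card S' \<le> card (snd q)" if "base \<sigma> \<and> valid \<sigma> S' \<and> excess \<sigma> = excess (fst q)" for \<sigma> S'
      using p(2)[OF Qi] that q(1) by auto
    show "card (same (fst q) (snd q)) \<le> card (same \<sigma> S')"
      if "base \<sigma> \<and> valid \<sigma> S' \<and> excess \<sigma> = excess (fst q) \<and> card S' = card (snd q)" for \<sigma> S'
      using q(2)[of "(\<sigma>, S')"] Qi[of \<sigma> S'] that q(1) by auto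
  qed
  then show thesis using that by blast
qed

text \<open>Lets the change certified by \<open>room\<close> be carried out without loss of
  optimality or of any class, so that spare capacity may be assumed to be present.\<close>

lemma opt_loc:
  assumes o: "opt \<tau> S" and D: "rigid \<tau> D" "D \<inter> S = {}" and l: "loc \<tau> D \<sigma>"
    and cp: "\<And>y. y \<in> D \<Longrightarrow> load \<sigma> y \<le> cap y"
  shows "opt \<sigma> S" "same \<sigma> S = same \<tau> S"
proof -
  have b: "base \<tau>" and v: "valid \<tau> S" using o by (auto simp: opt_def)
  note vl = valid_loc[OF b v D l cp]
  have "card (same \<tau> S) \<le> card (same \<sigma> S)"
    using o vl(1,3) loc_base[OF l] unfolding opt_def by blast
  then show "same \<sigma> S = same \<tau> S" using vl(2) finite_same card_seteq by blast
  then show "opt \<sigma> S" using o vl loc_base[OF l] unfolding opt_def by simp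
qed

text \<open>A vertex without room could be added to \<open>S\<close>, against the choice of a
  largest valid set.\<close>

lemma opt_room:
  assumes o: "opt \<tau> S" and x: "x \<in> N - S"
  shows "room \<tau> S x"
proof (rule ccontr)
  assume n: "\<not> room \<tau> S x"
  have v: "valid \<tau> S" using o by (auto simp: opt_def)
  have "valid \<tau> (insert x S)"
    unfolding valid_def
  proof (intro conjI allI impI)
    show "bad \<tau> \<subseteq> insert x S" "insert x S \<subseteq> N" using v x by (auto simp: valid_def)
    fix S' assume S': "bad \<tau> \<subseteq> S' \<and> S' \<subset> insert x S"
    show "\<exists>y\<in>insert x S - S'. \<not> room \<tau> S' y"
    proof (cases "S \<subseteq> S'")
      case True
      then have "S' = S" using S' by auto
      then show ?thesis using n x by auto
    next
      case False
      then have "S \<inter> S' \<subset> S" "bad \<tau> \<subseteq> S \<inter> S'" using S' v by (auto simp: valid_def)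
      then obtain y where "y \<in> S - S \<inter> S'" "\<not> room \<tau> (S \<inter> S') y" using v unfolding valid_def by meson
      then show ?thesis using room_mono[of \<tau> S' y "S \<inter> S'"] by blast
    qed
  qed
  then have "card (insert x S) \<le> card S" using o unfolding opt_def by blast
  moreover have "finite S" using v finite_sub_N by (auto simp: valid_def)
  ultimately show False using x by simp
qed

text \<open>An underloaded vertex has room on the rigid set consisting of it alone, so it could
  never have entered a valid set.\<close>

lemma opt_load:
  assumes o: "opt \<tau> S" and x: "x \<in> S"
  shows "cap x \<le> load \<tau> x"
proof (rule ccontr)
  assume n: "\<not> ?thesis"
  have v: "valid \<tau> S" and b: "base \<tau>" using o by (auto simp: opt_def)
  have "bad \<tau> \<subseteq> S - {x}" using v n by (auto simp: valid_def bad_def)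
  moreover have "S - {x} \<subset> S" using x by auto
  ultimately obtain y where "y \<in> S - (S - {x})" "\<not> room \<tau> (S - {x}) y"
    using v unfolding valid_def by meson
  moreover have "room \<tau> (S - {x}) x"
    unfolding room_def
    by (intro exI[of _ "{x}"] exI[of _ \<tau>])
      (use n rigid_singleton[OF base_config[OF b]] loc_refl[OF b] v x in \<open>auto simp: valid_def\<close>)
  ultimately show False by auto
qed

section \<open>Positions of the links in an optimal trimming\<close>

lemma load_update:
  assumes "h \<in> L"
  shows "load (\<tau>(h := S)) x + (if x \<in> \<tau> h then 1 else 0) = load \<tau> x + (if x \<in> S then 1 else 0)"
proof -
  let ?R = "{g \<in> L - {h}. x \<in> \<tau> g}"
  have f: "finite ?R" "h \<notin> ?R" using finite_L by auto
  have "{g \<in> L. x \<in> (\<tau>(h := S)) g} = (if x \<in> S then insert h ?R else ?R)" using assms by auto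
  moreover have "{g \<in> L. x \<in> \<tau> g} = (if x \<in> \<tau> h then insert h ?R else ?R)" using assms by auto
  ultimately show ?thesis using f by (simp add: load_def)
qed

lemma same_trans_rigid:
  assumes "sparse \<tau>" "rigid \<tau> D" "D \<inter> S = {}" "a \<in> D" "x \<in> D" "(a, b) \<in> same \<tau> S"
  shows "(x, b) \<in> same \<tau> S"
proof -
  obtain U where U: "rigid \<tau> U" "U \<inter> S = {}" "a \<in> U" "b \<in> U" using assms(6) by (auto simp: same_def)
  have "rigid \<tau> (D \<union> U)" by (rule rigid_union_inter) (use U assms in auto)
  then show ?thesis using U assms unfolding same_def by blast
qed

lemma same_sym: "(a, b) \<in> same \<tau> S \<Longrightarrow> (b, a) \<in> same \<tau> S"
  by (auto simp: same_def)

text \<open>Otherwise \<open>b\<close> has room in a rigid set disjoint from \<open>D\<close>, and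
  after that change the link can be enlarged by \<open>b\<close> without overload. Enlarging creates
  no rigid set and keeps \<open>S\<close> valid, so by the last criterion of optimality no pair
  disappears. The two old ends of the link then lie in a rigid set that still spans the enlarged
  link, and this set contains \<open>b\<close>.\<close>

lemma opt_used_link:
  assumes o: "opt \<tau> S" and h: "h \<in> L" "\<tau> h \<noteq> {}" "\<tau> h \<subseteq> D"
    and D: "rigid \<tau> D" "D \<inter> S = {}" and b: "b \<in> A h - S" and x: "x \<in> D"
  shows "(x, b) \<in> same \<tau> S"
proof (rule ccontr)
  assume n: "(x, b) \<notin> same \<tau> S"
  have bt: "base \<tau>" and v: "valid \<tau> S" using o by (auto simp: opt_def)
  have bN: "b \<in> N - S" using b h A_sub by auto
  obtain E \<sigma> where E: "rigid \<tau> E" "b \<in> E" "E \<inter> S = {}" "loc \<tau> E \<sigma>"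
    and cE: "\<And>y. y \<in> E \<Longrightarrow> load \<sigma> y \<le> cap y" "load \<sigma> b < cap b"
    using opt_room[OF o bN] by (auto simp: room_def)
  have DE: "D \<inter> E = {}"
  proof (rule ccontr)
    assume "D \<inter> E \<noteq> {}"
    then have "rigid \<tau> (D \<union> E)" using rigid_union_inter[OF base_sparse[OF bt] D(1) E(1)] by simp
    then have "(x, b) \<in> same \<tau> S" using D E x unfolding same_def by blast
    with n show False by simp
  qed
  note os = opt_loc[OF o E(1,3,4) cE(1)]
  have bs: "base \<sigma>" using E loc_base by blast
  note sp = base_sparse[OF bs] and cf = base_config[OF bs]
  have sh: "\<sigma> h = \<tau> h" using locD[OF E(4) h(1)] h DE by blast
  have rD: "rigid \<sigma> D" using loc_rigid[OF bt E(4), of D] D DE by auto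
  have bh: "b \<notin> \<tau> h" using h E DE by auto
  let ?t = "\<sigma>(h := insert b (\<tau> h))"
  have cft: "config ?t"
  proof -
    have "insert b (\<tau> h) \<subseteq> A h" using b config_sub[OF base_config[OF bt] h(1)] by auto
    moreover have "2 \<le> card (insert b (\<tau> h))"
    proof -
      have "2 \<le> card (\<tau> h)" using base_config[OF bt] h by (auto simp: config_def)
      also have "\<dots> \<le> card (insert b (\<tau> h))"
        using calculation(1) by (intro card_mono finite_subset[OF _ finite_A[OF h(1)]]) (use \<open>insert b (\<tau> h) \<subseteq> A h\<close> in auto)
      finally show ?thesis .
    qed
    ultimately show ?thesis using cf by (auto simp: config_def)
  qed
  have sub: "inn ?t U \<subseteq> inn \<sigma> U" for U using h sh by (auto simp: inn_def split: if_splits)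
  have le: "card (inn ?t U) \<le> card (inn \<sigma> U)" for U by (rule card_mono[OF finite_inn sub])
  have "sparse ?t" unfolding sparse_def using sparseD[OF sp] le by (meson add_le_mono1 le_trans)
  moreover have "inn ?t N = inn \<sigma> N"
    using h sh bN by (auto simp: inn_def)
  ultimately have bt': "base ?t" using cft base_rigid[OF bs] by (auto simp: base_def rigid_def)
  have rt: "rigid \<sigma> U" if "rigid ?t U" for U
    using that le[of U] sparseD[OF sp, of U] by (auto simp: rigid_def)
  have ld: "load ?t y = load \<sigma> y + (if y = b then 1 else 0)" for y
    using load_update[OF h(1), of \<sigma> "insert b (\<tau> h)" y] sh bh by (auto split: if_splits)
  have eb: "bad ?t = bad \<sigma>" using cE(2) by (auto simp: bad_def ld split: if_splits)
  have ee: "excess ?t = excess \<sigma>" unfolding excess_def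
    using cE(2) by (intro sum.cong) (auto simp: ld)
  \<comment> \<open>Room is pulled back from the enlarged trimming. If the rigid set contains the
    enlarged link, the certificate serves as it is. Otherwise equality of the counts shows that the
    old link was not inside either, and its old value can be restored without affecting the
    set.\<close>
  have rm: "room \<sigma> S' z" if r: "room ?t S' z" for S' z
  proof -
    obtain D' \<rho> where D': "rigid ?t D'" "z \<in> D'" "D' \<inter> S' = {}" "loc ?t D' \<rho>"
      and c': "\<And>y. y \<in> D' \<Longrightarrow> load \<rho> y \<le> cap y" "load \<rho> z < cap z"
      using r by (auto simp: room_def)
    have b\<rho>: "base \<rho>" using D' loc_base by blast
    show ?thesis
    proof (cases "insert b (\<tau> h) \<subseteq> D'")
      case True
      have "\<rho> g = \<sigma> g \<or> \<sigma> g \<subseteq> D' \<and> \<rho> g \<subseteq> D'" if "g \<in> L" for g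
        using locD[OF D'(4) that] True sh by (cases "g = h") auto
      then have "loc \<sigma> D' \<rho>" using b\<rho> by (simp add: loc_def)
      then show ?thesis unfolding room_def using rt[OF D'(1)] D' c' by blast
    next
      case False
      then have \<rho>h: "\<rho> h = insert b (\<tau> h)" using locD[OF D'(4) h(1)] by auto
      have c1: "card (inn ?t D') = card (inn \<sigma> D')" using D'(1) rt[OF D'(1)] by (simp add: rigid_def)
      then have eq: "inn ?t D' = inn \<sigma> D'" using card_subset_eq[OF finite_inn sub[of D']] by simp
      have "h \<notin> inn ?t D'" using False h by (simp add: inn_def)
      then have "h \<notin> inn \<sigma> D'" using eq by simp
      then have sh': "\<not> \<sigma> h \<subseteq> D'" using h sh by (auto simp: inn_def)
      let ?r = "\<rho>(h := \<sigma> h)"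
      have ir: "inn ?r U = inn \<rho> U" if "U \<subseteq> D'" for U
        using sh' \<rho>h False that h(1) by (auto simp: inn_def)
      have "loc \<sigma> D' ?r"
      proof (rule loc_intro[OF bs rt[OF D'(1)]])
        show "config ?r" using base_config[OF b\<rho>] cf h(1) by (auto simp: config_def)
        show "?r g = \<sigma> g \<or> \<sigma> g \<subseteq> D' \<and> ?r g \<subseteq> D'" if "g \<in> L" for g
          using locD[OF D'(4) that] by (cases "g = h") auto
        have "rigid \<rho> D'" using loc_rigid[OF bt' D'(4), of D'] D' by simp
        then show "card (inn ?r D') = card (inn \<sigma> D')" using D'(1) c1 ir[of D'] by (simp add: rigid_def)
        show "card (inn ?r U) + k \<le> k * card U" if U: "U \<subseteq> D'" "U \<noteq> {}" for U
        proof -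
          have "U \<subseteq> N" using U D'(1) by (auto simp: rigid_def)
          then show ?thesis using sparseD[OF base_sparse[OF b\<rho>]] U ir by simp
        qed
      qed
      moreover have "load ?r y \<le> load \<rho> y" for y
        unfolding load_def
        by (rule card_mono) (use finite_L sh \<rho>h in \<open>auto split: if_splits\<close>)
      ultimately show ?thesis unfolding room_def using rt[OF D'(1)] D' c'
        by (intro exI[of _ D'] exI[of _ ?r]) (auto intro: le_trans le_less_trans)
    qed
  qed
  have vs: "valid \<sigma> S" using os by (auto simp: opt_def)
  then have "valid ?t S" unfolding valid_def eb using rm by meson
  moreover have "excess ?t = excess \<sigma>" by (rule ee)
  ultimately have "card (same \<sigma> S) \<le> card (same ?t S)" using os(1) bt' unfolding opt_def by blast
  moreover have "same ?t S \<subseteq> same \<sigma> S" unfolding same_def using rt by blast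
  ultimately have eqs: "same ?t S = same \<sigma> S" using card_seteq[OF finite_same] by blast
  obtain a where a: "a \<in> \<tau> h" using h by auto
  have "card (\<tau> h) \<le> 2"
  proof -
    have "insert b (\<tau> h) \<subseteq> A h" using b config_sub[OF base_config[OF bt] h(1)] by auto
    then have "card (insert b (\<tau> h)) \<le> 3"
      using card_mono[OF finite_A[OF h(1)], of "insert b (\<tau> h)"] A_card[OF h(1)] by linarith
    moreover have "finite (\<tau> h)" using \<open>insert b (\<tau> h) \<subseteq> A h\<close> finite_A[OF h(1)] finite_subset by auto
    ultimately show ?thesis using bh by simp
  qed
  moreover have "2 \<le> card (\<tau> h)" using base_config[OF bt] h by (auto simp: config_def)
  ultimately have "card (\<tau> h) = 2" by simp
  then obtain c d where cd: "\<tau> h = {c, d}" by (auto simp: card_2_iff)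
  have "(c, d) \<in> same \<sigma> S" unfolding same_def using rD D cd h by blast
  then have "(c, d) \<in> same ?t S" by (simp only: eqs)
  then obtain U where U: "rigid ?t U" "U \<inter> S = {}" "c \<in> U" "d \<in> U" by (auto simp: same_def)
  have "card (inn ?t U) = card (inn \<sigma> U)" using U(1) rt[OF U(1)] by (simp add: rigid_def)
  then have "inn ?t U = inn \<sigma> U" using card_subset_eq[OF finite_inn sub[of U]] by simp
  moreover have "h \<in> inn \<sigma> U" using h sh cd U by (auto simp: inn_def)
  ultimately have "h \<in> inn ?t U" by simp
  then have "b \<in> U" by (simp add: inn_def)
  then have cb: "(c, b) \<in> same \<sigma> S" unfolding same_def using rt[OF U(1)] U by blast
  have "(x, b) \<in> same \<sigma> S" by (rule same_trans_rigid[OF sp rD D(2) _ x cb]) (use h cd in auto)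
  then show False using n os by simp
qed

text \<open>Without a spanned link at \<open>x\<close>, the set \<open>U - {x}\<close> would span as
  many links as \<open>U\<close> and be too dense by \<open>k\<close>.\<close>

lemma rigid_touch:
  assumes "base \<tau>" "rigid \<tau> U" "x \<in> U" "U \<noteq> {x}"
  obtains g where "g \<in> inn \<tau> U" "x \<in> \<tau> g"
proof -
  have UN: "U \<subseteq> N" using assms by (auto simp: rigid_def)
  have "\<exists>g\<in>inn \<tau> U. x \<in> \<tau> g"
  proof (rule ccontr)
    assume "\<not> ?thesis"
    then have "inn \<tau> U = inn \<tau> (U - {x})" by (auto simp: inn_def)
    moreover have "card (inn \<tau> (U - {x})) + k \<le> k * card (U - {x})"
      by (rule sparseD[OF base_sparse[OF assms(1)]]) (use UN assms in auto)
    moreover have "card U = Suc (card (U - {x}))"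
      using card_Suc_Diff1[OF finite_sub_N[OF UN] assms(3)] by simp
    ultimately show False using assms(2) k_pos by (simp add: rigid_def)
  qed
  then show thesis using that by blast
qed

lemma opt_free_slack:
  assumes o: "opt \<tau> S" and h: "h \<in> L" "\<tau> h = {}" and ab: "a \<in> A h - S" "b \<in> A h - S" "a \<noteq> b"
    and sl: "load \<tau> a < cap a" "load \<tau> b < cap b"
  shows "(a, b) \<in> same \<tau> S"
proof (rule ccontr)
  assume n: "(a, b) \<notin> same \<tau> S"
  have bt: "base \<tau>" and v: "valid \<tau> S" and mn: "\<And>\<sigma>. base \<sigma> \<Longrightarrow> excess \<tau> \<le> excess \<sigma>"
    using o by (auto simp: opt_def)
  note sp = base_sparse[OF bt] and cf = base_config[OF bt]
  have abN: "a \<in> N" "b \<in> N" using ab A_sub h by auto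
  let ?\<U> = "{U. rigid \<tau> U \<and> a \<in> U \<and> b \<in> U}"
  have "?\<U> \<subseteq> Pow N" by (auto simp: rigid_def)
  then have "finite ?\<U>" using finite_N finite_subset by auto
  moreover have "N \<in> ?\<U>" using base_rigid[OF bt] abN by auto
  ultimately obtain U where U: "U \<in> ?\<U>" and Umin: "\<And>V. V \<in> ?\<U> \<Longrightarrow> V \<subseteq> U \<Longrightarrow> U = V"
    using finite_has_minimal[of ?\<U>] by blast
  \<comment> \<open>By uncrossing, \<open>U\<close> lies in every rigid set containing
    \<open>a\<close> and \<open>b\<close>; it plays the part of a fundamental circuit of the new
    link.\<close>
  have sw: "loc \<tau> U (\<tau>(h := {a, b}, g := {}))" if g: "g \<in> inn \<tau> U" for g
  proof -
    let ?s = "\<tau>(h := {a, b}, g := {})"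
    have gh: "g \<noteq> h" "g \<in> L" using g h by (auto simp: inn_def)
    have inn_s: "inn ?s V = (inn \<tau> V - {g}) \<union> (if a \<in> V \<and> b \<in> V then {h} else {})" for V
      using gh h by (auto simp: inn_def)
    have hn: "h \<notin> inn \<tau> V" for V using h by (simp add: inn_def)
    have "config ?s" using cf gh h ab by (auto simp: config_def)
    moreover have "sparse ?s" unfolding sparse_def
    proof (intro allI impI)
      fix V assume V: "V \<subseteq> N \<and> V \<noteq> {}"
      have sV: "card (inn \<tau> V) + k \<le> k * card V" using sparseD[OF sp] V by auto
      show "card (inn ?s V) + k \<le> k * card V"
      proof (cases "a \<in> V \<and> b \<in> V")
        case False
        then have "card (inn ?s V) \<le> card (inn \<tau> V)" unfolding inn_s by (intro card_mono) auto
        then show ?thesis using sV by linarith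
      next
        case True
        then have eq: "inn ?s V = insert h (inn \<tau> V - {g})" unfolding inn_s by auto
        show ?thesis
        proof (cases "rigid \<tau> V")
          case rV: True
          have "rigid \<tau> (U \<inter> V)" by (rule rigid_union_inter[OF sp]) (use U True rV in auto)
          then have "U = U \<inter> V" using Umin[of "U \<inter> V"] U True by auto
          then have "g \<in> inn \<tau> V" using g by (auto simp: inn_def)
          then have "card (insert h (inn \<tau> V - {g})) = card (inn \<tau> V)"
            using hn card_Suc_Diff1[OF finite_inn, of g \<tau> V] by (simp del: card_Diff_insert card_Diff_singleton)
          then show ?thesis using eq sV by simp
        next
          case False
          then have "card (inn \<tau> V) + k < k * card V" using sV V by (auto simp: rigid_def)
          moreover have "card (insert h (inn \<tau> V - {g})) \<le> Suc (card (inn \<tau> V))"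
            using hn by (simp add: card_Diff1_le)
          ultimately show ?thesis using eq by simp
        qed
      qed
    qed
    moreover have "rigid ?s N"
    proof -
      have "g \<in> inn \<tau> N" using g U by (auto simp: inn_def rigid_def)
      then have "card (insert h (inn \<tau> N - {g})) = card (inn \<tau> N)"
        using hn card_Suc_Diff1[OF finite_inn, of g \<tau> N] by (simp del: card_Diff_insert card_Diff_singleton)
      moreover have "inn ?s N = insert h (inn \<tau> N - {g})" unfolding inn_s using abN by auto
      ultimately show ?thesis using base_rigid[OF bt] by (simp add: rigid_def)
    qed
    moreover have "?s f = \<tau> f \<or> \<tau> f \<subseteq> U \<and> ?s f \<subseteq> U" for f
      using g U h by (auto simp: inn_def)
    ultimately show ?thesis unfolding loc_def base_def by blast
  qed
  have ls: "load (\<tau>(h := {a, b}, g := {})) y + (if y \<in> \<tau> g then 1 else 0)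
      = load \<tau> y + (if y \<in> {a, b} then 1 else 0)" if g: "g \<in> inn \<tau> U" for g y
  proof -
    have gh: "g \<noteq> h" "g \<in> L" using g h by (auto simp: inn_def)
    show ?thesis
      using load_update[OF gh(2), of "\<tau>(h := {a, b})" "{}" y] load_update[OF h(1), of \<tau> "{a, b}" y] gh h
      by auto
  qed
  have Ux: "U \<noteq> {x}" for x using U ab by auto
  have nb: "U \<inter> bad \<tau> = {}"
  proof (rule ccontr)
    assume "U \<inter> bad \<tau> \<noteq> {}"
    then obtain x where x: "x \<in> U" "x \<in> bad \<tau>" by auto
    obtain g where g: "g \<in> inn \<tau> U" "x \<in> \<tau> g" using rigid_touch[OF bt _ x(1) Ux] U by auto
    let ?s = "\<tau>(h := {a, b}, g := {})"
    have "excess ?s < excess \<tau>" unfolding excess_def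
    proof (rule sum_strict_mono_ex1[OF finite_N])
      show "\<forall>y\<in>N. load ?s y - cap y \<le> load \<tau> y - cap y"
      proof
        fix y
        show "load ?s y - cap y \<le> load \<tau> y - cap y"
          using ls[OF g(1), of y] sl by (cases "y = a \<or> y = b") (auto split: if_splits)
      qed
      have xab: "x \<notin> {a, b}" using x sl by (auto simp: bad_def)
      have "load ?s x + 1 = load \<tau> x" using ls[OF g(1), of x] g(2) xab by simp
      moreover have "cap x < load \<tau> x" "x \<in> N" using x by (auto simp: bad_def)
      ultimately show "\<exists>y\<in>N. load ?s y - cap y < load \<tau> y - cap y"
        by (intro bexI[of _ x]) auto
    qed
    then show False using mn[OF loc_base[OF sw[OF g(1)]]] by simp
  qed
  have "bad \<tau> \<subseteq> S - U" using v nb by (auto simp: valid_def)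
  moreover have "U \<inter> S \<noteq> {}" using n U unfolding same_def by blast
  then have "S - U \<subset> S" by auto
  ultimately obtain x where x: "x \<in> S" "x \<in> U" "\<not> room \<tau> (S - U) x"
    using v unfolding valid_def by (metis Diff_iff)
  obtain g where g: "g \<in> inn \<tau> U" "x \<in> \<tau> g" using rigid_touch[OF bt _ x(2) Ux] U by auto
  let ?s = "\<tau>(h := {a, b}, g := {})"
  have lc: "load \<tau> y \<le> cap y" if "y \<in> U" for y
    using nb that U by (auto simp: bad_def rigid_def not_less)
  have "load ?s y \<le> cap y" if "y \<in> U" for y
    using ls[OF g(1), of y] lc[OF that] sl by (cases "y = a \<or> y = b") (auto split: if_splits)
  moreover have "load ?s x < cap x"
    using ls[OF g(1), of x] g(2) x ab lc[OF x(2)] by (auto split: if_splits)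
  ultimately have "room \<tau> (S - U) x"
    unfolding room_def using sw[OF g(1)] U x by (intro exI[of _ U] exI[of _ ?s]) auto
  then show False using x by simp
qed

lemma opt_free_link:
  assumes o: "opt \<tau> S" and h: "h \<in> L" "\<tau> h = {}" and ab: "a \<in> A h - S" "b \<in> A h - S"
  shows "(a, b) \<in> same \<tau> S"
proof (rule ccontr)
  assume n: "(a, b) \<notin> same \<tau> S"
  have bt: "base \<tau>" and v: "valid \<tau> S" using o by (auto simp: opt_def)
  have abN: "a \<in> N - S" "b \<in> N - S" using ab A_sub h by auto
  have neq: "a \<noteq> b"
    using n rigid_singleton[OF base_config[OF bt], of a] abN unfolding same_def by auto
  obtain D \<sigma>1 where D: "rigid \<tau> D" "a \<in> D" "D \<inter> S = {}" "loc \<tau> D \<sigma>1"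
    and cD: "\<And>y. y \<in> D \<Longrightarrow> load \<sigma>1 y \<le> cap y" "load \<sigma>1 a < cap a"
    using opt_room[OF o abN(1)] by (auto simp: room_def)
  obtain E \<sigma>2 where E: "rigid \<tau> E" "b \<in> E" "E \<inter> S = {}" "loc \<tau> E \<sigma>2"
    and cE: "\<And>y. y \<in> E \<Longrightarrow> load \<sigma>2 y \<le> cap y" "load \<sigma>2 b < cap b"
    using opt_room[OF o abN(2)] by (auto simp: room_def)
  have DE: "D \<inter> E = {}"
  proof (rule ccontr)
    assume "D \<inter> E \<noteq> {}"
    then have "rigid \<tau> (D \<union> E)" using rigid_union_inter[OF base_sparse[OF bt] D(1) E(1)] by simp
    then show False using n D E unfolding same_def by blast
  qed
  obtain \<sigma> where \<sigma>: "loc \<sigma>1 E \<sigma>" "loc \<sigma>2 D \<sigma>"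
    and c: "\<And>h. h \<in> L \<Longrightarrow> \<sigma>1 h = \<tau> h \<and> \<sigma> h = \<sigma>2 h \<or> \<sigma>2 h = \<tau> h \<and> \<sigma> h = \<sigma>1 h"
    using loc_combine[OF bt D(1) E(1) DE D(4) E(4)] by blast
  note o1 = opt_loc[OF o D(1,3,4) cD(1)]
  have b1: "base \<sigma>1" and bs: "base \<sigma>" using D \<sigma> loc_base by blast+
  have rE: "rigid \<sigma>1 E" using loc_rigid[OF bt D(4), of E] E DE by auto
  have lE: "load \<sigma> y = load \<sigma>2 y" if "y \<in> E" for y using loc_load[OF \<sigma>(2)] that DE by auto
  have lD: "load \<sigma> y = load \<sigma>1 y" if "y \<in> D" for y using loc_load[OF \<sigma>(1)] that DE by auto
  have cs: "load \<sigma> y \<le> cap y" if "y \<in> E" for y using lE[OF that] cE(1)[OF that] by simp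
  note o2 = opt_loc[OF o1(1) rE E(3) \<sigma>(1) cs]
  have sm: "same \<sigma> S = same \<tau> S" using o1 o2 by simp
  have rE': "rigid \<sigma> E" using loc_rigid[OF b1 \<sigma>(1), of E] rE by simp
  have "rigid \<sigma>1 D" using loc_rigid[OF bt D(4), of D] D by simp
  then have rD': "rigid \<sigma> D" using loc_rigid[OF b1 \<sigma>(1), of D] DE by auto
  show False
  proof (cases "\<sigma> h = {}")
    case True
    have "(a, b) \<in> same \<sigma> S"
      by (rule opt_free_slack[OF o2(1) h(1) True ab neq])
        (use cD(2) cE(2) lD[OF D(2)] lE[OF E(2)] in simp_all)
    then show False using n sm by simp
  next
    case False
    then have "\<sigma> h \<subseteq> D \<or> \<sigma> h \<subseteq> E"
      using c[OF h(1)] h(2) locD[OF D(4) h(1)] locD[OF E(4) h(1)] by auto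
    then show False
    proof
      assume "\<sigma> h \<subseteq> D"
      from opt_used_link[OF o2(1) h(1) False this rD' D(3) ab(2) D(2)] n sm show False by simp
    next
      assume "\<sigma> h \<subseteq> E"
      from opt_used_link[OF o2(1) h(1) False this rE' E(3) ab(1) E(2)] n sm show False
        by (auto dest: same_sym)
    qed
  qed
qed

text \<open>The shape of an obstruction to the degree bounds, ready for counting: apart from its
  ends in \<open>S\<close>, an inactive link meets only one part of the partition into classes and
  single vertices of \<open>S\<close>. The vertex \<open>x\<close> will make one load inequality
  strict.\<close>

theorem overload_structure:
  assumes "base \<tau>0" "\<nexists>\<tau>. base \<tau> \<and> (\<forall>x\<in>N. load \<tau> x \<le> cap x)"
  obtains \<tau> S x where "base \<tau>" "S \<subseteq> N" "\<And>x. x \<in> S \<Longrightarrow> cap x \<le> load \<tau> x" "x \<in> S" "cap x < load \<tau> x"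
    "\<And>h. h \<in> L \<Longrightarrow> h \<notin> active \<tau> S \<Longrightarrow> \<tau> h \<inter> S = {} \<and> (A h - S = {} \<or> (\<exists>D\<in>classes \<tau> S. A h - S \<subseteq> D))"
proof -
  obtain \<tau> S where o: "opt \<tau> S" using opt_exists[OF assms(1)] .
  have bt: "base \<tau>" and v: "valid \<tau> S" using o by (auto simp: opt_def)
  obtain x where x: "x \<in> N" "cap x < load \<tau> x" using assms(2) bt by (auto simp: not_le)
  have xS: "x \<in> S" using v x by (auto simp: valid_def bad_def)
  have SN: "S \<subseteq> N" using v by (auto simp: valid_def)
  note cf = base_config[OF bt] and sp = base_sparse[OF bt]
  have "\<tau> h \<inter> S = {} \<and> (A h - S = {} \<or> (\<exists>D\<in>classes \<tau> S. A h - S \<subseteq> D))"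
    if h: "h \<in> L" "h \<notin> active \<tau> S" for h
  proof (cases "\<tau> h = {}")
    case True
    have "\<exists>D\<in>classes \<tau> S. A h - S \<subseteq> D" if a: "a \<in> A h - S" for a
    proof
      show "A h - S \<subseteq> cls \<tau> S a"
      proof
        fix b assume "b \<in> A h - S"
        then have "(a, b) \<in> same \<tau> S" by (rule opt_free_link[OF o h(1) True a])
        then show "b \<in> cls \<tau> S a" unfolding same_def cls_def by blast
      qed
      show "cls \<tau> S a \<in> classes \<tau> S" using a A_sub[OF h(1)] by (auto simp: classes_def)
    qed
    then show ?thesis using True by blast
  next
    case False
    then obtain y where y: "y \<in> N - S" "\<tau> h \<subseteq> cls \<tau> S y"
      using h config_sub_N[OF cf h(1)] by (auto simp: active_def inn_def classes_def)
    note D = rigid_cls[OF cf sp y(1)] cls_disjoint[OF cf sp y(1)] cls_refl[OF cf sp y(1)]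
    have "A h - S \<subseteq> cls \<tau> S y"
    proof
      fix b assume "b \<in> A h - S"
      then have "(y, b) \<in> same \<tau> S" by (rule opt_used_link[OF o h(1) False y(2) D(1,2) _ D(3)])
      then show "b \<in> cls \<tau> S y" unfolding same_def cls_def by blast
    qed
    then show ?thesis using y D by (auto simp: classes_def)
  qed
  then show thesis using that[OF bt SN opt_load[OF o] xS x(2)] by blast
qed

end

section \<open>Balanced orientations\<close>

lemma card_filter_insert:
  "finite M \<Longrightarrow> h \<notin> M \<Longrightarrow> card {g \<in> insert h M. Q g} = card {g \<in> M. Q g} + (if Q h then 1 else 0)"
proof -
  assume "finite M" "h \<notin> M"
  moreover have "{g \<in> insert h M. Q g} = (if Q h then insert h {g \<in> M. Q g} else {g \<in> M. Q g})" by auto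
  ultimately show ?thesis by simp
qed

text \<open>Two edges \<open>xa\<close> and \<open>xb\<close> at a common vertex are replaced by the edge \<open>ab\<close>, whose orientation
  is then pulled back to the path \<open>axb\<close>.\<close>

lemma balanced_orientation:
  assumes "finite C" "\<And>h. h \<in> C \<Longrightarrow> card (B h) = 2"
  obtains \<alpha> where "\<And>h. h \<in> C \<Longrightarrow> \<alpha> h \<in> B h"
    "\<And>x. 2 * card {h \<in> C. \<alpha> h = x} \<le> card {h \<in> C. x \<in> B h} + 1"
proof -
  have "\<exists>\<alpha>. (\<forall>h\<in>C. \<alpha> h \<in> B h) \<and> (\<forall>x. 2 * card {h \<in> C. \<alpha> h = x} \<le> card {h \<in> C. x \<in> B h} + 1)"
    using assms
  proof (induction "card C" arbitrary: C B rule: less_induct)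
    case less
    show ?case
    proof (cases "\<exists>x. \<exists>h1\<in>C. \<exists>h2\<in>C. h1 \<noteq> h2 \<and> x \<in> B h1 \<and> x \<in> B h2")
      case False
      define \<alpha> where "\<alpha> h = (SOME x. x \<in> B h)" for h
      have \<alpha>: "\<alpha> h \<in> B h" if "h \<in> C" for h
      proof -
        have "B h \<noteq> {}" using less.prems(2)[OF that] by auto
        then show ?thesis unfolding \<alpha>_def by (simp add: some_in_eq)
      qed
      have "2 * card {h \<in> C. \<alpha> h = x} \<le> card {h \<in> C. x \<in> B h} + 1" for x
      proof -
        have "card {h \<in> C. \<alpha> h = x} \<le> card {h \<in> C. x \<in> B h}"
          using \<alpha> less.prems(1) by (intro card_mono) auto
        moreover have "card {h \<in> C. x \<in> B h} \<le> 1"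
          using False less.prems(1) by (auto simp: card_le_Suc0_iff_eq)
        ultimately show ?thesis by linarith
      qed
      then show ?thesis using \<alpha> by blast
    next
      case True
      then obtain x h1 h2 where x: "h1 \<in> C" "h2 \<in> C" "h1 \<noteq> h2" "x \<in> B h1" "x \<in> B h2" by blast
      have "\<exists>a. B h1 = {x, a} \<and> a \<noteq> x" using less.prems(2)[OF x(1)] x(4) by (auto simp: card_2_iff)
      then obtain a where a: "B h1 = {x, a}" "a \<noteq> x" by blast
      have "\<exists>b. B h2 = {x, b} \<and> b \<noteq> x" using less.prems(2)[OF x(2)] x(5) by (auto simp: card_2_iff)
      then obtain b where b: "B h2 = {x, b}" "b \<noteq> x" by blast
      define M where "M = C - {h1, h2}"
      have M: "C = insert h1 (insert h2 M)" "h1 \<notin> insert h2 M" "h2 \<notin> M" "finite M" "h1 \<notin> M"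
        using x less.prems(1) by (auto simp: M_def)
      have cC: "card {g \<in> C. Q g} = card {g \<in> M. Q g} + (if Q h1 then 1 else 0) + (if Q h2 then 1 else 0)" for Q
      proof -
        have "finite (insert h2 M)" using M(4) by simp
        from card_filter_insert[OF this M(2), of Q] card_filter_insert[OF M(4,3), of Q]
        show ?thesis unfolding M(1) by linarith
      qed
      show ?thesis
      proof (cases "a = b")
        case True
        have "card M < card C" using M by simp
        from less.hyps[OF this M(4), of B] obtain \<alpha> where \<alpha>: "\<forall>h\<in>M. \<alpha> h \<in> B h"
          "\<forall>x. 2 * card {h \<in> M. \<alpha> h = x} \<le> card {h \<in> M. x \<in> B h} + 1"
          using less.prems(2) M(1) by blast
        \<comment> \<open>Two parallel edges are oriented oppositely, so each of their common ends
          is chosen once out of two times.\<close>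
        let ?\<alpha> = "\<alpha>(h1 := x, h2 := a)"
        have e: "{g \<in> M. ?\<alpha> g = y} = {g \<in> M. \<alpha> g = y}" for y using M by auto
        have "2 * card {h \<in> C. ?\<alpha> h = y} \<le> card {h \<in> C. y \<in> B h} + 1" for y
          using \<alpha>(2)[rule_format, of y] a b True M x(3) unfolding cC e by auto
        moreover have "\<forall>h\<in>C. ?\<alpha> h \<in> B h" using \<alpha>(1) M a b True by auto
        ultimately show ?thesis by blast
      next
        case False
        let ?B = "B(h1 := {a, b})"
        let ?M = "insert h1 M"
        have "card ?M < card C" "finite ?M" using M by auto
        moreover have "\<And>h. h \<in> ?M \<Longrightarrow> card (?B h) = 2" using less.prems(2) M False by auto
        ultimately obtain \<alpha> where \<alpha>: "\<forall>h\<in>?M. \<alpha> h \<in> ?B h"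
          "\<forall>x. 2 * card {h \<in> ?M. \<alpha> h = x} \<le> card {h \<in> ?M. x \<in> ?B h} + 1"
          using less.hyps[of ?M ?B] by blast
        define \<beta> where "\<beta> = (if \<alpha> h1 = a then \<alpha>(h2 := x) else \<alpha>(h1 := x, h2 := b))"
        have ab: "\<alpha> h1 = a \<or> \<alpha> h1 = b" using \<alpha>(1) by auto
        have e: "{g \<in> M. \<beta> g = y} = {g \<in> M. \<alpha> g = y}" "{g \<in> M. y \<in> ?B g} = {g \<in> M. y \<in> B g}" for y
          using M by (auto simp: \<beta>_def)
        have bh: "\<beta> h1 = (if \<alpha> h1 = a then a else x)" "\<beta> h2 = (if \<alpha> h1 = a then x else b)"
          using x(3) by (auto simp: \<beta>_def)
        have "2 * card {h \<in> C. \<beta> h = y} \<le> card {h \<in> C. y \<in> B h} + 1" for y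
        proof -
          have "2 * (card {g \<in> M. \<alpha> g = y} + (if \<alpha> h1 = y then 1 else 0))
              \<le> card {g \<in> M. y \<in> B g} + (if y = a \<or> y = b then 1 else 0) + 1"
            using \<alpha>(2)[rule_format, of y] unfolding card_filter_insert[OF M(4,5)] e by simp
          then show ?thesis
            unfolding cC e(1) a(1) b(1) bh using ab a(2) b(2) False x(3)
            by (cases "y = x"; cases "y = a"; cases "y = b"; cases "\<alpha> h1 = a"; simp)
        qed
        moreover have "\<beta> h \<in> B h" if h: "h \<in> C" for h
        proof (cases "h = h1 \<or> h = h2")
          case True
          then show ?thesis using bh a(1) b(1) by (auto split: if_splits)
        next
          case False
          then have "h \<in> M" "h \<noteq> h1" using h M(1) by auto
          then have "\<alpha> h \<in> B h" using \<alpha>(1) by (metis fun_upd_other insertI2)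
          then show ?thesis using False by (simp add: \<beta>_def)
        qed
        ultimately show ?thesis by blast
      qed
    qed
  qed
  then show thesis using that by blast
qed

section \<open>Packing trees in a coloured hypergraph\<close>

lemma sum_card_swap:
  "finite P \<Longrightarrow> finite H \<Longrightarrow> (\<Sum>D\<in>P. card {h \<in> H. R h D}) = (\<Sum>h\<in>H. card {D \<in> P. R h D})"
proof -
  assume f: "finite P" "finite H"
  have "(\<Sum>D\<in>P. card {h \<in> H. R h D}) = (\<Sum>D\<in>P. \<Sum>h\<in>H. if R h D then 1 else 0)"
    using f by (intro sum.cong refl) (simp add: sum.If_cases Int_def)
  also have "\<dots> = (\<Sum>h\<in>H. \<Sum>D\<in>P. if R h D then 1 else 0)" by (rule sum.swap)
  also have "\<dots> = (\<Sum>h\<in>H. card {D \<in> P. R h D})"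
    using f by (intro sum.cong refl) (simp add: sum.If_cases Int_def)
  finally show ?thesis .
qed

lemma sum_indicator_card: "finite H \<Longrightarrow> (\<Sum>h\<in>H. if Q h then 1 else (0::nat)) = card {h \<in> H. Q h}"
  by (simp add: sum.If_cases Int_def)

lemma card_parts_meeting:
  assumes "partition_on N P" "finite X" "X \<subseteq> N"
  shows "card {D \<in> P. X \<inter> D \<noteq> {}} \<le> card X"
proof -
  define f where "f x = (SOME D. D \<in> P \<and> x \<in> D)" for x
  have "{D \<in> P. X \<inter> D \<noteq> {}} \<subseteq> f ` X"
  proof
    fix D assume D: "D \<in> {D \<in> P. X \<inter> D \<noteq> {}}"
    then obtain x where x: "x \<in> X" "x \<in> D" by auto
    have "f x \<in> P \<and> x \<in> f x" unfolding f_def by (rule someI[of _ D]) (use D x in auto)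
    then have "f x = D" using assms(1) D x unfolding partition_on_def disjoint_def by blast
    then show "D \<in> f ` X" using x by blast
  qed
  then show ?thesis using surj_card_le[OF assms(2)] by simp
qed

section \<open>Boundary counts in a hypergraph with a root\<close>

text \<open>\<open>C\<close> consists of the links at \<open>v\<close> with a prescribed colour. By
  \<open>deg_v\<close> and \<open>card_C\<close>, at least \<open>k\<close> links at
  \<open>v\<close> are uncoloured.\<close>

locale rooted_hypergraph =
  fixes T :: "'a set" and v :: 'a and H :: "'l set" and A :: "'l \<Rightarrow> 'a set"
    and C :: "'l set" and c :: "'l \<Rightarrow> nat" and k :: nat
  assumes finite_T: "finite T" and v_T: "v \<in> T" and T_v: "T \<noteq> {v}" and finite_H: "finite H"
    and A_T: "h \<in> H \<Longrightarrow> A h \<subseteq> T \<and> 2 \<le> card (A h) \<and> card (A h) \<le> 3"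
    and cut: "X \<subseteq> T \<Longrightarrow> X \<noteq> {} \<Longrightarrow> X \<noteq> T \<Longrightarrow> 5 * k + 4 \<le> card {h \<in> H. A h \<inter> X \<noteq> {} \<and> \<not> A h \<subseteq> X}"
    and deg_v: "card {h \<in> H. v \<in> A h} = 5 * k + 4"
    and k_pos: "k > 0"
    and C_sub: "C \<subseteq> {h \<in> H. v \<in> A h}" and c_less: "h \<in> C \<Longrightarrow> c h < k"
    and c_surj: "i < k \<Longrightarrow> \<exists>h\<in>C. c h = i" and card_C: "card C \<le> 4 * k + 4"
begin

definition N :: "'a set" where "N = T - {v}"

definition B :: "'l \<Rightarrow> 'a set" where "B h = A h - {v}"

text \<open>The links at the disposal of all trees; an uncoloured link with a single end off
  \<open>v\<close> cannot help to connect \<open>N\<close>.\<close>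

definition Gen :: "'l set" where "Gen = {h \<in> H. h \<notin> C \<and> 2 \<le> card (B h)}"

definition weight :: "'a set set \<Rightarrow> 'l \<Rightarrow> nat" where
  "weight P h = card {D \<in> P. A h \<inter> D \<noteq> {} \<and> \<not> A h \<subseteq> D}"

definition crossing :: "'l set \<Rightarrow> 'a set \<Rightarrow> 'l set" where
  "crossing M X = {h \<in> M. B h \<inter> X \<noteq> {} \<and> \<not> B h \<subseteq> X}"

lemma finite_N: "finite N" and N_nonempty: "N \<noteq> {}" and v_N: "v \<notin> N"
  using finite_T v_T T_v by (auto simp: N_def)

lemma finite_C: "finite C"
  using C_sub finite_H finite_subset by fastforce

lemma B_N: "h \<in> H \<Longrightarrow> B h \<subseteq> N"
  using A_T by (auto simp: B_def N_def)

lemma finite_B: "h \<in> H \<Longrightarrow> finite (B h)"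
  using B_N finite_N finite_subset by blast

lemma A_B: "v \<notin> A h \<Longrightarrow> A h = B h" "v \<in> A h \<Longrightarrow> A h = insert v (B h)"
  by (auto simp: B_def)

lemma card_B:
  assumes "h \<in> H"
  shows "card (A h) = card (B h) + (if v \<in> A h then 1 else 0)"
proof (cases "v \<in> A h")
  case True
  have "v \<notin> B h" by (simp add: B_def)
  then have "card (insert v (B h)) = card (B h) + 1" using finite_B[OF assms] by simp
  then show ?thesis using True A_B(2)[OF True] by simp
next
  case False
  then show ?thesis using A_B(1)[OF False] by simp
qed

lemma card_B_bounds:
  assumes "h \<in> H"
  shows "1 \<le> card (B h)" "card (B h) \<le> 3" "v \<in> A h \<Longrightarrow> card (B h) \<le> 2" "v \<notin> A h \<Longrightarrow> 2 \<le> card (B h)"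
  using card_B[OF assms] A_T[OF assms] by (auto split: if_splits)

lemma B_nonempty: "h \<in> H \<Longrightarrow> B h \<noteq> {}"
  using card_B_bounds(1) by fastforce

lemma finite_partition: "partition_on N P \<Longrightarrow> finite P"
  using finite_N finite_elements by blast

lemma part_sub: "partition_on N P \<Longrightarrow> D \<in> P \<Longrightarrow> D \<subseteq> N" "partition_on N P \<Longrightarrow> D \<in> P \<Longrightarrow> D \<noteq> {}"
  unfolding partition_on_def by auto

lemma AB_meet: "D \<subseteq> N \<Longrightarrow> A h \<inter> D = B h \<inter> D"
  using v_N by (auto simp: B_def)

text \<open>No part contains \<open>v\<close>, so each part is a cut of \<open>T\<close>, even the
  single part of the trivial partition.\<close>

lemma sum_weight:
  assumes "partition_on N P"
  shows "(5 * k + 4) * card P \<le> (\<Sum>h\<in>H. weight P h)"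
proof -
  have "(\<Sum>D\<in>P. 5 * k + 4) \<le> (\<Sum>D\<in>P. card {h \<in> H. A h \<inter> D \<noteq> {} \<and> \<not> A h \<subseteq> D})"
  proof (rule sum_mono)
    fix D assume "D \<in> P"
    then have "D \<subseteq> N" "D \<noteq> {}" using part_sub[OF assms] by auto
    then show "5 * k + 4 \<le> card {h \<in> H. A h \<inter> D \<noteq> {} \<and> \<not> A h \<subseteq> D}"
      by (intro cut) (use v_T in \<open>auto simp: N_def\<close>)
  qed
  also have "\<dots> = (\<Sum>h\<in>H. weight P h)"
    unfolding weight_def by (rule sum_card_swap[OF finite_partition[OF assms] finite_H])
  finally show ?thesis by (simp add: mult.commute)
qed

lemma weight_le_card:
  assumes "partition_on N P" "h \<in> H"
  shows "weight P h \<le> card (B h)"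
proof -
  have "{D \<in> P. A h \<inter> D \<noteq> {} \<and> \<not> A h \<subseteq> D} \<subseteq> {D \<in> P. B h \<inter> D \<noteq> {}}"
  proof
    fix D assume D: "D \<in> {D \<in> P. A h \<inter> D \<noteq> {} \<and> \<not> A h \<subseteq> D}"
    then have "A h \<inter> D = B h \<inter> D" using AB_meet part_sub(1)[OF assms(1)] by simp
    then show "D \<in> {D \<in> P. B h \<inter> D \<noteq> {}}" using D by simp
  qed
  then have "weight P h \<le> card {D \<in> P. B h \<inter> D \<noteq> {}}"
    unfolding weight_def using finite_partition[OF assms(1)] by (intro card_mono) auto
  also have "\<dots> \<le> card (B h)"
    by (rule card_parts_meeting[OF assms(1) finite_B B_N]) (use assms in auto)
  finally show ?thesis .
qed

lemma weight_le_parts: "partition_on N P \<Longrightarrow> weight P h \<le> card P"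
  unfolding weight_def by (rule card_mono) (auto intro: finite_partition)

lemma weight_inside:
  assumes "partition_on N P" "h \<in> H" "D \<in> P" "B h \<subseteq> D"
  shows "weight P h \<le> (if v \<in> A h then 1 else 0)"
proof -
  have "{E \<in> P. A h \<inter> E \<noteq> {} \<and> \<not> A h \<subseteq> E} \<subseteq> (if v \<in> A h then {D} else {})"
  proof
    fix E assume E: "E \<in> {E \<in> P. A h \<inter> E \<noteq> {} \<and> \<not> A h \<subseteq> E}"
    then have "A h \<inter> E = B h \<inter> E" using AB_meet part_sub(1)[OF assms(1)] by simp
    then have "B h \<inter> E \<noteq> {}" using E by simp
    then have "E \<inter> D \<noteq> {}" using assms(4) by auto
    then have "E = D" using assms(1,3) E unfolding partition_on_def disjoint_def by blast
    then show "E \<in> (if v \<in> A h then {D} else {})" using E assms(4) A_B[of h] by auto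
  qed
  then have "weight P h \<le> card (if v \<in> A h then {D} else {})"
    unfolding weight_def by (rule card_mono[rotated]) auto
  then show ?thesis by (auto split: if_splits)
qed

text \<open>Each link at \<open>v\<close> is charged one for \<open>v\<close>, which makes
  \<open>5 * k + 4\<close> in total. Beyond this, a link inside a part costs nothing, a coloured one
  at most one because it has at most two ends off \<open>v\<close>, and an uncoloured one at most
  \<open>q\<close>, which stands for three or the number of parts.\<close>

lemma partition_count:
  assumes P: "partition_on N P" and q: "card P \<le> q \<or> 3 \<le> q"
  shows "(5 * k + 4) * card P \<le> q * card {h \<in> Gen. \<forall>D\<in>P. \<not> B h \<subseteq> D} + (5 * k + 4)
    + card {h \<in> C. \<forall>D\<in>P. \<not> B h \<subseteq> D}"
proof -
  let ?x = "\<lambda>h. \<forall>D\<in>P. \<not> B h \<subseteq> D"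
  have w: "weight P h \<le> q * (if h \<in> Gen \<and> ?x h then 1 else 0) + (if v \<in> A h then 1 else 0)
      + (if h \<in> C \<and> ?x h then 1 else 0)" if h: "h \<in> H" for h
  proof (cases "?x h")
    case False
    then obtain D where "D \<in> P" "B h \<subseteq> D" by auto
    from weight_inside[OF P h this] show ?thesis by auto
  next
    case True
    have two: "2 \<le> card (B h)"
    proof (rule ccontr)
      assume "\<not> ?thesis"
      then have "card (B h) = 1" using card_B_bounds(1)[OF h] by linarith
      then obtain x where x: "B h = {x}" by (auto simp: card_1_singleton_iff)
      then have "x \<in> N" using B_N[OF h] by auto
      then show False using P x True by (auto simp: partition_on_def)
    qed
    show ?thesis
    proof (cases "h \<in> C")
      case hC: True
      then have "v \<in> A h" using C_sub by auto
      then show ?thesis using weight_le_card[OF P h] card_B_bounds(3)[OF h] hC True by auto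
    next
      case False
      then have "h \<in> Gen" using h two by (simp add: Gen_def)
      moreover have "weight P h \<le> q"
        using q weight_le_card[OF P h] card_B_bounds(2)[OF h] weight_le_parts[OF P, of h] by linarith
      ultimately show ?thesis using True by auto
    qed
  qed
  have "(\<Sum>h\<in>H. weight P h) \<le> (\<Sum>h\<in>H. q * (if h \<in> Gen \<and> ?x h then 1 else 0) + (if v \<in> A h then 1 else 0)
      + (if h \<in> C \<and> ?x h then 1 else 0))"
    by (rule sum_mono) (rule w)
  also have "\<dots> = q * card {h \<in> H. h \<in> Gen \<and> ?x h} + card {h \<in> H. v \<in> A h} + card {h \<in> H. h \<in> C \<and> ?x h}"
    by (simp add: sum.distrib sum_distrib_left[symmetric] sum_indicator_card[OF finite_H])
  also have "{h \<in> H. h \<in> Gen \<and> ?x h} = {h \<in> Gen. ?x h}" by (auto simp: Gen_def)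
  also have "{h \<in> H. h \<in> C \<and> ?x h} = {h \<in> C. ?x h}" using C_sub by auto
  finally show ?thesis using sum_weight[OF P] deg_v by linarith
qed

lemma many_parts_count:
  assumes P: "partition_on N P" and t: "3 \<le> card P"
  shows "k * card P \<le> card {h \<in> Gen. \<forall>D\<in>P. \<not> B h \<subseteq> D} + k"
proof -
  let ?e = "card {h \<in> Gen. \<forall>D\<in>P. \<not> B h \<subseteq> D}"
  have "card {h \<in> C. \<forall>D\<in>P. \<not> B h \<subseteq> D} \<le> card C" by (rule card_mono[OF finite_C]) auto
  then have "(5 * k + 4) * card P \<le> 3 * ?e + (5 * k + 4) + (4 * k + 4)"
    using partition_count[OF P, of 3] card_C by linarith
  \<comment> \<open>What is needed is that \<open>(2 * k + 4) * card P\<close> be at least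
    \<open>6 * k + 8\<close>. Three parts give \<open>6 * k + 12\<close>; two parts would not
    do.\<close>
  moreover have "(2 * k + 4) * 3 \<le> (2 * k + 4) * card P" by (rule mult_le_mono2[OF t])
  ultimately show ?thesis by (simp add: algebra_simps)
qed

lemma two_parts:
  assumes X: "X \<subseteq> N" "X \<noteq> {}" "X \<noteq> N"
  shows "partition_on N {X, N - X}" "card {X, N - X} = 2"
    "M \<subseteq> H \<Longrightarrow> {h \<in> M. \<forall>D\<in>{X, N - X}. \<not> B h \<subseteq> D} = crossing M X"
proof -
  show "partition_on N {X, N - X}"
    using X by (auto simp: partition_on_def disjoint_def)
  have "X \<noteq> N - X" using X by auto
  then show "card {X, N - X} = 2" by simp
  show "{h \<in> M. \<forall>D\<in>{X, N - X}. \<not> B h \<subseteq> D} = crossing M X" if "M \<subseteq> H"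
    using B_N that by (auto simp: crossing_def)
qed

lemma bipartition_count:
  assumes X: "X \<subseteq> N" "X \<noteq> {}" "X \<noteq> N"
  shows "5 * k + 4 \<le> 2 * card (crossing Gen X) + card (crossing C X)"
proof -
  note t = two_parts[OF X]
  have "Gen \<subseteq> H" "C \<subseteq> H" using C_sub by (auto simp: Gen_def)
  then show ?thesis using partition_count[OF t(1), of 2] t by simp
qed

lemma finite_Gen: "finite Gen"
  using finite_H by (simp add: Gen_def)

text \<open>If \<open>Y\<close> cuts one side of the bipartition by \<open>X\<close>, the three
  resulting parts are crossed by fewer than \<open>2 * k\<close> uncoloured links, while
  \<open>many_parts_count\<close> demands \<open>2 * k\<close>.\<close>

lemma two_small_bipartitions:
  assumes X: "X \<subseteq> N" "X \<noteq> {}" "X \<noteq> N" and Y: "Y \<subseteq> N" "Y \<noteq> {}" "Y \<noteq> N"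
    and e: "card (crossing Gen X) < k" "card (crossing Gen Y) < k"
  shows "Y = X \<or> Y = N - X"
proof (rule ccontr)
  assume n: "\<not> ?thesis"
  have "\<exists>D. (D = X \<or> D = N - X) \<and> D \<inter> Y \<noteq> {} \<and> D - Y \<noteq> {}"
  proof (rule ccontr)
    assume m: "\<not> ?thesis"
    then have "X \<inter> Y = {} \<or> X \<subseteq> Y" "(N - X) \<inter> Y = {} \<or> N - X \<subseteq> Y" by blast+
    moreover have "Y \<subseteq> N" "X \<subseteq> N" using X Y by auto
    ultimately have "Y = {} \<or> Y = N - X \<or> Y = X \<or> Y = N" by (elim disjE) auto
    then show False using n Y by auto
  qed
  then obtain D where D: "D = X \<or> D = N - X" "D \<inter> Y \<noteq> {}" "D - Y \<noteq> {}" by blast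
  let ?Q = "{D \<inter> Y, D - Y, N - D}"
  have DN: "D \<subseteq> N" "N - D \<noteq> {}" using D X by auto
  have Q: "partition_on N ?Q" using D DN by (auto simp: partition_on_def disjoint_def)
  have "D \<inter> Y \<noteq> D - Y" "D \<inter> Y \<noteq> N - D" "D - Y \<noteq> N - D" using D DN by blast+
  then have cQ: "card ?Q = 3" by simp
  have GH: "h \<in> H" if "h \<in> Gen" for h using that by (simp add: Gen_def)
  have "{h \<in> Gen. \<forall>E\<in>?Q. \<not> B h \<subseteq> E} \<subseteq> crossing Gen X \<union> crossing Gen Y"
  proof
    fix h assume h: "h \<in> {h \<in> Gen. \<forall>E\<in>?Q. \<not> B h \<subseteq> E}"
    then have "B h \<subseteq> N" using B_N GH by auto
    then show "h \<in> crossing Gen X \<union> crossing Gen Y" using h D X(1) unfolding crossing_def by auto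
  qed
  then have "card {h \<in> Gen. \<forall>E\<in>?Q. \<not> B h \<subseteq> E} \<le> card (crossing Gen X \<union> crossing Gen Y)"
    by (rule card_mono[rotated]) (use finite_Gen in \<open>auto simp: crossing_def\<close>)
  also have "\<dots> \<le> card (crossing Gen X) + card (crossing Gen Y)" by (rule card_Un_le)
  finally show False using many_parts_count[OF Q] cQ e by simp
qed

lemma crossing_coloured:
  assumes "h \<in> crossing C X"
  shows "card (B h) = 2" "h \<in> H" "v \<in> A h"
proof -
  show h: "h \<in> H" "v \<in> A h" using assms C_sub by (auto simp: crossing_def)
  obtain x y where "x \<in> B h" "y \<in> B h" "x \<noteq> y" using assms by (auto simp: crossing_def)
  then have "card {x, y} \<le> card (B h)" by (intro card_mono finite_B[OF h(1)]) auto
  then show "card (B h) = 2" using card_B_bounds(3)[OF h] \<open>x \<noteq> y\<close> by simp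
qed

text \<open>If fewer than \<open>k\<close> uncoloured links cross some bipartition, then the bipartition is unique
  and is filled up to exactly \<open>k\<close> crossing links by coloured links of distinct colours.\<close>

lemma filling_exists:
  obtains F where "F \<subseteq> C" "\<And>h. h \<in> F \<Longrightarrow> card (B h) = 2"
    "\<And>P. partition_on N P \<Longrightarrow> k * card P \<le> card {h \<in> Gen \<union> F. \<forall>D\<in>P. \<not> B h \<subseteq> D} + k"
    "F \<noteq> {} \<Longrightarrow> \<exists>X\<subseteq>N. X \<noteq> {} \<and> X \<noteq> N \<and> card (crossing (Gen \<union> F) X) = k \<and> F \<subseteq> crossing C X \<and> inj_on c F"
proof -
  have one: "k * card P \<le> card {h \<in> Gen \<union> F. \<forall>D\<in>P. \<not> B h \<subseteq> D} + k"
    if "F \<subseteq> C" "partition_on N P" "card P \<noteq> 2" for F P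
  proof (cases "3 \<le> card P")
    case True
    have "card {h \<in> Gen. \<forall>D\<in>P. \<not> B h \<subseteq> D} \<le> card {h \<in> Gen \<union> F. \<forall>D\<in>P. \<not> B h \<subseteq> D}"
      using finite_Gen finite_C finite_subset[OF that(1)] by (intro card_mono) auto
    then show ?thesis using many_parts_count[OF that(2) True] by linarith
  next
    case False
    then have "card P = 0 \<or> card P = 1" using that(3) by linarith
    then show ?thesis by auto
  qed
  have two: "\<exists>Y. P = {Y, N - Y} \<and> Y \<subseteq> N \<and> Y \<noteq> {} \<and> Y \<noteq> N" if P: "partition_on N P" "card P = 2" for P
  proof -
    obtain Y Z where YZ: "P = {Y, Z}" "Y \<noteq> Z" using P(2) by (auto simp: card_2_iff)
    then have "Y \<inter> Z = {}" "Y \<union> Z = N" "Y \<noteq> {}" "Z \<noteq> {}"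
      using P(1) by (auto simp: partition_on_def disjoint_def)
    then show ?thesis using YZ by (intro exI[of _ Y]) auto
  qed
  show thesis
  proof (cases "\<exists>X\<subseteq>N. X \<noteq> {} \<and> X \<noteq> N \<and> card (crossing Gen X) < k")
    case False
    have "k * card P \<le> card {h \<in> Gen \<union> {}. \<forall>D\<in>P. \<not> B h \<subseteq> D} + k" if P: "partition_on N P" for P
    proof (cases "card P = 2")
      case True
      then obtain Y where Y: "P = {Y, N - Y}" "Y \<subseteq> N" "Y \<noteq> {}" "Y \<noteq> N" using two[OF P] by blast
      have "{h \<in> Gen \<union> {}. \<forall>D\<in>P. \<not> B h \<subseteq> D} = crossing Gen Y"
        using two_parts(3)[OF Y(2-4), of Gen] Y(1) by (auto simp: Gen_def)
      moreover have "k \<le> card (crossing Gen Y)" using False Y by (meson not_le)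
      ultimately show ?thesis using True by simp
    qed (use one[of "{}"] P in auto)
    then show thesis using that[of "{}"] by auto
  next
    case True
    then obtain X where X: "X \<subseteq> N" "X \<noteq> {}" "X \<noteq> N" and e: "card (crossing Gen X) < k" by blast
    let ?e = "card (crossing Gen X)"
    let ?I = "c ` crossing C X"
    have fc: "finite (crossing C X)" using finite_C by (simp add: crossing_def)
    have Ik: "?I \<subseteq> {..<k}" using c_less by (auto simp: crossing_def)
    have "{..<k} - ?I \<subseteq> c ` (C - crossing C X)" using c_surj by blast
    then have "card ({..<k} - ?I) \<le> card (C - crossing C X)"
      using surj_card_le[of "C - crossing C X"] finite_C by simp
    moreover have "card ({..<k} - ?I) = k - card ?I" using Ik fc by (simp add: card_Diff_subset)
    moreover have "card (C - crossing C X) = card C - card (crossing C X)"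
      using fc by (intro card_Diff_subset) (auto simp: crossing_def)
    moreover have "card (crossing C X) \<le> card C" using finite_C by (intro card_mono) (auto simp: crossing_def)
    moreover have "card ?I \<le> k" using card_mono[OF _ Ik] by simp
    \<comment> \<open>By \<open>bipartition_count\<close>, at most \<open>2 * ?e - k\<close>
      coloured links do not cross \<open>X\<close>. Only their colours can be missing on the
      crossing ones, so at least \<open>2 * (k - ?e)\<close> colours occur there.\<close>
    ultimately have "k - ?e \<le> card ?I" using bipartition_count[OF X] card_C e by linarith
    then obtain I where I: "I \<subseteq> ?I" "card I = k - ?e" using obtain_subset_with_card_n by metis
    define g where "g i = (SOME h. h \<in> crossing C X \<and> c h = i)" for i
    have g: "g i \<in> crossing C X \<and> c (g i) = i" if "i \<in> I" for i
      unfolding g_def by (rule someI_ex) (use I that in auto)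
    define F where "F = g ` I"
    have FC: "F \<subseteq> crossing C X" using g by (auto simp: F_def)
    have inj: "inj_on c F" using g by (auto simp: F_def inj_on_def)
    have "inj_on g I" using g by (metis inj_on_inverseI)
    then have cF: "card F = k - ?e" using I by (simp add: F_def card_image)
    have FC': "F \<subseteq> C" using FC by (auto simp: crossing_def)
    have fF: "finite F" using FC' finite_C finite_subset by auto
    have FH: "F \<subseteq> H" "Gen \<subseteq> H" using FC' C_sub by (auto simp: Gen_def)
    have "crossing (Gen \<union> F) X = crossing Gen X \<union> F" using FC by (auto simp: crossing_def)
    moreover have "crossing Gen X \<inter> F = {}" using FC' by (auto simp: crossing_def Gen_def)
    moreover have "finite (crossing Gen X)" using finite_Gen by (simp add: crossing_def)
    ultimately have cX: "card (crossing (Gen \<union> F) X) = k" using cF e fF by (simp add: card_Un_disjoint)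
    have "k * card P \<le> card {h \<in> Gen \<union> F. \<forall>D\<in>P. \<not> B h \<subseteq> D} + k" if P: "partition_on N P" for P
    proof (cases "card P = 2")
      case True
      then obtain Y where Y: "P = {Y, N - Y}" "Y \<subseteq> N" "Y \<noteq> {}" "Y \<noteq> N" using two[OF P] by blast
      have eq: "{h \<in> Gen \<union> F. \<forall>D\<in>P. \<not> B h \<subseteq> D} = crossing (Gen \<union> F) Y"
        using two_parts(3)[OF Y(2-4), of "Gen \<union> F"] Y(1) FH by auto
      have "k \<le> card (crossing (Gen \<union> F) Y)"
      proof (cases "card (crossing Gen Y) < k")
        case True
        then have "Y = X \<or> Y = N - X" using two_small_bipartitions[OF X Y(2-4) e] by simp
        moreover have "crossing (Gen \<union> F) (N - X) = crossing (Gen \<union> F) X"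
        proof -
          have "B h \<inter> (N - X) \<noteq> {} \<and> \<not> B h \<subseteq> N - X \<longleftrightarrow> B h \<inter> X \<noteq> {} \<and> \<not> B h \<subseteq> X" if "h \<in> Gen \<union> F" for h
          proof -
            have "B h \<subseteq> N" using that FH B_N by auto
            then show ?thesis by blast
          qed
          then show ?thesis by (auto simp only: crossing_def)
        qed
        ultimately show ?thesis using cX by auto
      next
        case False
        moreover have "card (crossing Gen Y) \<le> card (crossing (Gen \<union> F) Y)"
          using finite_Gen fF by (intro card_mono) (auto simp: crossing_def)
        ultimately show ?thesis by linarith
      qed
      then show ?thesis using True eq by simp
    qed (use one[OF FC'] P in auto)
    then show thesis using that[of F] FC' FC inj cX X crossing_coloured(1) by blast
  qed
qed

end

lemma linked_crossing:
  assumes "(x, y) \<in> linked A F" "x \<in> X" "y \<notin> X"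
  obtains f where "f \<in> F" "A f \<inter> X \<noteq> {}" "\<not> A f \<subseteq> X"
proof -
  have "\<exists>f\<in>F. A f \<inter> X \<noteq> {} \<and> \<not> A f \<subseteq> X"
  proof (rule ccontr)
    assume n: "\<not> ?thesis"
    have "linked A F \<subseteq> {(x, y). x \<in> X \<longrightarrow> y \<in> X}"
    proof (rule linked_subset)
      fix f p q assume f: "f \<in> F" "A f = {p, q}"
      have "p \<in> X \<longrightarrow> q \<in> X"
      proof
        assume "p \<in> X"
        then have "A f \<inter> X \<noteq> {}" using f(2) by simp
        then have "A f \<subseteq> X" using n f(1) by blast
        then show "q \<in> X" using f(2) by simp
      qed
      then show "(p, q) \<in> {(x, y). x \<in> X \<longrightarrow> y \<in> X}" by simp
    qed auto
    then show False using assms by auto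
  qed
  then show thesis using that by blast
qed

section \<open>Degree bounds at the tight terminals\<close>

text \<open>Here \<open>s\<close> is the size of \<open>S\<close>, \<open>r\<close> the number of
  classes, \<open>K\<close> the number of active links, and \<open>m\<close> that of the coloured
  links outside the filling with two ends off \<open>v\<close>. Summed over \<open>S\<close>,
  \<open>U\<close> counts the inactive links at a vertex, \<open>W\<close> those of the
  \<open>m\<close> links at it, \<open>Att\<close> those of them attached to it, \<open>Y\<close>
  the coloured links having it as only end off \<open>v\<close>, and \<open>J\<close> the loads. For
  \<open>r >= 3\<close> the boundaries suffice without \<open>J\<close>. With fewer classes the
  loads come in, and \<open>r = s = 1\<close> needs the further cut behind
  \<open>one\<close>.\<close>

lemma overload_arith:
  fixes k s r K U m W Att J Y :: nat
  assumes "k \<ge> 1" "s \<ge> 1" and K: "K + k = k * (s + r)"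
    and cuts: "(5 * k + 4) * (r + s) \<le> 3 * K + (5 * k + 4) + 2 * U + m"
    and U: "U + W \<le> k * s + Att" and Att: "2 * Att \<le> W + s"
    and J: "s * (4 * k + 4) + 1 \<le> J + Y + Att"
    and J1: "s = 1 \<Longrightarrow> J \<le> K" and J2: "s = 2 \<Longrightarrow> J \<le> 2 * K" and J3: "J + k \<le> 2 * K + k * s"
    and Y: "Y + m \<le> 4 * k + 4" and Am: "Att \<le> m"
    and one: "r = 1 \<Longrightarrow> s = 1 \<Longrightarrow> 2 * Y + W \<le> 5 * k + 4"
  shows False
proof -
  consider "r \<ge> 3" | "r = 2" | "r = 1" | "r = 0" by linarith
  then show False
  proof cases
    case 1
    then obtain q where q: "r = q + 3" by (metis add.commute le_Suc_ex)
    have "U \<le> k * s"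
    proof (cases "Att \<le> W")
      case True
      then show ?thesis using U by linarith
    next
      case False
      then show ?thesis using U cuts K Att Y Am unfolding q by (simp add: algebra_simps)
    qed
    then show False using cuts K Y unfolding q by (simp add: algebra_simps)
  next
    case 2
    consider "s = 1" | "s = 2" | "s \<ge> 3" using assms(2) by linarith
    then show False
    proof cases
      case 3
      then obtain q where q: "s = q + 3" by (metis add.commute le_Suc_ex)
      show False using cuts K Y U J3 J Att Am unfolding q 2 by (simp add: algebra_simps)
    qed (use 2 cuts K Y U J1 J2 J Att Am in \<open>simp_all add: algebra_simps\<close>)
  next
    case r: 3
    consider "s = 1" | "s = 2" | "s \<ge> 3" using assms(2) by linarith
    then show False
    proof cases
      case 3
      then obtain q where q: "s = q + 3" by (metis add.commute le_Suc_ex)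
      show False using cuts K Y U J3 J Att Am unfolding q r by (simp add: algebra_simps)
    qed (use r one cuts K Y U J1 J2 J Att Am assms(1) in \<open>simp_all add: algebra_simps\<close>)
  next
    case r: 4
    consider "s = 1" | "s = 2" | "s \<ge> 3" using assms(2) by linarith
    then show False
    proof cases
      case 3
      then obtain q where q: "s = q + 3" by (metis add.commute le_Suc_ex)
      show False using cuts K Y U J3 J Att Am unfolding q r by (simp add: algebra_simps)
    qed (use r cuts K Y U J1 J2 J Att Am assms(1) in \<open>simp_all add: algebra_simps\<close>)
  qed
qed

context rooted_hypergraph
begin

text \<open>Both \<open>v\<close> and \<open>x\<close> have degree \<open>5 * k + 4\<close>, and at
  least as many links leave the pair; so the links inside the pair and the links common to both
  vertices number at most \<open>5 * k + 4\<close> together.\<close>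

lemma root_pair_cut:
  assumes x: "x \<in> N" "N \<noteq> {x}" and d: "card {h \<in> H. x \<in> A h} = 5 * k + 4"
  shows "card {h \<in> C. B h = {x}} + card {h \<in> C. x \<in> B h} \<le> 5 * k + 4"
proof -
  let ?V = "{h \<in> H. v \<in> A h}" and ?D = "{h \<in> H. x \<in> A h}" and ?I = "{h \<in> H. A h = {v, x}}"
  let ?X = "{h \<in> H. A h \<inter> {v, x} \<noteq> {} \<and> \<not> A h \<subseteq> {v, x}}"
  have xv: "x \<in> T" "x \<noteq> v" using x by (auto simp: N_def)
  have "{v, x} \<noteq> T"
  proof
    assume "{v, x} = T"
    then have "N = {x}" using xv by (auto simp: N_def)
    then show False using x by simp
  qed
  then have 1: "5 * k + 4 \<le> card ?X" by (intro cut) (use v_T xv in auto)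
  have "?X \<union> ?I \<subseteq> ?V \<union> ?D" by auto
  then have "card (?X \<union> ?I) \<le> card (?V \<union> ?D)" by (rule card_mono[rotated]) (use finite_H in auto)
  moreover have "card (?X \<union> ?I) = card ?X + card ?I" by (rule card_Un_disjoint) (use finite_H in auto)
  moreover have "card ?V + card ?D = card (?V \<union> ?D) + card (?V \<inter> ?D)"
    by (rule card_Un_Int) (use finite_H in auto)
  moreover have "card {h \<in> C. B h = {x}} \<le> card ?I"
    using C_sub finite_H A_B(2) by (intro card_mono) auto
  moreover have "card {h \<in> C. x \<in> B h} \<le> card (?V \<inter> ?D)"
    using C_sub finite_H by (intro card_mono) (auto simp: B_def)
  ultimately show ?thesis using 1 d deg_v by linarith
qed

text \<open>If every base overloads a vertex, \<open>overload_structure\<close> yields a partition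
  of \<open>N\<close> into classes and single vertices. The boundaries of its parts, and the degrees
  and loads summed over \<open>S\<close>, give the inequalities that \<open>overload_arith\<close>
  refutes. A coloured link outside \<open>F\<close> is not trimmed; it burdens the vertex
  \<open>\<alpha> h\<close> and lowers the cap there.\<close>

lemma bounded_base:
  assumes F: "F \<subseteq> C" "\<And>h. h \<in> F \<Longrightarrow> card (B h) = 2"
    and count: "\<And>P. partition_on N P \<Longrightarrow> k * card P \<le> card {h \<in> Gen \<union> F. \<forall>D\<in>P. \<not> B h \<subseteq> D} + k"
    and \<alpha>: "\<And>h. h \<in> C - F \<Longrightarrow> \<alpha> h \<in> B h"
      "\<And>x. 2 * card {h \<in> C - F. card (B h) = 2 \<and> \<alpha> h = x} \<le> card {h \<in> C - F. card (B h) = 2 \<and> x \<in> B h} + 1"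
  shows "\<exists>\<tau>. link_system.base N (Gen \<union> F) B k \<tau> \<and>
    (\<forall>x\<in>N. card {h \<in> H. x \<in> A h} = 5 * k + 4 \<longrightarrow>
      card {h \<in> Gen \<union> F. x \<in> \<tau> h} + card {h \<in> C - F. \<alpha> h = x} \<le> 4 * k + 4)"
proof -
  define L where "L = Gen \<union> F"
  define \<beta> where "\<beta> x = card {h \<in> C - F. \<alpha> h = x}" for x
  \<comment> \<open>The value \<open>Suc (card L)\<close> exceeds every load and thus means that there is no bound.\<close>
  define cap where "cap x = (if card {h \<in> H. x \<in> A h} = 5 * k + 4 then 4 * k + 4 - \<beta> x else Suc (card L))" for x
  have FH: "F \<subseteq> H" using F C_sub by auto
  have LH: "L \<subseteq> H" using FH by (auto simp: L_def Gen_def)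
  have fL: "finite L" using LH finite_H finite_subset by auto
  have LC: "h \<notin> C - F" if "h \<in> L" for h using that by (auto simp: L_def Gen_def)
  have \<beta>C: "\<beta> x \<le> 4 * k + 4" for x
  proof -
    have "\<beta> x \<le> card C" unfolding \<beta>_def using finite_C by (intro card_mono) auto
    then show ?thesis using card_C by linarith
  qed
  have L2: "2 \<le> card (B h) \<and> card (B h) \<le> 3" if "h \<in> L" for h
    using that F(2)[of h] LH card_B_bounds(2)[of h] by (auto simp: L_def Gen_def)
  interpret G: capped_link_system N L B k cap
  proof unfold_locales
    show "B h \<subseteq> N" if "h \<in> L" for h using B_N LH that by blast
    show "2 \<le> card (B h) \<and> card (B h) \<le> 3" if "h \<in> L" for h by (rule L2[OF that])
  qed (rule finite_N N_nonempty fL k_pos)+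
  have countL: "k * card P \<le> card {h \<in> L. \<forall>D\<in>P. \<not> B h \<subseteq> D} + k" if "partition_on N P" for P
    using count[OF that] by (simp only: L_def)
  obtain \<tau>0 where \<tau>0: "G.base \<tau>0" using G.base_exists[OF countL] by blast
  show ?thesis
  proof (cases "\<exists>\<tau>. G.base \<tau> \<and> (\<forall>x\<in>N. G.load \<tau> x \<le> cap x)")
    case True
    then obtain \<tau> where \<tau>: "G.base \<tau>" "\<And>x. x \<in> N \<Longrightarrow> G.load \<tau> x \<le> cap x" by blast
    have "card {h \<in> L. x \<in> \<tau> h} + \<beta> x \<le> 4 * k + 4" if "x \<in> N" "card {h \<in> H. x \<in> A h} = 5 * k + 4" for x
      using \<tau>(2)[OF that(1)] that(2) \<beta>C[of x] by (simp add: cap_def G.load_def)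
    then show ?thesis using \<tau>(1) unfolding L_def \<beta>_def by blast
  next
    case False
    obtain \<tau> S x0 where \<tau>: "G.base \<tau>" and SN: "S \<subseteq> N" and cl: "\<And>x. x \<in> S \<Longrightarrow> cap x \<le> G.load \<tau> x"
      and x0: "x0 \<in> S" "cap x0 < G.load \<tau> x0"
      and inact: "\<And>h. h \<in> L \<Longrightarrow> h \<notin> G.active \<tau> S \<Longrightarrow>
        \<tau> h \<inter> S = {} \<and> (B h - S = {} \<or> (\<exists>D\<in>G.classes \<tau> S. B h - S \<subseteq> D))"
      using G.overload_structure[OF \<tau>0 False] by blast
    note cf = G.base_config[OF \<tau>] and sp = G.base_sparse[OF \<tau>]
    define Ac where "Ac = G.active \<tau> S"
    define Cl where "Cl = G.classes \<tau> S"
    define s where "s = card S"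
    define r where "r = card Cl"
    have fS: "finite S" using SN finite_N finite_subset by auto
    have s1: "s \<ge> 1" using x0 fS by (auto simp: s_def Suc_le_eq card_gt_0_iff)
    have AcL: "Ac \<subseteq> L" by (auto simp: Ac_def G.active_def G.inn_def)
    have AcH: "Ac \<subseteq> H" using AcL LH by auto
    have fA: "finite Ac" using AcL fL finite_subset by auto
    have part: "partition_on (N - S) Cl" unfolding Cl_def by (rule G.partition_classes[OF cf sp SN])
    have fCl: "finite Cl" unfolding Cl_def by (rule G.finite_classes)
    have cN: "card N = card (N - S) + s"
      using SN fS finite_N card_mono[OF finite_N SN] by (simp add: s_def card_Diff_subset)
    have K: "card Ac + k = k * (s + r)"
    proof -
      have "card Ac + k * card (N - S) = card (G.inn \<tau> N) + k * r"
        unfolding Ac_def r_def Cl_def by (rule G.card_active[OF cf sp SN])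
      moreover have "card (G.inn \<tau> N) + k = k * card N" using G.base_rigid[OF \<tau>] by (simp add: G.rigid_def)
      ultimately show ?thesis unfolding cN by (simp add: algebra_simps)
    qed
    define P where "P = Cl \<union> (\<lambda>x. {x}) ` S"
    have dis: "Cl \<inter> (\<lambda>x. {x}) ` S = {}" using part by (auto simp: partition_on_def)
    have P: "partition_on N P"
    proof (rule partition_onI)
      have un: "\<Union>Cl = N - S" using part by (simp add: partition_on_def)
      then show "\<Union>P = N" using SN by (auto simp: P_def)
      show "{} \<notin> P" using part by (auto simp: P_def partition_on_def)
      fix p q assume pq: "p \<in> P" "q \<in> P" "p \<noteq> q"
      have sub: "D \<subseteq> N - S" if "D \<in> Cl" for D using un that by auto
      show "disjnt p q"
      proof (cases "p \<in> Cl \<and> q \<in> Cl")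
        case True
        then have "p \<inter> q = {}" using part pq(3) by (simp add: partition_on_def disjoint_def)
        then show ?thesis by (simp add: disjnt_def)
      next
        case False
        then show ?thesis using pq sub[of p] sub[of q] unfolding P_def disjnt_def by blast
      qed
    qed
    have cP: "card P = r + s"
      unfolding P_def r_def s_def using dis fCl fS by (simp add: card_Un_disjoint card_image)
    define Cs where "Cs = {h \<in> C - F. card (B h) = 2}"
    have fCs: "finite Cs" using finite_C by (simp add: Cs_def)
    define u where "u x = card {h \<in> L - Ac. x \<in> B h}" for x
    define y where "y x = card {h \<in> C - F. B h = {x}}" for x
    define W where "W x = card {h \<in> Cs. x \<in> B h}" for x
    define att where "att x = card {h \<in> Cs. \<alpha> h = x}" for x
    define U where "U = (\<Sum>h\<in>L - Ac. card {x \<in> S. x \<in> B h})"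
    have U: "U = (\<Sum>x\<in>S. u x)"
      unfolding U_def u_def by (rule sum_card_swap[symmetric]) (use fS fL in auto)
    \<comment> \<open>An active link meets at most three parts. An inactive link with n vertices in
      \<open>S\<close> meets at most one class besides them, and n + 1 is at most 2n for positive n;
      for n = 0 it lies inside a class.\<close>
    have w: "weight P h \<le> 3 * (if h \<in> Ac then 1 else 0) + (if v \<in> A h then 1 else 0)
        + 2 * (if h \<in> L - Ac then card {x \<in> S. x \<in> B h} else 0) + (if h \<in> Cs then 1 else 0)"
      if h: "h \<in> H" for h
    proof -
      consider "h \<in> Ac" | "h \<in> L - Ac" | "h \<notin> L" by auto
      then show ?thesis
      proof cases
        case 1
        then show ?thesis using weight_le_card[OF P h] card_B_bounds(2)[OF h] by simp
      next
        case 2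
        then have d: "B h - S = {} \<or> (\<exists>D\<in>Cl. B h - S \<subseteq> D)" using inact by (auto simp: Ac_def Cl_def)
        show ?thesis
        proof (cases "B h \<inter> S = {}")
          case True
          then have "\<exists>D\<in>P. B h \<subseteq> D" using d B_nonempty[OF h] by (auto simp: P_def)
          then obtain D where "D \<in> P" "B h \<subseteq> D" by blast
          from weight_inside[OF P h this] show ?thesis by auto
        next
          case False
          obtain D0 where D0: "B h - S \<subseteq> D0" "D0 \<in> Cl \<or> B h - S = {}" using d by blast
          have "{D \<in> P. A h \<inter> D \<noteq> {} \<and> \<not> A h \<subseteq> D} \<subseteq> insert D0 ((\<lambda>x. {x}) ` {x \<in> S. x \<in> B h})"
          proof
            fix D assume D: "D \<in> {D \<in> P. A h \<inter> D \<noteq> {} \<and> \<not> A h \<subseteq> D}"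
            then have "A h \<inter> D = B h \<inter> D" using AB_meet part_sub(1)[OF P] by simp
            then obtain z where z: "z \<in> B h" "z \<in> D" using D by auto
            show "D \<in> insert D0 ((\<lambda>x. {x}) ` {x \<in> S. x \<in> B h})"
            proof (cases "D \<in> Cl")
              case True
              then have "z \<notin> S" using z part by (auto simp: partition_on_def)
              then have "z \<in> D0" "D0 \<in> Cl" using z D0 by auto
              then have "D = D0" using part True z unfolding partition_on_def disjoint_def by blast
              then show ?thesis by simp
            next
              case False
              then show ?thesis using D z by (auto simp: P_def)
            qed
          qed
          then have "weight P h \<le> card (insert D0 ((\<lambda>x. {x}) ` {x \<in> S. x \<in> B h}))"
            unfolding weight_def by (rule card_mono[rotated]) (use fS in auto)
          also have "\<dots> \<le> Suc (card ((\<lambda>x. {x}) ` {x \<in> S. x \<in> B h}))" using fS by (simp add: card_insert_if)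
          also have "\<dots> = Suc (card {x \<in> S. x \<in> B h})" by (simp add: card_image)
          finally have "weight P h \<le> Suc (card {x \<in> S. x \<in> B h})" .
          moreover have "card {x \<in> S. x \<in> B h} > 0" using False fS by (auto simp: card_gt_0_iff)
          ultimately show ?thesis using 2 by simp
        qed
      next
        case 3
        show ?thesis
        proof (cases "h \<in> C")
          case True
          then have hC: "h \<in> C - F" "v \<in> A h" using 3 C_sub by (auto simp: L_def)
          show ?thesis
            using weight_le_card[OF P h] card_B_bounds(3)[OF h hC(2)] hC by (cases "card (B h) = 2") (auto simp: Cs_def)
        next
          case False
          then have "card (B h) \<le> 1" using 3 h by (auto simp: L_def Gen_def)
          then show ?thesis using weight_le_card[OF P h] card_B_bounds(4)[OF h] by (cases "v \<in> A h") auto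
        qed
      qed
    qed
    have CsH: "Cs \<subseteq> H" using C_sub by (auto simp: Cs_def)
    have cuts: "(5 * k + 4) * (r + s) \<le> 3 * card Ac + (5 * k + 4) + 2 * U + card Cs"
    proof -
      have "(\<Sum>h\<in>H. weight P h) \<le> (\<Sum>h\<in>H. 3 * (if h \<in> Ac then 1 else 0) + (if v \<in> A h then 1 else 0)
        + 2 * (if h \<in> L - Ac then card {x \<in> S. x \<in> B h} else 0) + (if h \<in> Cs then 1 else 0))"
        by (rule sum_mono) (rule w)
      also have "\<dots> = 3 * card {h \<in> H. h \<in> Ac} + card {h \<in> H. v \<in> A h}
          + 2 * (\<Sum>h\<in>H. if h \<in> L - Ac then card {x \<in> S. x \<in> B h} else 0) + card {h \<in> H. h \<in> Cs}"
        by (simp only: sum.distrib sum_distrib_left[symmetric] sum_indicator_card[OF finite_H])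
      also have "(\<Sum>h\<in>H. if h \<in> L - Ac then card {x \<in> S. x \<in> B h} else 0) = U"
      proof -
        have "H \<inter> (L - Ac) = L - Ac" using LH by auto
        then show ?thesis unfolding U_def by (metis (no_types) sum.inter_restrict[OF finite_H])
      qed
      also have "{h \<in> H. h \<in> Ac} = Ac" using AcH by auto
      also have "{h \<in> H. h \<in> Cs} = Cs" using CsH by auto
      finally show ?thesis using sum_weight[OF P] deg_v cP by simp
    qed
    have dS: "card {h \<in> H. x \<in> A h} = 5 * k + 4" "4 * k + 4 \<le> G.load \<tau> x + \<beta> x" if x: "x \<in> S" for x
    proof -
      have "G.load \<tau> x \<le> card L" unfolding G.load_def using fL by (intro card_mono) auto
      then show d: "card {h \<in> H. x \<in> A h} = 5 * k + 4" using cl[OF x] by (auto simp: cap_def split: if_splits)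
      show "4 * k + 4 \<le> G.load \<tau> x + \<beta> x" using cl[OF x] d by (simp add: cap_def)
    qed
    have \<beta>: "\<beta> x \<le> y x + att x" for x
    proof -
      have "{h \<in> C - F. \<alpha> h = x} \<subseteq> {h \<in> C - F. B h = {x}} \<union> {h \<in> Cs. \<alpha> h = x}"
      proof
        fix h assume h: "h \<in> {h \<in> C - F. \<alpha> h = x}"
        then have hH: "h \<in> H" "v \<in> A h" and xB: "x \<in> B h" using C_sub \<alpha>(1)[of h] by auto
        show "h \<in> {h \<in> C - F. B h = {x}} \<union> {h \<in> Cs. \<alpha> h = x}"
        proof (cases "card (B h) = 2")
          case False
          then have "card (B h) = 1" using card_B_bounds(1)[OF hH(1)] card_B_bounds(3)[OF hH] by linarith
          then have "B h = {x}" using xB by (auto simp: card_1_singleton_iff)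
          then show ?thesis using h by auto
        qed (use h in \<open>auto simp: Cs_def\<close>)
      qed
      then have "\<beta> x \<le> card ({h \<in> C - F. B h = {x}} \<union> {h \<in> Cs. \<alpha> h = x})"
        unfolding \<beta>_def by (rule card_mono[rotated]) (use finite_C fCs in auto)
      also have "\<dots> \<le> y x + att x" unfolding y_def att_def by (rule card_Un_le)
      finally show ?thesis .
    qed
    \<comment> \<open>The used links at \<open>x\<close>, the inactive ones and the two kinds of
      coloured ones outside \<open>F\<close> are disjoint families, because no inactive link is used
      at a vertex of \<open>S\<close>.\<close>
    have deg: "G.load \<tau> x + u x + y x + W x \<le> 5 * k + 4" if x: "x \<in> S" for x
    proof -
      let ?a = "{h \<in> L. x \<in> \<tau> h}" and ?b = "{h \<in> L - Ac. x \<in> B h}"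
        and ?c = "{h \<in> C - F. B h = {x}}" and ?d = "{h \<in> Cs. x \<in> B h}"
      have xv: "x \<noteq> v" using x SN v_N by auto
      have AB: "x \<in> B h \<Longrightarrow> x \<in> A h" for h by (simp add: B_def)
      have f: "finite ?a" "finite ?b" "finite ?c" "finite ?d" using fL finite_C fCs by auto
      have ab: "?a \<inter> ?b = {}" using inact x by (auto simp: Ac_def)
      have abc: "(?a \<union> ?b) \<inter> ?c = {}" using LC by auto
      have abcd: "(?a \<union> ?b \<union> ?c) \<inter> ?d = {}" using LC by (auto simp: Cs_def)
      have "?a \<union> ?b \<union> ?c \<union> ?d \<subseteq> {h \<in> H. x \<in> A h}"
      proof -
        have "?a \<subseteq> {h \<in> H. x \<in> A h}" using LH G.config_sub[OF cf] AB by blast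
        moreover have "?b \<subseteq> {h \<in> H. x \<in> A h}" using LH AB by blast
        moreover have "?c \<subseteq> {h \<in> H. x \<in> A h}" using C_sub AB by blast
        moreover have "?d \<subseteq> {h \<in> H. x \<in> A h}" using CsH AB by blast
        ultimately show ?thesis by blast
      qed
      then have "card (?a \<union> ?b \<union> ?c \<union> ?d) \<le> card {h \<in> H. x \<in> A h}"
        by (rule card_mono[rotated]) (use finite_H in auto)
      moreover have "card (?a \<union> ?b \<union> ?c \<union> ?d) = card ?a + card ?b + card ?c + card ?d"
        using card_Un_disjoint[OF f(1,2) ab] card_Un_disjoint[OF _ f(3) abc] card_Un_disjoint[OF _ f(4) abcd] f by simp
      ultimately show ?thesis using dS(1)[OF x] by (simp add: G.load_def u_def y_def W_def)
    qed
    \<comment> \<open>The \<open>k\<close> is the difference between the degree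
      \<open>5 * k + 4\<close> and the load \<open>4 * k + 4\<close> that a vertex of
      \<open>S\<close> carries at least.\<close>
    have u: "u x + W x \<le> k + att x" if x: "x \<in> S" for x
      using deg[OF x] dS(2)[OF x] \<beta>[of x] by linarith
    have UW: "U + (\<Sum>x\<in>S. W x) \<le> k * s + (\<Sum>x\<in>S. att x)"
    proof -
      have "(\<Sum>x\<in>S. u x + W x) \<le> (\<Sum>x\<in>S. k + att x)" by (rule sum_mono) (rule u)
      then show ?thesis by (simp add: U sum.distrib s_def mult.commute)
    qed
    have Att: "2 * (\<Sum>x\<in>S. att x) \<le> (\<Sum>x\<in>S. W x) + s"
    proof -
      have "2 * att x \<le> W x + 1" for x
        using \<alpha>(2)[of x] by (simp add: att_def W_def Cs_def conj_assoc)
      then have "(\<Sum>x\<in>S. 2 * att x) \<le> (\<Sum>x\<in>S. W x + 1)" by (intro sum_mono)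
      then show ?thesis by (simp add: sum.distrib s_def sum_distrib_left sum_Suc)
    qed
    define J where "J = (\<Sum>x\<in>S. G.load \<tau> x)"
    \<comment> \<open>The additional one comes from the overloaded vertex \<open>x0\<close>.\<close>
    have J: "s * (4 * k + 4) + 1 \<le> J + (\<Sum>x\<in>S. y x) + (\<Sum>x\<in>S. att x)"
    proof -
      have ge: "4 * k + 4 \<le> G.load \<tau> x + y x + att x" if "x \<in> S" for x
        using dS(2)[OF that] \<beta>[of x] by linarith
      have "4 * k + 4 < G.load \<tau> x0 + y x0 + att x0"
        using x0(2) dS(1)[OF x0(1)] \<beta>[of x0] by (simp add: cap_def)
      then have "(\<Sum>x\<in>S. 4 * k + 4) < (\<Sum>x\<in>S. G.load \<tau> x + y x + att x)"
        using x0(1) ge by (intro sum_strict_mono_ex1[OF fS]) auto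
      then show ?thesis by (simp add: J_def sum.distrib s_def)
    qed
    have Jh: "J = (\<Sum>h\<in>L. card {x \<in> S. x \<in> \<tau> h})"
      unfolding J_def G.load_def by (rule sum_card_swap[OF fS fL])
    have AL: "{h \<in> L. h \<in> Ac} = Ac" using AcL by auto
    have zero: "card {x \<in> S. x \<in> \<tau> h} = 0" if "h \<in> L" "h \<notin> Ac" for h
    proof -
      have "{x \<in> S. x \<in> \<tau> h} = {}" using inact[OF that(1)] that(2) by (auto simp: Ac_def)
      then show ?thesis by (simp only: card.empty)
    qed
    have Js: "J \<le> s * card Ac"
    proof -
      have "card {x \<in> S. x \<in> \<tau> h} \<le> s * (if h \<in> Ac then 1 else 0)" if "h \<in> L" for h
      proof (cases "h \<in> Ac")
        case True
        have "card {x \<in> S. x \<in> \<tau> h} \<le> card S" by (rule card_mono[OF fS]) auto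
        then show ?thesis using True by (simp add: s_def)
      qed (use zero[OF that] in simp)
      then have "J \<le> (\<Sum>h\<in>L. s * (if h \<in> Ac then 1 else 0))" unfolding Jh by (rule sum_mono)
      also have "\<dots> = s * card {h \<in> L. h \<in> Ac}"
        by (simp only: sum_distrib_left[symmetric] sum_indicator_card[OF fL])
      finally show ?thesis by (simp add: AL)
    qed
    \<comment> \<open>An active link has at most two ends in \<open>S\<close> unless its value lies
      in \<open>S\<close> entirely, and sparsity of \<open>S\<close> bounds the number of the
      latter.\<close>
    have J3: "J + k \<le> 2 * card Ac + k * s"
    proof -
      have "card {x \<in> S. x \<in> \<tau> h} \<le> 2 * (if h \<in> Ac then 1 else 0) + (if h \<in> G.inn \<tau> S then 1 else 0)"
        if h: "h \<in> L" for h
      proof (cases "h \<in> Ac")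
        case True
        have f: "finite (\<tau> h)" using G.config_sub[OF cf h] G.finite_A[OF h] finite_subset by auto
        have c3: "card (\<tau> h) \<le> 3" using G.card_config_le[OF cf h] .
        show ?thesis
        proof (cases "\<tau> h \<subseteq> S")
          case sub: True
          have "card {x \<in> S. x \<in> \<tau> h} \<le> card (\<tau> h)" by (rule card_mono[OF f]) auto
          moreover have "h \<in> G.inn \<tau> S" using True sub h by (auto simp: G.inn_def Ac_def G.active_def)
          ultimately show ?thesis using True c3 by simp
        next
          case False
          then have "{x \<in> S. x \<in> \<tau> h} \<subset> \<tau> h" by auto
          then have "card {x \<in> S. x \<in> \<tau> h} < card (\<tau> h)" by (rule psubset_card_mono[OF f])
          then show ?thesis using True c3 by simp
        qed
      qed (use zero[OF h] in simp)
      then have "J \<le> (\<Sum>h\<in>L. 2 * (if h \<in> Ac then 1 else 0) + (if h \<in> G.inn \<tau> S then 1 else 0))"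
        unfolding Jh by (rule sum_mono)
      also have "\<dots> = 2 * card {h \<in> L. h \<in> Ac} + card {h \<in> L. h \<in> G.inn \<tau> S}"
        by (simp only: sum.distrib sum_distrib_left[symmetric] sum_indicator_card[OF fL])
      also have "{h \<in> L. h \<in> G.inn \<tau> S} = G.inn \<tau> S" by (auto simp: G.inn_def)
      finally have "J \<le> 2 * card Ac + card (G.inn \<tau> S)" by (simp add: AL)
      moreover have "card (G.inn \<tau> S) + k \<le> k * card S" using G.sparseD[OF sp SN] x0 by auto
      ultimately show ?thesis by (simp add: s_def)
    qed
    have fCF: "finite (C - F)" using finite_C by simp
    have Ym: "(\<Sum>x\<in>S. y x) + card Cs \<le> 4 * k + 4"
    proof -
      have "(\<Sum>x\<in>S. y x) = (\<Sum>h\<in>C - F. card {x \<in> S. B h = {x}})"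
        unfolding y_def by (rule sum_card_swap[OF fS fCF])
      also have "\<dots> \<le> (\<Sum>h\<in>C - F. if card (B h) \<noteq> 2 then 1 else 0)"
      proof (rule sum_mono)
        fix h assume "h \<in> C - F"
        show "card {x \<in> S. B h = {x}} \<le> (if card (B h) \<noteq> 2 then 1 else 0)"
        proof (cases "\<exists>x. B h = {x}")
          case True
          then obtain x where x: "B h = {x}" by auto
          then have "{z \<in> S. B h = {z}} \<subseteq> {x}" by auto
          then have "card {z \<in> S. B h = {z}} \<le> card {x}" by (rule card_mono[rotated]) simp
          then show ?thesis using x by simp
        next
          case False
          then have "{x \<in> S. B h = {x}} = {}" by auto
          then show ?thesis by (simp only: card.empty)
        qed
      qed
      also have "\<dots> = card {h \<in> C - F. card (B h) \<noteq> 2}" by (rule sum_indicator_card[OF fCF])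
      finally have "(\<Sum>x\<in>S. y x) + card Cs \<le> card {h \<in> C - F. card (B h) \<noteq> 2} + card Cs" by simp
      also have "\<dots> = card ({h \<in> C - F. card (B h) \<noteq> 2} \<union> Cs)"
        by (rule card_Un_disjoint[symmetric]) (use finite_C fCs in \<open>auto simp: Cs_def\<close>)
      also have "\<dots> \<le> card C" by (rule card_mono[OF finite_C]) (auto simp: Cs_def)
      finally show ?thesis using card_C by linarith
    qed
    have Am: "(\<Sum>x\<in>S. att x) \<le> card Cs"
    proof -
      have "(\<Sum>x\<in>S. att x) = (\<Sum>h\<in>Cs. card {x \<in> S. \<alpha> h = x})"
        unfolding att_def by (rule sum_card_swap[OF fS fCs])
      also have "\<dots> \<le> (\<Sum>h\<in>Cs. 1)"
      proof (rule sum_mono)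
        fix h
        have "{x \<in> S. \<alpha> h = x} \<subseteq> {\<alpha> h}" by auto
        then have "card {x \<in> S. \<alpha> h = x} \<le> card {\<alpha> h}" by (rule card_mono[rotated]) simp
        then show "card {x \<in> S. \<alpha> h = x} \<le> 1" by simp
      qed
      finally show ?thesis by simp
    qed
    have one: "2 * (\<Sum>x\<in>S. y x) + (\<Sum>x\<in>S. W x) \<le> 5 * k + 4" if rs: "r = 1" "s = 1"
    proof -
      have S: "S = {x0}" using rs(2) x0(1) by (auto simp: s_def card_1_singleton_iff)
      have "N \<noteq> {x0}"
      proof
        assume "N = {x0}"
        then have "N - S = {}" using S by simp
        then have "Cl = {}" unfolding Cl_def G.classes_def by (simp only: image_empty)
        then show False using rs by (simp add: r_def)
      qed
      then have "card {h \<in> C. B h = {x0}} + card {h \<in> C. x0 \<in> B h} \<le> 5 * k + 4"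
        using root_pair_cut[of x0] SN dS(1) x0(1) by auto
      moreover have "y x0 \<le> card {h \<in> C. B h = {x0}}"
        unfolding y_def by (rule card_mono) (use finite_C in auto)
      moreover have "y x0 + W x0 \<le> card {h \<in> C. x0 \<in> B h}"
      proof -
        have "{h \<in> C - F. B h = {x0}} \<inter> {h \<in> Cs. x0 \<in> B h} = {}" by (auto simp: Cs_def)
        then have "y x0 + W x0 = card ({h \<in> C - F. B h = {x0}} \<union> {h \<in> Cs. x0 \<in> B h})"
          unfolding y_def W_def using finite_C fCs by (simp add: card_Un_disjoint)
        also have "\<dots> \<le> card {h \<in> C. x0 \<in> B h}" by (rule card_mono) (use finite_C in \<open>auto simp: Cs_def\<close>)
        finally show ?thesis .
      qed
      ultimately show ?thesis by (simp add: S)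
    qed
    have False
      by (rule overload_arith[OF _ s1 K cuts UW Att J _ _ J3 Ym Am one]) (use k_pos Js in auto)
    then show ?thesis ..
  qed
qed

section \<open>Renaming the trees and attaching the remaining coloured links\<close>

text \<open>Serves to rename the trees so that the links of the filling receive their prescribed
  colours.\<close>

lemma permutation_extending:
  fixes f g :: "'b \<Rightarrow> nat"
  assumes "finite F" "inj_on f F" "inj_on g F" "f ` F \<subseteq> {..<n}" "g ` F \<subseteq> {..<n}"
  obtains \<pi> where "bij_betw \<pi> {..<n} {..<n}" "\<And>x. x \<in> F \<Longrightarrow> \<pi> (f x) = g x"
proof -
  have "card ({..<n} - f ` F) = card ({..<n} - g ` F)"
    using assms by (simp add: card_Diff_subset card_image)
  then obtain \<rho> where \<rho>: "bij_betw \<rho> ({..<n} - f ` F) ({..<n} - g ` F)"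
    using finite_same_card_bij[of "{..<n} - f ` F" "{..<n} - g ` F"] by auto
  define \<pi> where "\<pi> j = (if j \<in> f ` F then g (inv_into F f j) else \<rho> j)" for j
  have e: "\<pi> (f x) = g x" if "x \<in> F" for x
    using that assms(2) by (simp add: \<pi>_def)
  have 1: "bij_betw \<pi> (f ` F) (g ` F)"
  proof (rule bij_betwI')
    show "\<And>x y. x \<in> f ` F \<Longrightarrow> y \<in> f ` F \<Longrightarrow> (\<pi> x = \<pi> y) = (x = y)"
      using e assms(3) by (auto simp: inj_on_def)
  qed (use e in auto)
  have 2: "bij_betw \<pi> ({..<n} - f ` F) ({..<n} - g ` F)"
    by (rule iffD1[OF bij_betw_cong \<rho>]) (auto simp: \<pi>_def)
  have "bij_betw \<pi> (f ` F \<union> ({..<n} - f ` F)) (g ` F \<union> ({..<n} - g ` F))"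
    by (rule bij_betw_combine[OF 1 2]) auto
  moreover have "f ` F \<union> ({..<n} - f ` F) = {..<n}" "g ` F \<union> ({..<n} - g ` F) = {..<n}" using assms by auto
  ultimately show thesis using that e by simp
qed

text \<open>If the filling is nonempty, exactly \<open>k\<close> links cross \<open>X\<close>, and
  each of the \<open>k\<close> spanning trees uses one of them. So every link of the filling is
  used, each in a tree of its own, and a permutation of the trees produces the prescribed colours.
  The other coloured links are cut down to the single vertex \<open>\<alpha> h\<close>, which
  suffices since their tree spans \<open>N\<close> already.\<close>

theorem hypergraph_packing:
  obtains \<sigma> c' where
    "\<And>h. h \<in> H \<Longrightarrow> \<sigma> h \<subseteq> A h - {v}"
    "\<And>h. h \<in> C \<Longrightarrow> \<sigma> h \<noteq> {} \<and> c' h = c h"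
    "\<And>h. h \<in> H \<Longrightarrow> h \<notin> C \<Longrightarrow> \<sigma> h \<noteq> {} \<Longrightarrow> card (\<sigma> h) = 2 \<and> c' h < k"
    "\<And>i x y. i < k \<Longrightarrow> x \<in> T - {v} \<Longrightarrow> y \<in> T - {v} \<Longrightarrow> (x, y) \<in> linked \<sigma> {h \<in> H. \<sigma> h \<noteq> {} \<and> c' h = i}"
    "\<And>x. x \<in> T - {v} \<Longrightarrow> card {h \<in> H. x \<in> A h} = 5 * k + 4 \<Longrightarrow> card {h \<in> H. x \<in> \<sigma> h} \<le> 4 * k + 4"
proof -
  obtain F where F: "F \<subseteq> C" "\<And>h. h \<in> F \<Longrightarrow> card (B h) = 2"
    and count: "\<And>P. partition_on N P \<Longrightarrow> k * card P \<le> card {h \<in> Gen \<union> F. \<forall>D\<in>P. \<not> B h \<subseteq> D} + k"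
    and FX: "F \<noteq> {} \<Longrightarrow> \<exists>X\<subseteq>N. X \<noteq> {} \<and> X \<noteq> N \<and> card (crossing (Gen \<union> F) X) = k \<and> F \<subseteq> crossing C X \<and> inj_on c F"
    using filling_exists by blast
  have CH: "h \<in> H" "v \<in> A h" if "h \<in> C" for h using that C_sub by auto
  obtain \<alpha>0 where \<alpha>0: "\<And>h. h \<in> {h \<in> C - F. card (B h) = 2} \<Longrightarrow> \<alpha>0 h \<in> B h"
    "\<And>x. 2 * card {h \<in> {h \<in> C - F. card (B h) = 2}. \<alpha>0 h = x}
       \<le> card {h \<in> {h \<in> C - F. card (B h) = 2}. x \<in> B h} + 1"
  proof -
    have fq: "finite {h \<in> C - F. card (B h) = 2}" using finite_C by simp
    have cq: "\<And>h. h \<in> {h \<in> C - F. card (B h) = 2} \<Longrightarrow> card (B h) = 2" by simp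
    show thesis by (rule balanced_orientation[of _ B, OF fq cq]) (assumption, rule that)
  qed
  define \<alpha> where "\<alpha> h = (if card (B h) = 2 then \<alpha>0 h else (SOME x. x \<in> B h))" for h
  have \<alpha>1: "\<alpha> h \<in> B h" if "h \<in> C - F" for h
    using \<alpha>0(1)[of h] that B_nonempty[of h] CH[of h] by (auto simp: \<alpha>_def some_in_eq)
  have \<alpha>2: "2 * card {h \<in> C - F. card (B h) = 2 \<and> \<alpha> h = x} \<le> card {h \<in> C - F. card (B h) = 2 \<and> x \<in> B h} + 1" for x
  proof -
    have "{h \<in> C - F. card (B h) = 2 \<and> \<alpha> h = x} = {h \<in> {h \<in> C - F. card (B h) = 2}. \<alpha>0 h = x}"
      by (auto simp: \<alpha>_def)
    moreover have "{h \<in> C - F. card (B h) = 2 \<and> x \<in> B h} = {h \<in> {h \<in> C - F. card (B h) = 2}. x \<in> B h}"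
      by auto
    ultimately show ?thesis using \<alpha>0(2)[of x] by simp
  qed
  define L where "L = Gen \<union> F"
  obtain \<tau> where \<tau>: "link_system.base N L B k \<tau>"
    and ld: "\<And>x. x \<in> N \<Longrightarrow> card {h \<in> H. x \<in> A h} = 5 * k + 4 \<Longrightarrow>
      card {h \<in> L. x \<in> \<tau> h} + card {h \<in> C - F. \<alpha> h = x} \<le> 4 * k + 4"
    using bounded_base[OF F count \<alpha>1 \<alpha>2] unfolding L_def by blast
  have LH: "L \<subseteq> H" using F C_sub by (auto simp: L_def Gen_def)
  have fL: "finite L" using LH finite_H finite_subset by auto
  have L2: "2 \<le> card (B h) \<and> card (B h) \<le> 3" if "h \<in> L" for h
    using that F(2)[of h] LH card_B_bounds(2)[of h] by (auto simp: L_def Gen_def)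
  interpret G: link_system N L B k
  proof unfold_locales
    show "B h \<subseteq> N" if "h \<in> L" for h using B_N LH that by blast
    show "2 \<le> card (B h) \<and> card (B h) \<le> 3" if "h \<in> L" for h by (rule L2[OF that])
  qed (rule finite_N N_nonempty fL k_pos)+
  obtain \<rho> d where \<rho>: "\<And>h. h \<in> L \<Longrightarrow> \<rho> h \<subseteq> \<tau> h"
    and \<rho>2: "\<And>h. h \<in> L \<Longrightarrow> \<rho> h \<noteq> {} \<Longrightarrow> card (\<rho> h) = 2 \<and> d h < k"
    and con: "\<And>i x y. i < k \<Longrightarrow> x \<in> N \<Longrightarrow> y \<in> N \<Longrightarrow> (x, y) \<in> linked \<rho> {h \<in> L. \<rho> h \<noteq> {} \<and> d h = i}"
    by (rule G.base_tree_packing[OF \<tau>]) (rule that)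
  have \<tau>B: "\<tau> h \<subseteq> B h" if "h \<in> L" for h using \<tau> G.config_sub that by (auto simp: G.base_def)
  have "\<exists>\<pi>. bij_betw \<pi> {..<k} {..<k} \<and> (\<forall>h\<in>F. \<rho> h \<noteq> {} \<and> \<pi> (d h) = c h)"
  proof (cases "F = {}")
    case True
    then show ?thesis by (intro exI[of _ id]) auto
  next
    case False
    then obtain X where X: "X \<subseteq> N" "X \<noteq> {}" "X \<noteq> N" and cX: "card (crossing L X) = k"
      and FX': "F \<subseteq> crossing C X" and inj: "inj_on c F" using FX unfolding L_def by blast
    obtain x y where xy: "x \<in> X" "y \<in> N" "y \<notin> X" using X by auto
    let ?Z = "{h \<in> crossing L X. \<rho> h \<noteq> {}}"
    have fc: "finite (crossing L X)" using fL by (simp add: crossing_def)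
    have "{..<k} \<subseteq> d ` ?Z"
    proof
      fix i assume "i \<in> {..<k}"
      then have lk: "(x, y) \<in> linked \<rho> {h \<in> L. \<rho> h \<noteq> {} \<and> d h = i}" using con xy X by auto
      obtain h where h: "h \<in> {h \<in> L. \<rho> h \<noteq> {} \<and> d h = i}" "\<rho> h \<inter> X \<noteq> {}" "\<not> \<rho> h \<subseteq> X"
        by (rule linked_crossing[OF lk xy(1,3)])
      have "\<rho> h \<subseteq> B h" using \<rho>[of h] \<tau>B[of h] h(1) by auto
      then have "h \<in> crossing L X" using h by (auto simp: crossing_def)
      then show "i \<in> d ` ?Z" using h(1) by auto
    qed
    then have kZ: "k \<le> card (d ` ?Z)" using card_mono[of "d ` ?Z" "{..<k}"] fc by simp
    have "card (d ` ?Z) \<le> card ?Z" by (rule card_image_le) (use fc in simp)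
    moreover have "card ?Z \<le> card (crossing L X)" by (rule card_mono[OF fc]) auto
    ultimately have "card ?Z = card (crossing L X)" "card (d ` ?Z) = card ?Z" using kZ cX by linarith+
    then have Z: "?Z = crossing L X" "inj_on d ?Z"
      using card_subset_eq[OF fc, of ?Z] eq_card_imp_inj_on[of ?Z d] fc by auto
    have FZ: "F \<subseteq> ?Z" unfolding Z using FX' by (auto simp: crossing_def L_def)
    have "finite F" using F finite_C finite_subset by auto
    moreover have "inj_on d F" using Z(2) FZ inj_on_subset by blast
    moreover have "d ` F \<subseteq> {..<k}" using FZ \<rho>2 by (auto simp: crossing_def)
    moreover have "c ` F \<subseteq> {..<k}" using F c_less by auto
    ultimately obtain \<pi> where "bij_betw \<pi> {..<k} {..<k}" "\<And>h. h \<in> F \<Longrightarrow> \<pi> (d h) = c h"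
      using permutation_extending[of F d c k] inj by blast
    then show ?thesis using FZ by blast
  qed
  then obtain \<pi> where \<pi>: "bij_betw \<pi> {..<k} {..<k}" and \<pi>F: "\<And>h. h \<in> F \<Longrightarrow> \<rho> h \<noteq> {} \<and> \<pi> (d h) = c h" by blast
  define \<sigma> where "\<sigma> h = (if h \<in> L then \<rho> h else if h \<in> C then {\<alpha> h} else {})" for h
  define c' where "c' h = (if h \<in> C then c h else \<pi> (d h))" for h
  have LC: "h \<in> F" if "h \<in> L" "h \<in> C" for h using that by (auto simp: L_def Gen_def)
  show thesis
  proof (rule that[of \<sigma> c'])
    show "\<sigma> h \<subseteq> A h - {v}" if "h \<in> H" for h
      using \<rho>[of h] \<tau>B[of h] \<alpha>1[of h] F by (auto simp: \<sigma>_def B_def L_def)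
    show "\<sigma> h \<noteq> {} \<and> c' h = c h" if "h \<in> C" for h
      using that \<pi>F LC by (auto simp: \<sigma>_def c'_def)
    show "card (\<sigma> h) = 2 \<and> c' h < k" if h: "h \<in> H" "h \<notin> C" "\<sigma> h \<noteq> {}" for h
    proof -
      have "h \<in> L" "\<rho> h \<noteq> {}" using h by (auto simp: \<sigma>_def split: if_splits)
      then show ?thesis using \<rho>2[of h] h(2) bij_betwE[OF \<pi>] by (auto simp: \<sigma>_def c'_def)
    qed
    show "(x, y) \<in> linked \<sigma> {h \<in> H. \<sigma> h \<noteq> {} \<and> c' h = i}" if i: "i < k" and xy: "x \<in> T - {v}" "y \<in> T - {v}" for i x y
    proof -
      have "i \<in> \<pi> ` {..<k}" using \<pi> i by (simp add: bij_betw_def)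
      then obtain j where j: "j < k" "\<pi> j = i" by auto
      have "linked \<rho> {h \<in> L. \<rho> h \<noteq> {} \<and> d h = j} \<subseteq> linked \<sigma> {h \<in> H. \<sigma> h \<noteq> {} \<and> c' h = i}"
      proof (rule linked_subset)
        fix f p q assume f: "f \<in> {h \<in> L. \<rho> h \<noteq> {} \<and> d h = j}" "\<rho> f = {p, q}"
        then have "c' f = i" using j \<pi>F[of f] LC[of f] by (auto simp: c'_def)
        then show "(p, q) \<in> linked \<sigma> {h \<in> H. \<sigma> h \<noteq> {} \<and> c' h = i}"
          using f LH by (intro linked_edge[of f]) (auto simp: \<sigma>_def)
      qed (auto intro: linked_trans)
      then show ?thesis using con[OF j(1)] xy by (auto simp: N_def)
    qed
    show "card {h \<in> H. x \<in> \<sigma> h} \<le> 4 * k + 4" if x: "x \<in> T - {v}" "card {h \<in> H. x \<in> A h} = 5 * k + 4" for x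
    proof -
      have "{h \<in> H. x \<in> \<sigma> h} \<subseteq> {h \<in> L. x \<in> \<tau> h} \<union> {h \<in> C - F. \<alpha> h = x}"
        using \<rho> F by (auto simp: \<sigma>_def L_def split: if_splits)
      then have "card {h \<in> H. x \<in> \<sigma> h} \<le> card ({h \<in> L. x \<in> \<tau> h} \<union> {h \<in> C - F. \<alpha> h = x})"
        by (rule card_mono[rotated]) (use fL finite_C in auto)
      also have "\<dots> \<le> card {h \<in> L. x \<in> \<tau> h} + card {h \<in> C - F. \<alpha> h = x}" by (rule card_Un_le)
      finally show ?thesis using ld[of x] x by (simp add: N_def)
    qed
  qed
qed

end

section \<open>Extending a colouring of the edges at a terminal\<close>

text \<open>Graphs are given by an edge set \<open>E\<close> and a function \<open>B\<close> assigning to each edge its two ends.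
  Colours below \<open>k\<close> are the indices of the trees; the colour \<open>k\<close> means that the edge is not used.\<close>

definition cut_edges :: "'e set \<Rightarrow> ('e \<Rightarrow> 'v set) \<Rightarrow> 'v set \<Rightarrow> 'e set" where
  "cut_edges E B X = {e \<in> E. B e \<inter> X \<noteq> {} \<and> \<not> B e \<subseteq> X}"

text \<open>Connection is expressed by cuts instead of walks, with \<open>X\<close> ranging over all
  sets of the type. Under a contraction one then only has to pass to suitable sets \<open>X\<close>,
  and \<open>W\<close> may be connected through vertices outside it.\<close>

definition connects :: "'e set \<Rightarrow> ('e \<Rightarrow> 'v set) \<Rightarrow> 'v set \<Rightarrow> bool" where
  "connects R B W \<longleftrightarrow> (\<forall>X. X \<inter> W \<noteq> {} \<and> \<not> W \<subseteq> X \<longrightarrow> cut_edges R B X \<noteq> {})"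

definition splits :: "'v set \<Rightarrow> 'v set \<Rightarrow> bool" where
  "splits X T \<longleftrightarrow> X \<inter> T \<noteq> {} \<and> \<not> T \<subseteq> X"

lemma splits_compl: "splits (- X) T \<longleftrightarrow> splits X T"
  by (auto simp: splits_def)

lemma cut_edges_compl: "cut_edges E B (- X) = cut_edges E B X"
  by (auto simp: cut_edges_def)

lemma cut_edges_subset: "cut_edges E B X \<subseteq> E"
  by (auto simp: cut_edges_def)

text \<open>Contraction means mapping the ends by \<open>f\<close> and dropping the edges whose ends
  merge. No dropped edge crosses a preimage, so a cut of the contraction consists of the very same
  edges.\<close>

lemma cut_edges_vimage:
  assumes "\<And>e. e \<in> E \<Longrightarrow> card (B e) = 2"
  shows "cut_edges {e \<in> E. card (f ` B e) = 2} (\<lambda>e. f ` B e) X = cut_edges E B (f -` X)"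
proof -
  have "card (f ` B e) = 2" if e: "e \<in> E" "B e \<inter> f -` X \<noteq> {}" "\<not> B e \<subseteq> f -` X" for e
  proof -
    obtain x y where xy: "x \<in> B e" "f x \<in> X" "y \<in> B e" "f y \<notin> X" using e by auto
    have "x \<noteq> y" using xy by auto
    have "finite (B e)" using assms[OF e(1)] card.infinite by fastforce
    then have "B e = {x, y}"
      using card_subset_eq[of "B e" "{x, y}"] assms[OF e(1)] xy \<open>x \<noteq> y\<close> by auto
    moreover have "f x \<noteq> f y" using xy by metis
    ultimately show ?thesis by simp
  qed
  then show ?thesis unfolding cut_edges_def
    by (auto simp: image_subset_iff_subset_vimage)
qed

text \<open>The vertex set is left implicit, since only terminals and ends of edges matter.\<close>

locale coloured_graph =
  fixes E :: "'e set" and B :: "'e \<Rightarrow> 'v set" and T :: "'v set" and v :: 'v and c :: "'e \<Rightarrow> nat" and k :: nat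
  assumes finite_E: "finite E" and finite_T: "finite T" and card_B: "\<And>e. e \<in> E \<Longrightarrow> card (B e) = 2"
    and v_T: "v \<in> T" and T_v: "T \<noteq> {v}" and k_pos: "k > 0"
    and large_cut: "\<And>X. splits X T \<Longrightarrow> 5 * k + 4 \<le> card (cut_edges E B X)"
    and deg_v: "card (cut_edges E B {v}) = 5 * k + 4"
    and c_le: "\<And>e. e \<in> cut_edges E B {v} \<Longrightarrow> c e \<le> k"
    and c_surj: "\<And>i. i < k \<Longrightarrow> \<exists>e\<in>cut_edges E B {v}. c e = i"
    and c_few: "card {e \<in> cut_edges E B {v}. c e < k} \<le> 4 * k + 4"

definition attached :: "'e set \<Rightarrow> ('e \<Rightarrow> 'v set) \<Rightarrow> 'v set \<Rightarrow> 'v \<Rightarrow> ('e \<Rightarrow> nat) \<Rightarrow> nat \<Rightarrow> 'v set" where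
  "attached E B T v c i = (T - {v}) \<union> {x. \<exists>e\<in>E. c e = i \<and> B e = {v, x}}"

definition extension :: "'e set \<Rightarrow> ('e \<Rightarrow> 'v set) \<Rightarrow> 'v set \<Rightarrow> 'v \<Rightarrow> ('e \<Rightarrow> nat) \<Rightarrow> nat \<Rightarrow> ('e \<Rightarrow> nat) \<Rightarrow> bool" where
  "extension E B T v c k c' \<longleftrightarrow>
    (\<forall>e\<in>cut_edges E B {v}. c' e = c e) \<and> (\<forall>e\<in>E. c' e \<le> k) \<and>
    (\<forall>i<k. connects {e \<in> E. c' e = i \<and> v \<notin> B e} B (attached E B T v c' i)) \<and>
    (\<forall>t\<in>T - {v}. card (cut_edges E B {t}) = 5 * k + 4 \<longrightarrow> card {e \<in> cut_edges E B {t}. c' e < k} \<le> 4 * k + 4)"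

lemma extension_few:
  "extension E B T v c k d \<Longrightarrow> t \<in> T - {v} \<Longrightarrow> card (cut_edges E B {t}) = 5 * k + 4 \<Longrightarrow>
    card {e \<in> cut_edges E B {t}. d e < k} \<le> 4 * k + 4"
  unfolding extension_def by blast

lemma extension_connects:
  "extension E B T v c k d \<Longrightarrow> i < k \<Longrightarrow> connects {e \<in> E. d e = i \<and> v \<notin> B e} B (attached E B T v d i)"
  unfolding extension_def by blast

lemma extension_le: "extension E B T v c k d \<Longrightarrow> e \<in> E \<Longrightarrow> d e \<le> k"
  unfolding extension_def by blast

lemma extension_old: "extension E B T v c k d \<Longrightarrow> e \<in> cut_edges E B {v} \<Longrightarrow> d e = c e"
  unfolding extension_def by blast

lemma connectsE:
  assumes "connects R B W" "p \<in> W" "q \<in> W" "p \<in> X" "q \<notin> X"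
  obtains e where "e \<in> R" "B e \<inter> X \<noteq> {}" "\<not> B e \<subseteq> X"
proof -
  have "X \<inter> W \<noteq> {} \<and> \<not> W \<subseteq> X" using assms by auto
  then have "cut_edges R B X \<noteq> {}" using assms(1) unfolding connects_def by simp
  then show thesis using that by (auto simp: cut_edges_def)
qed

context coloured_graph
begin

lemma B_pair:
  assumes "e \<in> E"
  obtains x y where "B e = {x, y}" "x \<noteq> y"
  using card_B[OF assms] by (auto simp: card_2_iff)

lemma B_other:
  assumes "e \<in> E" "x \<in> B e"
  obtains y where "B e = {x, y}" "x \<noteq> y"
proof -
  obtain p q where "B e = {p, q}" "p \<noteq> q" using B_pair[OF assms(1)] .
  then show thesis using assms(2) that[of p] that[of q] by (auto simp: insert_commute)
qed

lemma cut_singleton: "cut_edges E B {x} = {e \<in> E. x \<in> B e}"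
proof -
  have "\<not> B e \<subseteq> {x}" if e: "e \<in> E" for e
  proof -
    obtain p q where "B e = {p, q}" "p \<noteq> q" using B_pair[OF e] .
    then show ?thesis by auto
  qed
  then show ?thesis by (auto simp: cut_edges_def)
qed

lemma finite_cut: "finite (cut_edges E B X)"
  by (rule finite_subset[OF cut_edges_subset finite_E])

lemma splits_singleton: "t \<in> T \<Longrightarrow> splits {t} T"
  using v_T T_v by (auto simp: splits_def)

section \<open>Contraction of the two sides of a tight cut\<close>

text \<open>The contracted side is represented by one of its terminals, so \<open>z\<close> is a
  terminal whose star is the boundary of \<open>Z\<close>. A set that splits the new terminals has a
  preimage that splits \<open>T\<close>.\<close>

lemma contract_inside:
  assumes Z: "v \<notin> Z" "z \<in> Z" "z \<in> T"
  defines "f \<equiv> \<lambda>x. if x \<in> Z then z else x"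
  shows "coloured_graph {e \<in> E. card (f ` B e) = 2} (\<lambda>e. f ` B e) (f ` T) v c k"
    and "\<And>X. cut_edges {e \<in> E. card (f ` B e) = 2} (\<lambda>e. f ` B e) X = cut_edges E B (f -` X)"
    and "f -` {z} = Z" and "x \<notin> Z \<Longrightarrow> f -` {x} = {x}"
proof -
  show ce: "cut_edges {e \<in> E. card (f ` B e) = 2} (\<lambda>e. f ` B e) X = cut_edges E B (f -` X)" for X
    by (rule cut_edges_vimage[OF card_B])
  show "f -` {z} = Z" using Z by (auto simp: f_def split: if_splits)
  show fx: "f -` {x} = {x}" if "x \<notin> Z" for x using Z that by (auto simp: f_def split: if_splits)
  have fv: "f -` {v} = {v}" using fx Z by simp
  have zT: "z \<in> f ` T" "z \<noteq> v" using Z by (auto simp: f_def)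
  have vT: "v \<in> f ` T" using Z v_T by (auto simp: f_def)
  show "coloured_graph {e \<in> E. card (f ` B e) = 2} (\<lambda>e. f ` B e) (f ` T) v c k"
  proof (unfold_locales, unfold ce fv)
    show "finite {e \<in> E. card (f ` B e) = 2}" using finite_E by simp
    show "finite (f ` T)" using finite_T by simp
    show "v \<in> f ` T" by (rule vT)
    show "f ` T \<noteq> {v}" using zT by blast
    show "5 * k + 4 \<le> card (cut_edges E B (f -` X))" if "splits X (f ` T)" for X
      by (rule large_cut) (use that in \<open>auto simp: splits_def\<close>)
  qed (use k_pos deg_v c_le c_surj c_few in simp_all)
qed

text \<open>With the complement of \<open>Z\<close> contracted to \<open>v\<close>, tightness gives
  \<open>v\<close> the degree \<open>5 * k + 4\<close>, and the conditions on \<open>d\<close> are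
  those required of a prescription.\<close>

lemma contract_outside:
  assumes Z: "v \<notin> Z" "z \<in> Z" "z \<in> T" and tight: "card (cut_edges E B Z) = 5 * k + 4"
    and d: "\<And>e. e \<in> cut_edges E B Z \<Longrightarrow> d e \<le> k" "\<And>i. i < k \<Longrightarrow> \<exists>e\<in>cut_edges E B Z. d e = i"
      "card {e \<in> cut_edges E B Z. d e < k} \<le> 4 * k + 4"
  defines "f \<equiv> \<lambda>x. if x \<in> Z then x else v"
  shows "coloured_graph {e \<in> E. card (f ` B e) = 2} (\<lambda>e. f ` B e) (f ` T) v d k"
    and "\<And>X. cut_edges {e \<in> E. card (f ` B e) = 2} (\<lambda>e. f ` B e) X = cut_edges E B (f -` X)"
    and "f -` {v} = - Z" and "x \<in> Z \<Longrightarrow> f -` {x} = {x}"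
proof -
  show ce: "cut_edges {e \<in> E. card (f ` B e) = 2} (\<lambda>e. f ` B e) X = cut_edges E B (f -` X)" for X
    by (rule cut_edges_vimage[OF card_B])
  show fv: "f -` {v} = - Z" using Z by (auto simp: f_def split: if_splits)
  show "f -` {x} = {x}" if "x \<in> Z" for x using Z that by (auto simp: f_def split: if_splits)
  have zT: "z \<in> f ` T" "z \<noteq> v" using Z by (force simp: f_def)+
  have vT: "v \<in> f ` T" using Z v_T by (force simp: f_def)
  show "coloured_graph {e \<in> E. card (f ` B e) = 2} (\<lambda>e. f ` B e) (f ` T) v d k"
  proof (unfold_locales, unfold ce fv cut_edges_compl)
    show "finite {e \<in> E. card (f ` B e) = 2}" using finite_E by simp
    show "finite (f ` T)" using finite_T by simp
    show "v \<in> f ` T" by (rule vT)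
    show "f ` T \<noteq> {v}" using zT by blast
    show "5 * k + 4 \<le> card (cut_edges E B (f -` X))" if "splits X (f ` T)" for X
      by (rule large_cut) (use that in \<open>auto simp: splits_def\<close>)
  qed (use k_pos tight d in simp_all)
qed

text \<open>First the side \<open>Z\<close> without \<open>v\<close> of the tight cut is contracted. The resulting colours of the
  edges of the cut are then prescribed at \<open>v\<close> in the graph in which the other side is contracted.\<close>

lemma extension_tight_cut:
  assumes IH: "\<And>E' B' T' c'. card E' < card E \<Longrightarrow> coloured_graph E' B' T' v c' k \<Longrightarrow>
      \<exists>d. extension (E' :: 'e set) B' (T' :: 'v set) v c' k d"
    and Z: "v \<notin> Z" "splits Z T" "card (cut_edges E B Z) = 5 * k + 4"
    and e1: "e1 \<in> E" "B e1 \<subseteq> Z" and e2: "e2 \<in> E" "B e2 \<inter> Z = {}"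
  shows "\<exists>d. extension E B T v c k d"
proof -
  obtain z where z: "z \<in> Z" "z \<in> T" using Z by (auto simp: splits_def)
  have zv: "z \<noteq> v" using z Z by auto
  define f where "f x = (if x \<in> Z then z else x)" for x
  define g where "g x = (if x \<in> Z then x else v)" for x
  define E1 where "E1 = {e \<in> E. card (f ` B e) = 2}"
  define E2 where "E2 = {e \<in> E. card (g ` B e) = 2}"
  define B1 where "B1 = (\<lambda>e. f ` B e)"
  define B2 where "B2 = (\<lambda>e. g ` B e)"
  note c1 = contract_inside[OF Z(1) z, folded f_def, folded E1_def B1_def]
  have E1: "e \<in> E1 \<longleftrightarrow> e \<in> E \<and> \<not> B e \<subseteq> Z" for e
  proof (cases "e \<in> E")
    case True
    then obtain x y where "B e = {x, y}" "x \<noteq> y" by (rule B_pair)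
    then show ?thesis using z True unfolding E1_def
      by (cases "x \<in> Z"; cases "y \<in> Z") (auto simp: f_def card_insert_if)
  qed (simp add: E1_def)
  have E2: "e \<in> E2 \<longleftrightarrow> e \<in> E \<and> B e \<inter> Z \<noteq> {}" for e
  proof (cases "e \<in> E")
    case True
    then obtain x y where "B e = {x, y}" "x \<noteq> y" by (rule B_pair)
    then show ?thesis using Z(1) True unfolding E2_def
      by (cases "x \<in> Z"; cases "y \<in> Z") (auto simp: g_def card_insert_if)
  qed (simp add: E2_def)
  \<comment> \<open>\<open>e1\<close> vanishes when \<open>Z\<close> is contracted, and
    \<open>e2\<close> when the complement is; so the induction hypothesis covers both
    graphs.\<close>
  have "E1 \<subset> E" using E1 e1 by blast
  then have "card E1 < card E" by (rule psubset_card_mono[OF finite_E])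
  then obtain d1 where d1: "extension E1 B1 (f ` T) v c k d1" using IH c1(1) by blast
  have cZ1: "cut_edges E1 B1 {z} = cut_edges E B Z" using c1(2)[of "{z}"] c1(3) by simp
  have zT1: "z \<in> f ` T - {v}" using z zv by (auto simp: f_def)
  have fv: "f x = v \<longleftrightarrow> x = v" for x using Z(1) zv z by (auto simp: f_def)
  have few: "card {e \<in> cut_edges E B Z. d1 e < k} \<le> 4 * k + 4"
    using extension_few[OF d1 zT1] Z(3) by (simp only: cZ1)
  have E1E: "E1 \<subseteq> E" "E2 \<subseteq> E" by (auto simp: E1_def E2_def)
  have cutE1: "cut_edges E B Z \<subseteq> E1" using E1 by (auto simp: cut_edges_def)
  have d1k: "d1 e \<le> k" if "e \<in> E1" for e using extension_le[OF d1 that] .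
  have cv1: "cut_edges E1 B1 {v} = cut_edges E B {v}" using c1(2)[of "{v}"] c1(4) Z(1) by simp
  have d1c: "d1 e = c e" if "e \<in> cut_edges E B {v}" for e
    using extension_old[OF d1] that by (simp only: cv1)
  have con1: "connects {e \<in> E1. d1 e = i \<and> v \<notin> B1 e} B1 (attached E1 B1 (f ` T) v d1 i)" if "i < k" for i
    by (rule extension_connects[OF d1 that])
  \<comment> \<open>An edge at \<open>v\<close> of colour \<open>i\<close> either crosses the cut or
    has its other end outside \<open>Z\<close>. In the second case the class connects this end to
    \<open>z\<close>, so an edge at \<open>z\<close> has the colour.\<close>
  have surj: "\<exists>e\<in>cut_edges E B Z. d1 e = i" if i: "i < k" for i
  proof -
    obtain e where e: "e \<in> cut_edges E B {v}" "c e = i" using c_surj[OF i] by auto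
    then have eE: "e \<in> E" "v \<in> B e" by (auto simp: cut_singleton)
    obtain x where x: "B e = {v, x}" "v \<noteq> x" using B_other[OF eE] .
    show ?thesis
    proof (cases "x \<in> Z")
      case True
      then show ?thesis using x Z(1) eE e d1c by (intro bexI[of _ e]) (auto simp: cut_edges_def)
    next
      case False
      have "e \<in> E1" using E1 eE Z(1) by auto
      moreover have "B1 e = {v, x}" using x False Z(1) by (auto simp: B1_def f_def)
      ultimately have xa: "x \<in> attached E1 B1 (f ` T) v d1 i"
        using d1c[OF e(1)] e(2) by (auto simp: attached_def)
      have za: "z \<in> attached E1 B1 (f ` T) v d1 i" using zT1 by (auto simp: attached_def)
      obtain e' where "e' \<in> {e \<in> E1. d1 e = i \<and> v \<notin> B1 e}" "B1 e' \<inter> {z} \<noteq> {}" "\<not> B1 e' \<subseteq> {z}"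
        by (rule connectsE[OF con1[OF i] za xa, of "{z}"]) (use False z(1) in auto)
      then have "e' \<in> cut_edges E1 B1 {z}" "d1 e' = i" by (auto simp: cut_edges_def)
      then show ?thesis unfolding cZ1 by blast
    qed
  qed
  have dle: "d1 e \<le> k" if "e \<in> cut_edges E B Z" for e using d1k cutE1 that by blast
  note c2 = contract_outside[OF Z(1) z Z(3) dle surj few, folded g_def, folded E2_def B2_def]
  have "E2 \<subset> E" using E2 e2 by blast
  then have "card E2 < card E" by (rule psubset_card_mono[OF finite_E])
  then obtain d2 where d2: "extension E2 B2 (g ` T) v d1 k d2" using IH c2(1) by blast
  have cZ2: "cut_edges E2 B2 {v} = cut_edges E B Z" using c2(2)[of "{v}"] c2(3) by (simp add: cut_edges_compl)
  have d21: "d2 e = d1 e" if "e \<in> E1" "e \<in> E2" for e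
  proof -
    have "e \<in> cut_edges E B Z" using that E1 E2 by (auto simp: cut_edges_def)
    then show ?thesis using extension_old[OF d2] by (simp only: cZ2)
  qed
  define d where "d e = (if e \<in> E1 then d1 e else d2 e)" for e
  have dE1: "d e = d1 e" if "e \<in> E1" for e using that by (simp add: d_def)
  have dE2: "d e = d2 e" if "e \<in> E2" for e using that d21 by (simp add: d_def)
  have E12: "e \<in> E1 \<or> e \<in> E2" if "e \<in> E" for e
  proof -
    have "B e \<noteq> {}" using card_B[OF that] by auto
    then show ?thesis using E1 E2 that by auto
  qed
  have con2: "connects {e \<in> E2. d2 e = i \<and> v \<notin> B2 e} B2 (attached E2 B2 (g ` T) v d2 i)" if "i < k" for i
    by (rule extension_connects[OF d2 that])
  have con: "connects {e \<in> E. d e = i \<and> v \<notin> B e} B (attached E B T v d i)" if i: "i < k" for i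
    unfolding connects_def
  proof (intro allI impI)
    let ?W = "attached E B T v d i" and ?W1 = "attached E1 B1 (f ` T) v d1 i"
      and ?W2 = "attached E2 B2 (g ` T) v d2 i" and ?R = "{e \<in> E. d e = i \<and> v \<notin> B e}"
    fix X assume X: "X \<inter> ?W \<noteq> {} \<and> \<not> ?W \<subseteq> X"
    show "cut_edges ?R B X \<noteq> {}"
    \<comment> \<open>Either \<open>X\<close> separates vertices that the class has to connect
      inside \<open>Z\<close>, and the second graph supplies an edge, or all of them lie on the side
      of \<open>z\<close>. Then \<open>X\<close> can be replaced by a set that treats
      \<open>Z\<close> like \<open>z\<close>, and the first graph supplies an edge.\<close>
    proof (cases "X \<inter> ?W2 \<noteq> {} \<and> \<not> ?W2 \<subseteq> X")
      case True
      then obtain p q where pq: "p \<in> ?W2" "q \<in> ?W2" "p \<in> X" "q \<notin> X" by blast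
      obtain e where "e \<in> {e \<in> E2. d2 e = i \<and> v \<notin> B2 e}" and ex: "B2 e \<inter> X \<noteq> {}" "\<not> B2 e \<subseteq> X"
        by (rule connectsE[OF con2[OF i] pq])
      then have e: "e \<in> E2" "d2 e = i" "v \<notin> B2 e" "B2 e \<inter> X \<noteq> {}" "\<not> B2 e \<subseteq> X" by auto
      have BZ: "B e \<subseteq> Z" using e(3) by (auto simp: B2_def g_def split: if_splits)
      then have "B2 e = B e" by (auto simp: B2_def g_def subset_iff)
      then have "e \<in> cut_edges ?R B X" using e E1E dE2 by (auto simp: cut_edges_def)
      then show ?thesis by blast
    next
      case False
      have zW2: "z \<in> ?W2" using z zv by (auto simp: attached_def g_def)
      have same: "w \<in> X \<longleftrightarrow> z \<in> X" if "w \<in> ?W2" for w using False zW2 that by blast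
      define X1 where "X1 = (X - Z) \<union> (X \<inter> {z})"
      have key: "w \<in> X \<longleftrightarrow> f w \<in> X1" if "w \<in> ?W2 \<or> w \<notin> Z" for w
      proof (cases "w \<in> Z")
        case True
        then have "w \<in> ?W2" using that by simp
        then have "w \<in> X \<longleftrightarrow> z \<in> X" by (rule same)
        then show ?thesis using True z by (auto simp: X1_def f_def)
      next
        case False
        then show ?thesis using z by (auto simp: X1_def f_def)
      qed
      have W12: "(w \<in> ?W2 \<or> w \<notin> Z) \<and> f w \<in> ?W1" if "w \<in> ?W" for w
      proof -
        consider "w \<in> T - {v}" | e where "e \<in> E" "d e = i" "B e = {v, w}" using \<open>w \<in> ?W\<close> by (auto simp: attached_def)
        then show ?thesis
        proof cases
          case 1
          have "g w \<in> g ` T" "f w \<in> f ` T" "f w \<noteq> v" using 1 fv by auto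
          then show ?thesis using 1 by (auto simp: attached_def g_def split: if_splits)
        next
          case 2
          have eE1: "e \<in> E1" using 2 E1 Z(1) by auto
          moreover have "B1 e = {v, f w}" using 2 Z(1) by (auto simp: B1_def f_def)
          ultimately have 3: "f w \<in> ?W1" using 2 dE1 by (auto simp: attached_def)
          have "w \<in> ?W2" if "w \<in> Z"
          proof -
            have "e \<in> E2" using 2 E2 that by auto
            moreover have "B2 e = {v, w}" using 2 Z(1) that by (auto simp: B2_def g_def)
            ultimately show ?thesis using 2 dE2 by (auto simp: attached_def)
          qed
          then show ?thesis using 3 by blast
        qed
      qed
      obtain p q where pq: "p \<in> X" "p \<in> ?W" "q \<notin> X" "q \<in> ?W" using X by blast
      have fpq: "f p \<in> ?W1" "f q \<in> ?W1" "f p \<in> X1" "f q \<notin> X1"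
        using key[of p] key[of q] W12[of p] W12[of q] pq by auto
      obtain e where "e \<in> {e \<in> E1. d1 e = i \<and> v \<notin> B1 e}" and ex: "B1 e \<inter> X1 \<noteq> {}" "\<not> B1 e \<subseteq> X1"
        by (rule connectsE[OF con1[OF i] fpq])
      then have e: "e \<in> E1" "d1 e = i" "v \<notin> B1 e" "B1 e \<inter> X1 \<noteq> {}" "\<not> B1 e \<subseteq> X1" by auto
      have eE: "e \<in> E" using e(1) E1 by simp
      have ends: "w \<in> ?W2 \<or> w \<notin> Z" if w: "w \<in> B e" for w
      proof (cases "w \<in> Z")
        case True
        obtain y where y: "B e = {w, y}" "w \<noteq> y" using B_other[OF eE w] .
        have "y \<notin> Z" using e(1) E1 y True by auto
        then have "B2 e = {v, w}" using y True by (auto simp: B2_def g_def)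
        moreover have "e \<in> E2" using E2 eE y True by auto
        ultimately have "w \<in> ?W2" using d21[OF e(1)] e(2) by (auto simp: attached_def)
        then show ?thesis ..
      qed simp
      have "\<exists>p\<in>B e. p \<in> X" "\<exists>q\<in>B e. q \<notin> X"
        using e(4,5) key ends by (auto simp: B1_def)
      then have "B e \<inter> X \<noteq> {}" "\<not> B e \<subseteq> X" by auto
      moreover have "v \<notin> B e" using e(3) fv by (force simp: B1_def)
      ultimately have "e \<in> cut_edges ?R B X" using eE dE1[OF e(1)] e(2) by (auto simp: cut_edges_def)
      then show ?thesis by blast
    qed
  qed
  have deg: "card {e \<in> cut_edges E B {t}. d e < k} \<le> 4 * k + 4"
    if t: "t \<in> T - {v}" "card (cut_edges E B {t}) = 5 * k + 4" for t
  proof (cases "t \<in> Z")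
    case True
    have ct: "cut_edges E2 B2 {t} = cut_edges E B {t}" using c2(2)[of "{t}"] c2(4)[OF _ _ True] by simp
    have tg: "t \<in> g ` T - {v}" using t True by (force simp: g_def)
    have "card {e \<in> cut_edges E B {t}. d2 e < k} \<le> 4 * k + 4"
      using extension_few[OF d2 tg] t(2) by (simp only: ct)
    moreover have "{e \<in> cut_edges E B {t}. d e < k} = {e \<in> cut_edges E B {t}. d2 e < k}"
      using dE2 cut_edges_subset[of E2 B2 "{t}"] unfolding ct by auto
    ultimately show ?thesis by simp
  next
    case False
    have ct: "cut_edges E1 B1 {t} = cut_edges E B {t}" using c1(2)[of "{t}"] c1(4)[OF False] by simp
    have tf: "t \<in> f ` T - {v}" using t False by (force simp: f_def)
    have "card {e \<in> cut_edges E B {t}. d1 e < k} \<le> 4 * k + 4"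
      using extension_few[OF d1 tf] t(2) by (simp only: ct)
    moreover have "{e \<in> cut_edges E B {t}. d e < k} = {e \<in> cut_edges E B {t}. d1 e < k}"
      using dE1 cut_edges_subset[of E1 B1 "{t}"] unfolding ct by auto
    ultimately show ?thesis by simp
  qed
  have "d e \<le> k" if "e \<in> E" for e
  proof (cases "e \<in> E1")
    case False
    then have "e \<in> E2" using E12 that by blast
    then show ?thesis using extension_le[OF d2] dE2 by simp
  qed (use d1k dE1 in auto)
  moreover have "d e = c e" if "e \<in> cut_edges E B {v}" for e
    using d1c[OF that] dE1 cut_edges_subset[of E1 B1 "{v}"] that unfolding cv1 by auto
  ultimately have "extension E B T v c k d" unfolding extension_def using con deg by blast
  then show ?thesis by blast
qed

section \<open>Deletion and splitting of edges\<close>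

text \<open>The star of \<open>v\<close> is tight, so \<open>e0\<close> is not at \<open>v\<close>
  and the prescription is unaffected; every cut that loses \<open>e0\<close> had an edge to
  spare.\<close>

lemma extension_delete:
  assumes IH: "\<And>E' B' T' c'. card E' < card E \<Longrightarrow> coloured_graph E' B' T' v c' k \<Longrightarrow>
      \<exists>d. extension (E' :: 'e set) B' (T' :: 'v set) v c' k d"
    and e0: "e0 \<in> E" "\<And>X. splits X T \<Longrightarrow> card (cut_edges E B X) = 5 * k + 4 \<Longrightarrow> e0 \<notin> cut_edges E B X"
  shows "\<exists>d. extension E B T v c k d"
proof -
  let ?E = "E - {e0}"
  have ce: "cut_edges ?E B X = cut_edges E B X - {e0}" for X by (auto simp: cut_edges_def)
  have tight: "cut_edges ?E B X = cut_edges E B X" if "splits X T" "card (cut_edges E B X) = 5 * k + 4" for X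
    using e0(2)[OF that] ce by simp
  have cv: "cut_edges ?E B {v} = cut_edges E B {v}" by (rule tight[OF splits_singleton[OF v_T] deg_v])
  have lc: "5 * k + 4 \<le> card (cut_edges ?E B X)" if X: "splits X T" for X
  proof (cases "card (cut_edges E B X) = 5 * k + 4")
    case True
    then show ?thesis using tight[OF X] by simp
  next
    case False
    then have "5 * k + 4 < card (cut_edges E B X)" using large_cut[OF X] by simp
    moreover have "card (cut_edges E B X) - card {e0} \<le> card (cut_edges E B X - {e0})"
      by (rule diff_card_le_card_Diff) simp
    moreover have "card {e0} = 1" by simp
    ultimately show ?thesis unfolding ce by linarith
  qed
  have "coloured_graph ?E B T v c k"
    by (unfold_locales, unfold cv)
      (use finite_E finite_T card_B v_T T_v k_pos lc deg_v c_le c_surj c_few in simp_all)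
  moreover have "card ?E < card E" by (rule card_Diff1_less[OF finite_E e0(1)])
  ultimately obtain d1 where d1: "extension ?E B T v c k d1" using IH by blast
  define d where "d = d1(e0 := k)"
  have de: "d e = d1 e" if "e \<in> ?E" for e using that by (simp add: d_def)
  have att: "attached E B T v d i = attached ?E B T v d1 i" if "i < k" for i
  proof -
    have "e0 \<notin> cut_edges E B {v}" using cv ce by blast
    then have "v \<notin> B e0" using e0(1) by (simp add: cut_singleton)
    then show ?thesis unfolding attached_def d_def by auto
  qed
  have R: "{e \<in> E. d e = i \<and> v \<notin> B e} = {e \<in> ?E. d1 e = i \<and> v \<notin> B e}" if "i < k" for i
    using that e0(1) by (auto simp: d_def)
  have "extension E B T v c k d"
    unfolding extension_def
  proof (intro conjI ballI allI impI)
    show "d e = c e" if "e \<in> cut_edges E B {v}" for e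
    proof -
      have e: "e \<in> cut_edges ?E B {v}" using that cv by simp
      then have "d1 e = c e" using d1 by (simp add: extension_def)
      then show ?thesis using de[of e] e cut_edges_subset by fastforce
    qed
    show "d e \<le> k" if "e \<in> E" for e using d1 that by (auto simp: d_def extension_def)
    show "connects {e \<in> E. d e = i \<and> v \<notin> B e} B (attached E B T v d i)" if "i < k" for i
      using d1 that unfolding R[OF that] att[OF that] extension_def by blast
    show "card {e \<in> cut_edges E B {t}. d e < k} \<le> 4 * k + 4"
      if t: "t \<in> T - {v}" "card (cut_edges E B {t}) = 5 * k + 4" for t
    proof -
      have ct: "cut_edges ?E B {t} = cut_edges E B {t}" using tight[OF splits_singleton] t by simp
      have "{e \<in> cut_edges E B {t}. d e < k} = {e \<in> cut_edges ?E B {t}. d1 e < k}"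
      proof -
        have "d e = d1 e" if "e \<in> cut_edges ?E B {t}" for e
          using de[OF subsetD[OF cut_edges_subset that]] .
        then show ?thesis unfolding ct by auto
      qed
      moreover have "card {e \<in> cut_edges ?E B {t}. d1 e < k} \<le> 4 * k + 4"
        using extension_few[OF d1 t(1)] t(2) by (simp only: ct)
      ultimately show ?thesis by simp
    qed
  qed
  then show ?thesis by blast
qed

text \<open>The edge \<open>ab\<close> takes over the name \<open>e1\<close>, and its colour is
  later given to both edges of the path through \<open>s\<close>. A cut with \<open>a\<close> and
  \<open>b\<close> on one side and \<open>s\<close> on the other may lose two edges, whence
  \<open>5 * k + 6\<close>. As \<open>b\<close> differs from \<open>v\<close>, only
  \<open>e1\<close> can be at \<open>v\<close>, so the prescription keeps its edges.\<close>

lemma extension_split: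
  assumes IH: "\<And>E' B' T' c'. card E' < card E \<Longrightarrow> coloured_graph E' B' T' v c' k \<Longrightarrow>
      \<exists>d. extension (E' :: 'e set) B' (T' :: 'v set) v c' k d"
    and e: "e1 \<in> E" "e2 \<in> E" "e1 \<noteq> e2" "B e1 = {s, a}" "B e2 = {s, b}" "a \<noteq> b"
    and s: "s \<notin> T" "a \<in> T" "b \<in> T" "b \<noteq> v"
    and big: "\<And>X. s \<notin> X \<Longrightarrow> a \<in> X \<Longrightarrow> b \<in> X \<Longrightarrow> \<not> T \<subseteq> X \<Longrightarrow> 5 * k + 6 \<le> card (cut_edges E B X)"
  shows "\<exists>d. extension E B T v c k d"
proof -
  let ?E = "E - {e2}"
  define B' where "B' = B(e1 := {a, b})"
  have sv: "s \<noteq> v" "s \<noteq> a" "s \<noteq> b" using s v_T by auto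
  have B': "B' x = B x" if "x \<noteq> e1" for x using that by (simp add: B'_def)
  have B'1: "B' e1 = {a, b}" by (simp add: B'_def)
  have fin: "finite (cut_edges ?E B' X)" for X
    by (rule finite_subset[OF cut_edges_subset]) (use finite_E in simp)
  have lc0: "5 * k + 4 \<le> card (cut_edges ?E B' X)" if X: "splits X T" "s \<notin> X" for X
  proof -
    consider "a \<in> X \<and> b \<in> X" | "a \<notin> X \<and> b \<in> X" | "b \<notin> X" by blast
    then show ?thesis
    proof cases
      case 1
      have "5 * k + 6 \<le> card (cut_edges E B X)" by (rule big) (use X 1 in \<open>auto simp: splits_def\<close>)
      moreover have "cut_edges E B X - {e1, e2} \<subseteq> cut_edges ?E B' X"
        using B' by (force simp: cut_edges_def)
      then have "card (cut_edges E B X - {e1, e2}) \<le> card (cut_edges ?E B' X)" by (rule card_mono[OF fin])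
      moreover have "card (cut_edges E B X) - card {e1, e2} \<le> card (cut_edges E B X - {e1, e2})"
        by (rule diff_card_le_card_Diff) simp
      moreover have "card {e1, e2} = 2" using e(3) by simp
      ultimately show ?thesis by linarith
    next
      case 2
      have "insert e1 (cut_edges E B X - {e2}) \<subseteq> cut_edges ?E B' X"
      proof
        fix x assume x: "x \<in> insert e1 (cut_edges E B X - {e2})"
        show "x \<in> cut_edges ?E B' X"
          using x e 2 B' B'1 by (cases "x = e1") (auto simp: cut_edges_def)
      qed
      then have "card (insert e1 (cut_edges E B X - {e2})) \<le> card (cut_edges ?E B' X)" by (rule card_mono[OF fin])
      moreover have "e1 \<notin> cut_edges E B X" using e X 2 by (auto simp: cut_edges_def)
      moreover have "e2 \<in> cut_edges E B X" using e X 2 by (auto simp: cut_edges_def)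
      ultimately have "card (cut_edges E B X) \<le> card (cut_edges ?E B' X)"
        using finite_cut card_Suc_Diff1[OF finite_cut, of e2 X] by simp
      then show ?thesis using large_cut[OF X(1)] by linarith
    next
      case 3
      have "cut_edges E B X \<subseteq> cut_edges ?E B' X"
      proof
        fix x assume x: "x \<in> cut_edges E B X"
        have "x \<noteq> e2" using x e X 3 by (auto simp: cut_edges_def)
        then show "x \<in> cut_edges ?E B' X"
          using x e X 3 B' B'1 by (cases "x = e1") (auto simp: cut_edges_def)
      qed
      then have "card (cut_edges E B X) \<le> card (cut_edges ?E B' X)" by (rule card_mono[OF fin])
      then show ?thesis using large_cut[OF X(1)] by linarith
    qed
  qed
  have lc: "5 * k + 4 \<le> card (cut_edges ?E B' X)" if X: "splits X T" for X
  proof (cases "s \<in> X")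
    case True
    then show ?thesis using lc0[of "- X"] X by (simp add: splits_compl cut_edges_compl)
  qed (use lc0[OF X] in simp)
  have cB': "card (B' x) = 2" if "x \<in> ?E" for x
    using that card_B e(6) by (cases "x = e1") (auto simp: B'_def)
  have cs': "cut_edges ?E B' {t} = {x \<in> ?E. t \<in> B' x}" for t
  proof -
    have "\<not> B' x \<subseteq> {t}" if "x \<in> ?E" for x
    proof
      assume "B' x \<subseteq> {t}"
      then have "card (B' x) \<le> card {t}" by (rule card_mono[rotated]) simp
      then show False using cB'[OF that] by simp
    qed
    then show ?thesis by (auto simp: cut_edges_def)
  qed
  have cv: "cut_edges ?E B' {v} = cut_edges E B {v}"
    unfolding cs' cut_singleton
  proof (intro set_eqI)
    fix x show "x \<in> {x \<in> ?E. v \<in> B' x} \<longleftrightarrow> x \<in> {x \<in> E. v \<in> B x}"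
      using e s sv B' B'1 by (cases "x = e1"; cases "x = e2") auto
  qed
  have "coloured_graph ?E B' T v c k"
    by (unfold_locales, unfold cv)
      (use finite_E finite_T cB' v_T T_v k_pos lc deg_v c_le c_surj c_few in simp_all)
  moreover have "card ?E < card E" by (rule card_Diff1_less[OF finite_E e(2)])
  ultimately obtain d1 where d1: "extension ?E B' T v c k d1" using IH by blast
  define d where "d = d1(e2 := d1 e1)"
  have d2: "d e2 = d1 e1" "\<And>x. x \<noteq> e2 \<Longrightarrow> d x = d1 x" by (auto simp: d_def)
  have e1E: "e1 \<in> ?E" using e by simp
  have con: "connects {x \<in> E. d x = i \<and> v \<notin> B x} B (attached E B T v d i)" if i: "i < k" for i
    unfolding connects_def
  proof (intro allI impI)
    let ?W = "attached E B T v d i" and ?W' = "attached ?E B' T v d1 i" and ?R = "{x \<in> E. d x = i \<and> v \<notin> B x}"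
    fix X assume X: "X \<inter> ?W \<noteq> {} \<and> \<not> ?W \<subseteq> X"
    have e2R: "e2 \<in> ?R" if "d1 e1 = i" using that e s sv d2 by auto
    show "cut_edges ?R B X \<noteq> {}"
    \<comment> \<open>If the split pair has colour \<open>i\<close> and \<open>X\<close> separates
      \<open>s\<close> from \<open>b\<close>, then \<open>e2\<close> crosses. Otherwise
      \<open>s\<close> can be replaced by the terminal \<open>b\<close> where it matters, and
      \<open>e1\<close> crosses whenever an edge \<open>ab\<close> of this colour does.\<close>
    proof (cases "d1 e1 = i \<and> (s \<in> X \<longleftrightarrow> b \<notin> X)")
      case True
      then have "e2 \<in> cut_edges ?R B X" using e2R e by (auto simp: cut_edges_def)
      then show ?thesis by blast
    next
      case False
      have bW: "b \<in> ?W'" using s by (auto simp: attached_def)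
      have W: "w \<in> ?W' \<or> w = s \<and> d1 e1 = i" if "w \<in> ?W" for w
      proof -
        consider "w \<in> T - {v}" | x where "x \<in> E" "d x = i" "B x = {v, w}"
          using \<open>w \<in> ?W\<close> by (auto simp: attached_def)
        then show ?thesis
        proof cases
          case 1
          then show ?thesis by (auto simp: attached_def)
        next
          case 2
          have "x \<noteq> e2" using 2(3) e(5) s(4) sv by (auto simp: doubleton_eq_iff)
          show ?thesis
          proof (cases "x = e1")
            case True
            then show ?thesis using 2 e(4) sv d2(2)[OF \<open>x \<noteq> e2\<close>] by (auto simp: doubleton_eq_iff)
          next
            case False
            then show ?thesis using 2 \<open>x \<noteq> e2\<close> B'[OF False] d2(2)[of x] by (auto simp: attached_def)
          qed
        qed
      qed
      obtain p q where pq: "p \<in> X" "p \<in> ?W" "q \<notin> X" "q \<in> ?W" using X by blast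
      have "\<exists>p\<in>?W'. p \<in> X" using W[OF pq(2)] pq(1) False bW by blast
      then obtain p' where p': "p' \<in> ?W'" "p' \<in> X" by blast
      have "\<exists>q\<in>?W'. q \<notin> X" using W[OF pq(4)] pq(3) False bW by blast
      then obtain q' where q': "q' \<in> ?W'" "q' \<notin> X" by blast
      obtain x where "x \<in> {x \<in> ?E. d1 x = i \<and> v \<notin> B' x}" and ex: "B' x \<inter> X \<noteq> {}" "\<not> B' x \<subseteq> X"
        by (rule connectsE[OF extension_connects[OF d1 i] p'(1) q'(1) p'(2) q'(2)])
      then have x: "x \<in> ?E" "d1 x = i" "v \<notin> B' x" "B' x \<inter> X \<noteq> {}" "\<not> B' x \<subseteq> X" by auto
      have "x \<in> cut_edges ?R B X"
      proof (cases "x = e1")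
        case True
        then have "v \<notin> B e1" "B e1 \<inter> X \<noteq> {}" "\<not> B e1 \<subseteq> X"
          using x B'1 e(4) sv False by auto
        then show ?thesis using True x d2 e by (auto simp: cut_edges_def)
      next
        case False
        then show ?thesis using x B'[OF False] d2 by (auto simp: cut_edges_def)
      qed
      then show ?thesis by blast
    qed
  qed
  have deg: "card {x \<in> cut_edges E B {t}. d x < k} \<le> 4 * k + 4"
    if t: "t \<in> T - {v}" "card (cut_edges E B {t}) = 5 * k + 4" for t
  proof -
    \<comment> \<open>Degrees at terminals do not change: as \<open>a\<close> and \<open>b\<close>
      differ, at most one of the two edges is at \<open>t\<close>, and it corresponds to
      \<open>e1\<close> in the new graph.\<close>
    define sw where "sw x = (if x = e2 then e1 else x)" for x
    have ts: "t \<noteq> s" using t s by auto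
    have inj: "inj_on sw (cut_edges E B {t})"
      unfolding cut_singleton using e ts by (auto simp: inj_on_def sw_def split: if_splits)
    have im: "sw ` cut_edges E B {t} = cut_edges ?E B' {t}"
    proof
      show "sw ` cut_edges E B {t} \<subseteq> cut_edges ?E B' {t}"
        unfolding cut_singleton cs' using e ts B' B'1 by (auto simp: sw_def B'_def)
      show "cut_edges ?E B' {t} \<subseteq> sw ` cut_edges E B {t}"
      proof
        fix x assume x: "x \<in> cut_edges ?E B' {t}"
        show "x \<in> sw ` cut_edges E B {t}"
        proof (cases "x = e1 \<and> t = b")
          case True
          then have "x = sw e2" "e2 \<in> cut_edges E B {t}" using e by (auto simp: sw_def cut_singleton)
          then show ?thesis by blast
        next
          case False
          then have "x = sw x" "x \<in> cut_edges E B {t}"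
            using x e B' B'1 unfolding cs' cut_singleton by (auto simp: sw_def B'_def split: if_splits)
          then show ?thesis by blast
        qed
      qed
    qed
    have "card (cut_edges ?E B' {t}) = 5 * k + 4" using card_image[OF inj] im t(2) by simp
    then have le: "card {x \<in> cut_edges ?E B' {t}. d1 x < k} \<le> 4 * k + 4"
      using extension_few[OF d1 t(1)] by simp
    have "sw ` {x \<in> cut_edges E B {t}. d x < k} \<subseteq> {x \<in> cut_edges ?E B' {t}. d1 x < k}"
      using im d2 by (auto simp: sw_def split: if_splits)
    then have "card (sw ` {x \<in> cut_edges E B {t}. d x < k}) \<le> card {x \<in> cut_edges ?E B' {t}. d1 x < k}"
      by (rule card_mono[rotated]) (use fin in simp)
    moreover have "card (sw ` {x \<in> cut_edges E B {t}. d x < k}) = card {x \<in> cut_edges E B {t}. d x < k}"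
      by (rule card_image, rule inj_on_subset[OF inj]) auto
    ultimately show ?thesis using le by linarith
  qed
  have "d x \<le> k" if "x \<in> E" for x using d1 that e1E d2 by (cases "x = e2") (auto simp: extension_def)
  moreover have "d x = c x" if x: "x \<in> cut_edges E B {v}" for x
  proof -
    have "x \<noteq> e2" using x e s sv by (auto simp: cut_singleton)
    then show ?thesis using d1 x cv d2 by (auto simp: extension_def)
  qed
  ultimately have "extension E B T v c k d" unfolding extension_def using con deg by blast
  then show ?thesis by blast
qed

end

section \<open>Graphs in which no contraction or deletion applies\<close>

locale reduced_graph = coloured_graph E B T v c k
  for E :: "'e set" and B :: "'e \<Rightarrow> 'v set" and T :: "'v set" and v :: 'v and c :: "'e \<Rightarrow> nat" and k :: nat +
  assumes tight_trivial: "\<And>Z e1 e2. v \<notin> Z \<Longrightarrow> splits Z T \<Longrightarrow> card (cut_edges E B Z) = 5 * k + 4 \<Longrightarrow>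
      e1 \<in> E \<Longrightarrow> B e1 \<subseteq> Z \<Longrightarrow> e2 \<in> E \<Longrightarrow> B e2 \<inter> Z = {} \<Longrightarrow> False"
    and tight_edge: "\<And>e. e \<in> E \<Longrightarrow> \<exists>X. splits X T \<and> card (cut_edges E B X) = 5 * k + 4 \<and> e \<in> cut_edges E B X"
begin

text \<open>If no edge lies inside the side \<open>Z\<close> off \<open>v\<close>, all edges at a
  terminal of \<open>Z\<close> cross, and the sizes force equality. Otherwise no edge lies outside
  \<open>Z\<close>, and \<open>v\<close> takes the place of this terminal.\<close>

lemma tight_cut_star:
  assumes X: "splits X T" "card (cut_edges E B X) = 5 * k + 4"
  shows "\<exists>t\<in>T. cut_edges E B X = cut_edges E B {t} \<and> card (cut_edges E B {t}) = 5 * k + 4"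
proof -
  have star: "\<exists>t\<in>T. cut_edges E B X = cut_edges E B {t} \<and> card (cut_edges E B {t}) = 5 * k + 4"
    if t: "t \<in> T" and sub: "cut_edges E B {t} \<subseteq> cut_edges E B X" for t
  proof -
    have "5 * k + 4 \<le> card (cut_edges E B {t})" by (rule large_cut[OF splits_singleton[OF t]])
    then have "cut_edges E B {t} = cut_edges E B X"
      by (intro card_seteq[OF finite_cut sub]) (use X in simp)
    then show ?thesis using t X by metis
  qed
  have main: "\<exists>t\<in>T. cut_edges E B X = cut_edges E B {t} \<and> card (cut_edges E B {t}) = 5 * k + 4"
    if Z: "v \<notin> Z" "splits Z T" "cut_edges E B Z = cut_edges E B X" for Z
  proof (cases "\<exists>e\<in>E. B e \<subseteq> Z")
    case True
    then have out: "B e \<inter> Z \<noteq> {}" if "e \<in> E" for e using tight_trivial[OF Z(1,2)] Z(3) X(2) that by metis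
    have "cut_edges E B {v} \<subseteq> cut_edges E B X"
      unfolding Z(3)[symmetric] cut_singleton using out Z(1) by (auto simp: cut_edges_def)
    then show ?thesis by (rule star[OF v_T])
  next
    case False
    obtain t where t: "t \<in> Z" "t \<in> T" using Z by (auto simp: splits_def)
    have "cut_edges E B {t} \<subseteq> cut_edges E B X"
      unfolding Z(3)[symmetric] cut_singleton using False t by (auto simp: cut_edges_def)
    then show ?thesis by (rule star[OF t(2)])
  qed
  show ?thesis
  proof (cases "v \<in> X")
    case True
    show ?thesis by (rule main[of "- X"]) (use True X in \<open>simp_all add: splits_compl cut_edges_compl\<close>)
  qed (use main[of X] X in simp)
qed

lemma edge_tight_end: "e \<in> E \<Longrightarrow> \<exists>t\<in>T. t \<in> B e \<and> card (cut_edges E B {t}) = 5 * k + 4"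
proof -
  assume e: "e \<in> E"
  obtain X where X: "splits X T" "card (cut_edges E B X) = 5 * k + 4" "e \<in> cut_edges E B X" using tight_edge[OF e] by blast
  obtain t where "t \<in> T" "cut_edges E B X = cut_edges E B {t}" "card (cut_edges E B {t}) = 5 * k + 4"
    using tight_cut_star[OF X(1,2)] by blast
  then show ?thesis using X(3) by (auto simp: cut_singleton)
qed

text \<open>Tight cuts are stars of terminals and cover all edges, so nonterminals are pairwise
  nonadjacent.\<close>

lemma nonterminal_edge:
  assumes "e \<in> E" "s \<in> B e" "s \<notin> T"
  obtains t where "B e = {s, t}" "t \<in> T" "s \<noteq> t"
proof -
  obtain t where t: "B e = {s, t}" "s \<noteq> t" using B_other[OF assms(1,2)] .
  then have "t \<in> T" using edge_tight_end[OF assms(1)] assms(3) by auto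
  then show thesis using that t by blast
qed

lemma neighbour_tight:
  assumes "e \<in> E" "B e = {s, t}" "s \<notin> T"
  shows "t \<in> T" "card (cut_edges E B {t}) = 5 * k + 4"
  using edge_tight_end[OF assms(1)] assms by auto

text \<open>The edges from \<open>s\<close> to \<open>X\<close> leave the cut, and the other edges
  at \<open>s\<close> enter it.\<close>

lemma insert_cut:
  assumes s: "s \<notin> X"
  shows "card (cut_edges E B (insert s X)) + 2 * card {e \<in> E. s \<in> B e \<and> B e \<inter> X \<noteq> {}}
    = card (cut_edges E B X) + card {e \<in> E. s \<in> B e}"
proof -
  let ?Q = "{e \<in> E. s \<in> B e \<and> B e \<inter> X \<noteq> {}}" and ?S = "{e \<in> E. s \<in> B e}"
  have eq: "cut_edges E B (insert s X) = (cut_edges E B X - ?Q) \<union> (?S - ?Q)"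
  proof (intro set_eqI)
    fix e
    show "e \<in> cut_edges E B (insert s X) \<longleftrightarrow> e \<in> (cut_edges E B X - ?Q) \<union> (?S - ?Q)"
    proof (cases "e \<in> E")
      case True
      then obtain x y where "B e = {x, y}" "x \<noteq> y" by (rule B_pair)
      then show ?thesis using True s by (auto simp: cut_edges_def)
    qed (auto simp: cut_edges_def)
  qed
  have QX: "?Q \<subseteq> cut_edges E B X" using s by (auto simp: cut_edges_def)
  have QS: "?Q \<subseteq> ?S" by auto
  have f: "finite ?Q" "finite ?S" using finite_E by auto
  have "(cut_edges E B X - ?Q) \<inter> (?S - ?Q) = {}" by (auto simp: cut_edges_def)
  then have "card (cut_edges E B (insert s X)) = card (cut_edges E B X - ?Q) + card (?S - ?Q)"
    unfolding eq using finite_cut f by (intro card_Un_disjoint) auto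
  moreover have "card (cut_edges E B X) = card (cut_edges E B X - ?Q) + card ?Q"
    using card_mono[OF finite_cut QX] by (simp add: card_Diff_subset[OF f(1) QX])
  moreover have "card ?S = card (?S - ?Q) + card ?Q"
    using card_mono[OF f(2) QS] by (simp add: card_Diff_subset[OF f(1) QS])
  ultimately show ?thesis by linarith
qed

lemma insert_cut_bound:
  assumes "s \<notin> X" "s \<notin> T" "splits X T"
  shows "5 * k + 4 + 2 * card {e \<in> E. s \<in> B e \<and> B e \<inter> X \<noteq> {}} \<le> card (cut_edges E B X) + card {e \<in> E. s \<in> B e}"
proof -
  have "splits (insert s X) T" using assms by (auto simp: splits_def)
  then show ?thesis using insert_cut[OF assms(1)] large_cut[of "insert s X"] by linarith
qed

text \<open>The neighbour \<open>t\<close> has a smallest possible boundary, which must not shrink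
  when \<open>s\<close> moves to its side.\<close>

lemma multiplicity_bound:
  assumes s: "s \<notin> T" and t: "e \<in> E" "B e = {s, t}"
  shows "2 * card {e \<in> E. B e = {s, t}} \<le> card {e \<in> E. s \<in> B e}"
proof -
  note n = neighbour_tight[OF t s]
  have st: "s \<notin> {t}" using n s by auto
  have "{e \<in> E. B e = {s, t}} = {e \<in> E. s \<in> B e \<and> B e \<inter> {t} \<noteq> {}}"
  proof (intro Collect_cong conj_cong refl)
    fix e assume "e \<in> E"
    then obtain x y where "B e = {x, y}" "x \<noteq> y" by (rule B_pair)
    then show "B e = {s, t} \<longleftrightarrow> s \<in> B e \<and> B e \<inter> {t} \<noteq> {}" using st by (auto simp: doubleton_eq_iff)
  qed
  then show ?thesis using insert_cut_bound[OF st s splits_singleton[OF n(1)]] n(2) by simp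
qed

lemma card_cut_sum: "card (cut_edges E B X) = (\<Sum>e\<in>E. if B e \<inter> X \<noteq> {} \<and> \<not> B e \<subseteq> X then 1 else 0)"
  unfolding cut_edges_def by (rule sum_indicator_card[OF finite_E, symmetric])

text \<open>Checked edge by edge. An edge from \<open>s\<close> to \<open>a\<close> counts twice on
  the right and not at all in the boundaries of the differences, which pays for the additional
  term.\<close>

lemma posimodular:
  assumes "s \<notin> X" "s \<notin> Y" "a \<in> X" "a \<in> Y"
  shows "card (cut_edges E B (X - Y)) + card (cut_edges E B (Y - X)) + 2 * card {e \<in> E. B e = {s, a}}
    \<le> card (cut_edges E B X) + card (cut_edges E B Y)"
  unfolding card_cut_sum sum_indicator_card[OF finite_E, symmetric, of "\<lambda>e. B e = {s, a}"]
    sum_distrib_left sum.distrib[symmetric]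
proof (rule sum_mono)
  fix e assume "e \<in> E"
  then obtain x y where xy: "B e = {x, y}" "x \<noteq> y" by (rule B_pair)
  show "(if B e \<inter> (X - Y) \<noteq> {} \<and> \<not> B e \<subseteq> X - Y then 1 else 0) +
      (if B e \<inter> (Y - X) \<noteq> {} \<and> \<not> B e \<subseteq> Y - X then 1 else 0) + 2 * (if B e = {s, a} then 1 else 0)
    \<le> (if B e \<inter> X \<noteq> {} \<and> \<not> B e \<subseteq> X then 1 else (0::nat)) + (if B e \<inter> Y \<noteq> {} \<and> \<not> B e \<subseteq> Y then 1 else 0)"
  proof (cases "B e = {s, a}")
    case True
    then show ?thesis using assms by simp
  next
    case False
    then show ?thesis unfolding xy(1)
      by (cases "x \<in> X"; cases "x \<in> Y"; cases "y \<in> X"; cases "y \<in> Y"; simp)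
  qed
qed

text \<open>Checked for all positions of the two ends of an edge. Four boundaries stand against
  three, which is impossible if all four are large and the three barely exceed the minimum.\<close>

lemma three_sets:
  "card (cut_edges E B (X \<inter> Y \<inter> Z)) + card (cut_edges E B (X - Y - Z)) + card (cut_edges E B (Y - X - Z))
      + card (cut_edges E B (Z - X - Y))
    \<le> card (cut_edges E B X) + card (cut_edges E B Y) + card (cut_edges E B Z)"
  unfolding card_cut_sum sum.distrib[symmetric]
proof (rule sum_mono)
  fix e assume "e \<in> E"
  then obtain x y where xy: "B e = {x, y}" "x \<noteq> y" by (rule B_pair)
  show "(if B e \<inter> (X \<inter> Y \<inter> Z) \<noteq> {} \<and> \<not> B e \<subseteq> X \<inter> Y \<inter> Z then 1 else 0) +
      (if B e \<inter> (X - Y - Z) \<noteq> {} \<and> \<not> B e \<subseteq> X - Y - Z then 1 else 0) +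
      (if B e \<inter> (Y - X - Z) \<noteq> {} \<and> \<not> B e \<subseteq> Y - X - Z then 1 else 0) +
      (if B e \<inter> (Z - X - Y) \<noteq> {} \<and> \<not> B e \<subseteq> Z - X - Y then 1 else 0)
    \<le> (if B e \<inter> X \<noteq> {} \<and> \<not> B e \<subseteq> X then 1 else (0::nat)) + (if B e \<inter> Y \<noteq> {} \<and> \<not> B e \<subseteq> Y then 1 else 0) +
      (if B e \<inter> Z \<noteq> {} \<and> \<not> B e \<subseteq> Z then 1 else 0)"
    unfolding xy(1)
    by (cases "x \<in> X"; cases "x \<in> Y"; cases "x \<in> Z"; cases "y \<in> X"; cases "y \<in> Y"; cases "y \<in> Z"; simp)
qed

text \<open>A pair of edges at \<open>s\<close> cannot be split off only if its ends lie in a set \<open>X\<close> that avoids \<open>s\<close>,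
  separates \<open>T\<close> and has a boundary of size at most \<open>5 * k + 5\<close>. The argument uncrosses a minimal
  family of such sets that contain a fixed neighbour \<open>a\<close> and cover the neighbours of \<open>s\<close>.\<close>

lemma splitting_exists:
  assumes s: "s \<notin> T" and r: "card {e \<in> E. s \<in> B e} \<noteq> 0" "card {e \<in> E. s \<in> B e} \<noteq> 3"
  shows "\<exists>e1 e2 a b. e1 \<in> E \<and> e2 \<in> E \<and> e1 \<noteq> e2 \<and> B e1 = {s, a} \<and> B e2 = {s, b} \<and> a \<noteq> b \<and> b \<noteq> v \<and>
    (\<forall>X. s \<notin> X \<and> a \<in> X \<and> b \<in> X \<and> \<not> T \<subseteq> X \<longrightarrow> 5 * k + 6 \<le> card (cut_edges E B X))"
proof (rule ccontr)
  assume n: "\<not> ?thesis"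
  define S where "S = {e \<in> E. s \<in> B e}"
  define Nb where "Nb = {t. \<exists>e\<in>E. B e = {s, t}}"
  define p where "p t = card {e \<in> E. B e = {s, t}}" for t
  define q where "q X = card {e \<in> E. s \<in> B e \<and> B e \<inter> X \<noteq> {}}" for X
  have fS: "finite S" using finite_E by (simp add: S_def)
  have NbT: "t \<in> T" if "t \<in> Nb" for t using that neighbour_tight s by (auto simp: Nb_def)
  have Sedge: "\<exists>t\<in>Nb. B e = {s, t}" if e: "e \<in> S" for e
  proof -
    have "e \<in> E" "s \<in> B e" using e by (auto simp: S_def)
    then obtain t where "B e = {s, t}" using nonterminal_edge[OF _ _ s] by metis
    then show ?thesis using \<open>e \<in> E\<close> by (auto simp: Nb_def)
  qed
  have p2: "2 * p t \<le> card S" if "t \<in> Nb" for t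
    using that multiplicity_bound[OF s] by (auto simp: Nb_def p_def S_def)
  have danger1: "\<exists>X. s \<notin> X \<and> a \<in> X \<and> b \<in> X \<and> \<not> T \<subseteq> X \<and> card (cut_edges E B X) \<le> 5 * k + 5"
    if e: "e1 \<in> E" "e2 \<in> E" "e1 \<noteq> e2" "B e1 = {s, a}" "B e2 = {s, b}" "a \<noteq> b" "b \<noteq> v" for a b e1 e2
  proof (rule ccontr)
    assume m: "\<not> ?thesis"
    have "5 * k + 6 \<le> card (cut_edges E B X)" if "s \<notin> X \<and> a \<in> X \<and> b \<in> X \<and> \<not> T \<subseteq> X" for X
    proof -
      have "\<not> card (cut_edges E B X) \<le> 5 * k + 5" using m that by blast
      then show ?thesis by simp
    qed
    then have big: "\<forall>X. s \<notin> X \<and> a \<in> X \<and> b \<in> X \<and> \<not> T \<subseteq> X \<longrightarrow> 5 * k + 6 \<le> card (cut_edges E B X)"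
      by blast
    show False
      by (rule notE[OF n], intro exI conjI)
        (rule e(1), rule e(2), rule e(3), rule e(4), rule e(5), rule e(6), rule e(7), rule big)
  qed
  have danger: "\<exists>X. s \<notin> X \<and> a \<in> X \<and> b \<in> X \<and> \<not> T \<subseteq> X \<and> card (cut_edges E B X) \<le> 5 * k + 5"
    if ab: "a \<in> Nb" "b \<in> Nb" "a \<noteq> b" for a b
  proof -
    obtain e1 e2 where e: "e1 \<in> E" "B e1 = {s, a}" "e2 \<in> E" "B e2 = {s, b}" using ab by (auto simp: Nb_def)
    have ne: "e1 \<noteq> e2"
    proof
      assume "e1 = e2"
      then have "{s, a} = {s, b}" using e by simp
      then show False using ab(3) by (auto simp: doubleton_eq_iff)
    qed
    show ?thesis
    proof (cases "b = v")
      case False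
      show ?thesis by (rule danger1[OF e(1,3) ne e(2,4) ab(3) False])
    next
      case True
      then have "a \<noteq> v" using ab(3) by simp
      from danger1[OF e(3,1) ne[symmetric] e(4,2) ab(3)[symmetric] this] show ?thesis by (elim exE conjE) blast
    qed
  qed
  \<comment> \<open>Adding \<open>s\<close> to a set as in \<open>danger\<close> must leave a
    boundary of at least \<open>5 * k + 4\<close>, so at most half of the edges at \<open>s\<close>
    lead into the set, up to rounding.\<close>
  have qb: "2 * q X \<le> card S + 1" if X: "s \<notin> X" "\<not> T \<subseteq> X" "x \<in> X" "x \<in> T" "card (cut_edges E B X) \<le> 5 * k + 5" for X x
  proof -
    have "splits X T" using X by (auto simp: splits_def)
    then show ?thesis using insert_cut_bound[OF X(1) s, of] X(5) by (simp add: q_def S_def)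
  qed
  have Sne: "S \<noteq> {}" using r(1) unfolding S_def by (metis card.empty)
  then have "Nb \<noteq> {}" using Sedge by blast
  \<comment> \<open>A neighbour with parallel edges is preferred, so if \<open>a\<close> has none,
    no neighbour does.\<close>
  then obtain a where a: "a \<in> Nb" "(\<exists>t\<in>Nb. 2 \<le> p t) \<Longrightarrow> 2 \<le> p a" by (metis equals0I)
  have aT: "a \<in> T" by (rule NbT[OF a(1)])
  define D where "D b = (SOME X. s \<notin> X \<and> a \<in> X \<and> b \<in> X \<and> \<not> T \<subseteq> X \<and> card (cut_edges E B X) \<le> 5 * k + 5)" for b
  have D: "s \<notin> D b \<and> a \<in> D b \<and> b \<in> D b \<and> \<not> T \<subseteq> D b \<and> card (cut_edges E B (D b)) \<le> 5 * k + 5"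
    if "b \<in> Nb" "b \<noteq> a" for b
    unfolding D_def by (rule someI_ex[OF danger[OF a(1) that(1)]]) (use that in auto)
  have S2: "2 \<le> card S"
  proof -
    have "p a \<noteq> 0" using a(1) finite_E by (auto simp: p_def Nb_def)
    then show ?thesis using p2[OF a(1)] by linarith
  qed
  have "\<exists>b\<in>Nb. b \<noteq> a"
  proof (rule ccontr)
    assume "\<not> ?thesis"
    then have all: "\<And>b. b \<in> Nb \<Longrightarrow> b = a" by blast
    have "S \<subseteq> {e \<in> E. B e = {s, a}}"
    proof
      fix e assume e: "e \<in> S"
      obtain t where "t \<in> Nb" "B e = {s, t}" using Sedge[OF e] by blast
      then have "B e = {s, a}" using all[of t] by simp
      then show "e \<in> {e \<in> E. B e = {s, a}}" using e by (simp add: S_def)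
    qed
    then have "card S \<le> p a" unfolding p_def by (rule card_mono[rotated]) (use finite_E in simp)
    then show False using p2[OF a(1)] S2 by linarith
  qed
  then obtain b0 where b0: "b0 \<in> Nb" "b0 \<noteq> a" by blast
  have finN: "finite Nb" by (rule finite_subset[OF _ finite_T]) (use NbT in auto)
  let ?I = "D ` (Nb - {a})"
  \<comment> \<open>In a minimal cover of the neighbours each member has a neighbour of its own.
    Being terminals, these private neighbours make the differences of members split
    \<open>T\<close>.\<close>
  define CC where "CC = {F. F \<subseteq> ?I \<and> Nb \<subseteq> \<Union>F}"
  have "b \<in> \<Union>?I" if b: "b \<in> Nb" for b
  proof (cases "b = a")
    case True
    have "a \<in> D b0" "D b0 \<in> ?I" using D[OF b0] b0 by auto
    then show ?thesis using True by blast
  next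
    case False
    have "b \<in> D b" "D b \<in> ?I" using D[OF b False] b False by auto
    then show ?thesis by blast
  qed
  then have "?I \<in> CC" by (simp add: CC_def subset_iff)
  moreover have "finite CC" using finN by (simp add: CC_def)
  ultimately obtain F where F: "F \<in> CC" "\<And>G. G \<in> CC \<Longrightarrow> G \<subseteq> F \<Longrightarrow> F = G"
    using finite_has_minimal[of CC] by blast
  have FD: "s \<notin> X \<and> a \<in> X \<and> \<not> T \<subseteq> X \<and> card (cut_edges E B X) \<le> 5 * k + 5" if "X \<in> F" for X
  proof -
    have "X \<in> ?I" using F(1) that by (auto simp: CC_def)
    then obtain b where b: "b \<in> Nb" "b \<noteq> a" "X = D b" by blast
    show ?thesis unfolding b(3) using D[OF b(1,2)] by blast
  qed
  have Fcov: "Nb \<subseteq> \<Union>F" and FI: "F \<subseteq> ?I" using F(1) by (auto simp: CC_def)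
  have priv: "\<exists>x\<in>Nb. x \<in> X \<and> (\<forall>Y\<in>F. Y \<noteq> X \<longrightarrow> x \<notin> Y)" if X: "X \<in> F" for X
  proof (rule ccontr)
    assume m: "\<not> ?thesis"
    have "x \<in> \<Union>(F - {X})" if x: "x \<in> Nb" for x
    proof -
      obtain Y where Y: "Y \<in> F" "x \<in> Y" using Fcov x by blast
      show ?thesis
      proof (cases "Y = X")
        case True
        then have "\<exists>Y\<in>F. Y \<noteq> X \<and> x \<in> Y" using m x Y by blast
        then show ?thesis by blast
      qed (use Y in blast)
    qed
    then have "F - {X} \<in> CC" using FI by (auto simp: CC_def)
    then have "F = F - {X}" using F(2) by blast
    then show False using X by blast
  qed
  have qF: "2 * q X \<le> card S + 1" if "X \<in> F" for X using qb[of X a] FD[OF that] aT by blast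
  have r4: "card S = 2 \<or> 4 \<le> card S" using S2 r(2) by (auto simp: S_def)
  have q_all: "card S \<le> q X" if "Nb \<subseteq> X" for X
  proof -
    have "S \<subseteq> {e \<in> E. s \<in> B e \<and> B e \<inter> X \<noteq> {}}"
    proof
      fix e assume e: "e \<in> S"
      obtain t where "t \<in> Nb" "B e = {s, t}" using Sedge[OF e] by blast
      then show "e \<in> {e \<in> E. s \<in> B e \<and> B e \<inter> X \<noteq> {}}" using e that by (auto simp: S_def)
    qed
    then show ?thesis unfolding q_def by (rule card_mono[rotated]) (use finite_E in simp)
  qed
  obtain X where X: "X \<in> F" using a(1) Fcov by blast
  have "\<exists>Y\<in>F. Y \<noteq> X"
  proof (rule ccontr)
    assume "\<not> ?thesis"
    then have "Nb \<subseteq> X" using Fcov by blast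
    then have "card S \<le> q X" by (rule q_all)
    then show False using qF[OF X] S2 by linarith
  qed
  then obtain Y where Y: "Y \<in> F" "Y \<noteq> X" by blast
  obtain x where x: "x \<in> Nb" "x \<in> X" "\<And>Y. Y \<in> F \<Longrightarrow> Y \<noteq> X \<Longrightarrow> x \<notin> Y" using priv[OF X] by blast
  obtain y where y: "y \<in> Nb" "y \<in> Y" "\<And>Z. Z \<in> F \<Longrightarrow> Z \<noteq> Y \<Longrightarrow> y \<notin> Z" using priv[OF Y(1)] by blast
  have xyT: "x \<in> T" "y \<in> T" using NbT x y by auto
  have xy: "x \<notin> Y" "y \<notin> X" using x(3)[OF Y] y(3)[OF X] Y(2) by auto
  show False
  proof (cases "2 \<le> p a")
    case True
    \<comment> \<open>The left side is at least \<open>2 * (5 * k + 4) + 4\<close>, the right side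
      at most \<open>2 * (5 * k + 5)\<close>.\<close>
    have "card (cut_edges E B (X - Y)) + card (cut_edges E B (Y - X)) + 2 * p a
        \<le> card (cut_edges E B X) + card (cut_edges E B Y)"
      unfolding p_def by (rule posimodular) (use FD X Y in auto)
    moreover have "5 * k + 4 \<le> card (cut_edges E B (X - Y))"
      by (rule large_cut) (use x y xy xyT in \<open>auto simp: splits_def\<close>)
    moreover have "5 * k + 4 \<le> card (cut_edges E B (Y - X))"
      by (rule large_cut) (use x y xy xyT in \<open>auto simp: splits_def\<close>)
    ultimately show False using FD[OF X] FD[OF Y(1)] True by linarith
  next
    case pa: False
    have p1: "p t \<le> 1" if "t \<in> Nb" for t
    proof -
      have "\<not> 2 \<le> p t" using a(2) pa that by blast
      then show ?thesis by simp
    qed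
    show False
    proof (cases "\<exists>Z\<in>F. Z \<noteq> X \<and> Z \<noteq> Y")
      case True
      \<comment> \<open>Four cuts of size at least \<open>5 * k + 4\<close> exceed three of size at
        most \<open>5 * k + 5\<close>; the intersection counts since it contains
        \<open>a\<close>.\<close>
      then obtain Z where Z: "Z \<in> F" "Z \<noteq> X" "Z \<noteq> Y" by blast
      obtain z where z: "z \<in> Nb" "z \<in> Z" "\<And>W. W \<in> F \<Longrightarrow> W \<noteq> Z \<Longrightarrow> z \<notin> W" using priv[OF Z(1)] by blast
      have zT: "z \<in> T" using NbT z by auto
      have out: "x \<notin> Z" "y \<notin> Z" "z \<notin> X" "z \<notin> Y" using x(3) y(3) z(3) X Y Z by auto
      have "5 * k + 4 \<le> card (cut_edges E B (X \<inter> Y \<inter> Z))"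
        by (rule large_cut) (use FD X Y Z xyT xy aT in \<open>auto simp: splits_def\<close>)
      moreover have "5 * k + 4 \<le> card (cut_edges E B (X - Y - Z))"
        by (rule large_cut) (use x y xy xyT out in \<open>auto simp: splits_def\<close>)
      moreover have "5 * k + 4 \<le> card (cut_edges E B (Y - X - Z))"
        by (rule large_cut) (use x y xy xyT out in \<open>auto simp: splits_def\<close>)
      moreover have "5 * k + 4 \<le> card (cut_edges E B (Z - X - Y))"
        by (rule large_cut) (use z zT x xyT xy out in \<open>auto simp: splits_def\<close>)
      ultimately show False using three_sets[of X Y Z] FD[OF X] FD[OF Y(1)] FD[OF Z(1)] by linarith
    next
      case False
      then have cov: "Nb \<subseteq> X \<union> Y" using Fcov by blast
      let ?QX = "{e \<in> E. s \<in> B e \<and> B e \<inter> X \<noteq> {}}" and ?QY = "{e \<in> E. s \<in> B e \<and> B e \<inter> Y \<noteq> {}}"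
      have fQ: "finite ?QX" "finite ?QY" using finite_E by auto
      have "S \<subseteq> ?QX \<union> ?QY"
      proof
        fix e assume e: "e \<in> S"
        obtain t where "t \<in> Nb" "B e = {s, t}" using Sedge[OF e] by blast
        then show "e \<in> ?QX \<union> ?QY" using e cov by (auto simp: S_def)
      qed
      then have 1: "card S \<le> card (?QX \<union> ?QY)" by (rule card_mono[rotated]) (use fQ in auto)
      obtain ea where "ea \<in> E" "B ea = {s, a}" using a(1) by (auto simp: Nb_def)
      then have "ea \<in> ?QX \<inter> ?QY" using FD[OF X] FD[OF Y(1)] by auto
      then have 2: "1 \<le> card (?QX \<inter> ?QY)" using fQ by (auto simp: Suc_le_eq card_gt_0_iff)
      have "card ?QX + card ?QY = card (?QX \<union> ?QY) + card (?QX \<inter> ?QY)" by (rule card_Un_Int[OF fQ])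
      \<comment> \<open>The edge at \<open>a\<close> counts for both sets, so the bound
        \<open>qb\<close> is attained and the degree of \<open>s\<close> is odd. Then
        \<open>X\<close> together with \<open>s\<close> is tight, so its boundary is the star of a
        terminal \<open>t\<close>, to which all edges from \<open>s\<close> outside \<open>X\<close>
        lead. As the degree is not three, there are at least two of them, against multiplicity
        one.\<close>
      then have "card S + 1 \<le> q X + q Y" using 1 2 by (simp add: q_def)
      then have qX: "2 * q X = card S + 1" using qF[OF X] qF[OF Y(1)] by linarith
      have spX: "splits X T" using FD[OF X] aT by (auto simp: splits_def)
      have sX: "s \<notin> X" using FD[OF X] by blast
      have spI: "splits (insert s X) T" using spX s by (auto simp: splits_def)
      have "card (cut_edges E B (insert s X)) + 2 * q X = card (cut_edges E B X) + card S"
        unfolding q_def S_def by (rule insert_cut[OF sX])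
      then have "card (cut_edges E B (insert s X)) = 5 * k + 4"
        using qX FD[OF X] large_cut[OF spI] by linarith
      then obtain t where t: "t \<in> T" "cut_edges E B (insert s X) = cut_edges E B {t}"
        using tight_cut_star[OF spI] by blast
      have "S - ?QX \<subseteq> {e \<in> E. B e = {s, t}}"
      proof
        fix e assume e: "e \<in> S - ?QX"
        then obtain u where u: "B e = {s, u}" "u \<in> Nb" using Sedge by blast
        have "u \<notin> X" using e u by (auto simp: S_def)
        moreover have "u \<noteq> s" using NbT[OF u(2)] s by auto
        ultimately have "e \<in> cut_edges E B (insert s X)" using e u by (auto simp: cut_edges_def S_def)
        then have "t \<in> B e" unfolding t(2) by (simp add: cut_singleton)
        then have "u = t" using u t s by auto
        then show "e \<in> {e \<in> E. B e = {s, t}}" using e u by (auto simp: S_def)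
      qed
      then have "card (S - ?QX) \<le> p t" unfolding p_def by (rule card_mono[rotated]) (use finite_E in simp)
      moreover have "card S - card ?QX \<le> card (S - ?QX)" by (rule diff_card_le_card_Diff[OF fQ(1)])
      ultimately have pt: "card S \<le> p t + q X" by (simp add: q_def)
      have "2 \<le> p t" using pt qX r4 by arith
      then have "{e \<in> E. B e = {s, t}} \<noteq> {}" unfolding p_def by (metis card.empty not_numeral_le_zero)
      then have "t \<in> Nb" by (auto simp: Nb_def)
      then show False using p1[of t] \<open>2 \<le> p t\<close> by linarith
    qed
  qed
qed

text \<open>A vertex of degree three outside \<open>T\<close> has three distinct neighbours, all in \<open>T\<close>, so the graph
  becomes a hypergraph on \<open>T\<close>: \<open>Inl e\<close> is an edge between terminals, \<open>Inr s\<close> the star of \<open>s\<close>.\<close>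

lemma extension_base:
  assumes three: "\<And>s. s \<notin> T \<Longrightarrow> card {e \<in> E. s \<in> B e} = 0 \<or> card {e \<in> E. s \<in> B e} = 3"
  shows "\<exists>d. extension E B T v c k d"
proof -
  define Sv where "Sv = {s. s \<notin> T \<and> (\<exists>e\<in>E. s \<in> B e)}"
  define nb where "nb s = {t. \<exists>e\<in>E. B e = {s, t}}" for s
  define H where "H = Inl ` {e \<in> E. B e \<subseteq> T} \<union> Inr ` Sv"
  define A where "A h = (case h of Inl e \<Rightarrow> B e | Inr s \<Rightarrow> nb s)" for h
  define ln where "ln e = (if B e \<subseteq> T then Inl e else Inr (SOME s. s \<in> B e \<and> s \<notin> T))" for e
  have deg3: "card {e \<in> E. s \<in> B e} = 3" if "s \<in> Sv" for s
  proof -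
    have "{e \<in> E. s \<in> B e} \<noteq> {}" using that by (auto simp: Sv_def)
    then have "card {e \<in> E. s \<in> B e} \<noteq> 0" using finite_E by simp
    then show ?thesis using three[of s] that by (auto simp: Sv_def)
  qed
  have star: "\<exists>t\<in>T. B e = {s, t} \<and> s \<noteq> t" if "e \<in> E" "s \<in> B e" "s \<in> Sv" for e s
  proof -
    have "s \<notin> T" using that by (simp add: Sv_def)
    with that(1,2) obtain t where "B e = {s, t}" "t \<in> T" "s \<noteq> t" by (rule nonterminal_edge)
    then show ?thesis by blast
  qed
  have uniq: "e = e'" if e: "e \<in> E" "e' \<in> E" "B e = {s, t}" "B e' = {s, t}" "s \<in> Sv" for e e' s t
  proof -
    have s: "s \<notin> T" using e by (simp add: Sv_def)
    have "2 * card {e \<in> E. B e = {s, t}} \<le> 3"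
      using multiplicity_bound[OF s e(1,3)] deg3[OF e(5)] by simp
    then have "card {e \<in> E. B e = {s, t}} \<le> Suc 0" by linarith
    then show ?thesis using e finite_E by (subst (asm) card_le_Suc0_iff_eq) auto
  qed
  have nbT: "nb s \<subseteq> T" if "s \<in> Sv" for s
    using that neighbour_tight(1) by (auto simp: nb_def Sv_def)
  have nb3: "card (nb s) = 3" if s: "s \<in> Sv" for s
  proof -
    define ot where "ot e = (SOME t. B e = {s, t})" for e
    have ot: "B e = {s, ot e}" if "e \<in> {e \<in> E. s \<in> B e}" for e
      unfolding ot_def by (rule someI_ex) (use star[of e s] that s in blast)
    have "inj_on ot {e \<in> E. s \<in> B e}"
      by (rule inj_onI) (use ot uniq s in \<open>metis (mono_tags, lifting) mem_Collect_eq\<close>)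
    moreover have "ot ` {e \<in> E. s \<in> B e} = nb s"
    proof
      show "ot ` {e \<in> E. s \<in> B e} \<subseteq> nb s" using ot by (auto simp: nb_def)
      show "nb s \<subseteq> ot ` {e \<in> E. s \<in> B e}"
      proof
        fix t assume "t \<in> nb s"
        then obtain e where e: "e \<in> E" "B e = {s, t}" by (auto simp: nb_def)
        then have "B e = {s, ot e}" using ot[of e] by auto
        moreover have "t \<noteq> s" using nbT[OF s] \<open>t \<in> nb s\<close> s by (auto simp: Sv_def)
        ultimately have "t = ot e" using e by (auto simp: doubleton_eq_iff)
        then show "t \<in> ot ` {e \<in> E. s \<in> B e}" using e by auto
      qed
    qed
    ultimately show ?thesis using deg3[OF s] card_image[of ot "{e \<in> E. s \<in> B e}"] by simp
  qed
  have lnT: "ln e = Inl e" if "B e \<subseteq> T" for e using that by (simp add: ln_def)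
  have ln_star: "ln e = Inr s" if e: "e \<in> E" "B e = {s, t}" "s \<in> Sv" for e s t
  proof -
    have s: "s \<notin> T" using e by (simp add: Sv_def)
    have t: "t \<in> T" using neighbour_tight(1)[OF e(1,2) s] .
    have "(SOME x. x \<in> B e \<and> x \<notin> T) = s" by (rule some_equality) (use e s t in auto)
    then show ?thesis using e s by (simp add: ln_def)
  qed
  have edge_cases: "B e \<subseteq> T \<or> (\<exists>s\<in>Sv. \<exists>t\<in>T. B e = {s, t} \<and> s \<noteq> t)" if e: "e \<in> E" for e
  proof (cases "B e \<subseteq> T")
    case False
    then obtain s where "s \<in> B e" "s \<notin> T" by blast
    then have "s \<in> Sv" using e by (auto simp: Sv_def)
    then show ?thesis using star[OF e \<open>s \<in> B e\<close>] by blast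
  qed simp
  have lnH: "ln e \<in> H" if e: "e \<in> E" for e
    using edge_cases[OF e]
  proof
    assume "\<exists>s\<in>Sv. \<exists>t\<in>T. B e = {s, t} \<and> s \<noteq> t"
    then obtain s t where "s \<in> Sv" "B e = {s, t}" by blast
    then show ?thesis using ln_star[OF e] by (auto simp: H_def)
  qed (use e in \<open>auto simp: H_def lnT\<close>)
  have lnA: "B e \<inter> T \<subseteq> A (ln e)" if e: "e \<in> E" for e
    using edge_cases[OF e]
  proof
    assume "\<exists>s\<in>Sv. \<exists>t\<in>T. B e = {s, t} \<and> s \<noteq> t"
    then obtain s t where st: "s \<in> Sv" "B e = {s, t}" by blast
    then have "B e \<inter> T \<subseteq> {t}" by (auto simp: Sv_def)
    then show ?thesis using ln_star[OF e st(2,1)] st e by (auto simp: A_def nb_def)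
  qed (use e in \<open>auto simp: lnT A_def\<close>)
  have ln_inj: "inj_on ln {e \<in> E. t \<in> B e}" if t: "t \<in> T" for t
  proof (rule inj_onI)
    fix e e' assume e: "e \<in> {e \<in> E. t \<in> B e}" "e' \<in> {e \<in> E. t \<in> B e}" "ln e = ln e'"
    then have eE: "e \<in> E" "e' \<in> E" "t \<in> B e" "t \<in> B e'" by auto
    show "e = e'"
    proof (cases "B e \<subseteq> T")
      case True
      then have "ln e' = Inl e" using e(3) lnT by simp
      then show ?thesis by (auto simp: ln_def split: if_splits)
    next
      case False
      then obtain s u where s: "s \<in> Sv" "B e = {s, u}" using edge_cases[OF eE(1)] by blast
      have l: "ln e' = Inr s" using ln_star[OF eE(1) s(2,1)] e(3) by simp
      then have "\<not> B e' \<subseteq> T" using lnT[of e'] by auto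
      then obtain s' u' where s': "s' \<in> Sv" "B e' = {s', u'}" using edge_cases[OF eE(2)] by blast
      then have "s' = s" using ln_star[OF eE(2) s'(2,1)] l by simp
      moreover have "s \<noteq> t" using s t by (auto simp: Sv_def)
      ultimately have "B e = {s, t}" "B e' = {s, t}" using s s' eE by auto
      then show ?thesis using uniq eE s by blast
    qed
  qed
  have ln_im: "ln ` {e \<in> E. t \<in> B e} = {h \<in> H. t \<in> A h}" if t: "t \<in> T" for t
  proof
    show "ln ` {e \<in> E. t \<in> B e} \<subseteq> {h \<in> H. t \<in> A h}" using lnH lnA t by blast
    show "{h \<in> H. t \<in> A h} \<subseteq> ln ` {e \<in> E. t \<in> B e}"
    proof
      fix h assume h: "h \<in> {h \<in> H. t \<in> A h}"
      show "h \<in> ln ` {e \<in> E. t \<in> B e}"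
      proof (cases h)
        case (Inl e)
        then have "e \<in> E" "B e \<subseteq> T" "t \<in> B e" using h by (auto simp: H_def A_def)
        then show ?thesis using lnT[of e] Inl by force
      next
        case (Inr s)
        then have "s \<in> Sv" "t \<in> nb s" using h by (auto simp: H_def A_def)
        then obtain e where "e \<in> E" "B e = {s, t}" by (auto simp: nb_def)
        then show ?thesis using ln_star[of e s t] \<open>s \<in> Sv\<close> Inr by force
      qed
    qed
  qed
  have deg: "card {h \<in> H. t \<in> A h} = card (cut_edges E B {t})" if "t \<in> T" for t
    using card_image[OF ln_inj[OF that]] ln_im[OF that] by (simp add: cut_singleton)
  have finSv: "finite Sv"
  proof -
    have "finite (\<Union>e\<in>E. B e)" using finite_E card_B card.infinite by fastforce
    moreover have "Sv \<subseteq> (\<Union>e\<in>E. B e)" by (auto simp: Sv_def)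
    ultimately show ?thesis by (rule rev_finite_subset)
  qed
  have finH: "finite H" using finite_E finSv by (simp add: H_def)
  have AT: "A h \<subseteq> T \<and> 2 \<le> card (A h) \<and> card (A h) \<le> 3" if "h \<in> H" for h
  proof (cases h)
    case (Inl e)
    then have "e \<in> E" "B e \<subseteq> T" using that by (auto simp: H_def)
    then show ?thesis using card_B[of e] Inl by (simp add: A_def)
  next
    case (Inr s)
    then have "s \<in> Sv" using that by (auto simp: H_def)
    then show ?thesis using nbT[of s] nb3[of s] Inr by (simp add: A_def)
  qed
  have hcut: "5 * k + 4 \<le> card {h \<in> H. A h \<inter> X \<noteq> {} \<and> \<not> A h \<subseteq> X}" if X: "X \<subseteq> T" "X \<noteq> {}" "X \<noteq> T" for X
  proof -
    \<comment> \<open>The centre of a star joins the side of the majority of its three neighbours.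
      At most one edge of the star crosses then, and only if the link does, so the crossing edges
      map injectively to crossing links.\<close>
    define X' where "X' = X \<union> {s \<in> Sv. 2 \<le> card (nb s \<inter> X)}"
    have X'T: "t \<in> X' \<longleftrightarrow> t \<in> X" if "t \<in> T" for t using that by (auto simp: X'_def Sv_def)
    have X's: "s \<in> X' \<longleftrightarrow> 2 \<le> card (nb s \<inter> X)" if "s \<in> Sv" for s
      using that X(1) by (auto simp: X'_def Sv_def)
    have "splits X' T" using X X'T by (auto simp: splits_def)
    then have 1: "5 * k + 4 \<le> card (cut_edges E B X')" by (rule large_cut)
    have side: "if s \<in> X' then u \<notin> X else u \<in> X"
      if "e \<in> cut_edges E B X'" "B e = {s, u}" "s \<in> Sv" for e s u
    proof -
      have "e \<in> E" "s \<notin> T" using that by (auto simp: Sv_def cut_edges_def)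
      then have "u \<in> T" using neighbour_tight(1)[OF _ that(2)] by blast
      then show ?thesis using that X'T[of u] by (auto simp: cut_edges_def)
    qed
    have fnb: "finite (nb s)" if "s \<in> Sv" for s using nb3[OF that] card.infinite by fastforce
    have inj: "inj_on ln (cut_edges E B X')"
    proof (rule inj_onI)
      fix e e' assume e: "e \<in> cut_edges E B X'" "e' \<in> cut_edges E B X'" "ln e = ln e'"
      have eE: "e \<in> E" "e' \<in> E" using e by (auto simp: cut_edges_def)
      show "e = e'"
      proof (cases "B e \<subseteq> T")
        case True
        then have "ln e' = Inl e" using e(3) lnT by simp
        then show ?thesis by (auto simp: ln_def split: if_splits)
      next
        case False
        then obtain s u where s: "s \<in> Sv" "B e = {s, u}" using edge_cases[OF eE(1)] by blast
        have l: "ln e' = Inr s" using ln_star[OF eE(1) s(2,1)] e(3) by simp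
        then have "\<not> B e' \<subseteq> T" using lnT[of e'] by auto
        then obtain s' u' where s': "s' \<in> Sv" "B e' = {s', u'}" using edge_cases[OF eE(2)] by blast
        then have ss: "s' = s" using ln_star[OF eE(2) s'(2,1)] l by simp
        have un: "u \<in> nb s" "u' \<in> nb s" using s s' ss eE by (auto simp: nb_def)
        have "u = u'"
        proof (rule ccontr)
          assume uu: "u \<noteq> u'"
          show False
          proof (cases "s \<in> X'")
            case True
            then have "u \<notin> X" "u' \<notin> X" using side[OF e(1) s(2,1)] side[OF e(2) s'(2,1)] ss by auto
            then have "nb s \<inter> X \<subseteq> nb s - {u, u'}" by auto
            then have "card (nb s \<inter> X) \<le> card (nb s - {u, u'})" by (rule card_mono[rotated]) (use fnb s in auto)
            also have "\<dots> = 1" using un uu nb3[OF s(1)] by (simp add: card_Diff_subset)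
            finally show False using True X's[OF s(1)] by simp
          next
            case False
            then have "u \<in> X" "u' \<in> X" using side[OF e(1) s(2,1)] side[OF e(2) s'(2,1)] ss by auto
            then have "{u, u'} \<subseteq> nb s \<inter> X" using un by auto
            then have "card {u, u'} \<le> card (nb s \<inter> X)" by (rule card_mono[rotated]) (use fnb s in auto)
            then show False using False X's[OF s(1)] uu by simp
          qed
        qed
        then show ?thesis using uniq[OF eE s(2) _ s(1)] s' ss by simp
      qed
    qed
    have "ln ` cut_edges E B X' \<subseteq> {h \<in> H. A h \<inter> X \<noteq> {} \<and> \<not> A h \<subseteq> X}"
    proof
      fix h assume "h \<in> ln ` cut_edges E B X'"
      then obtain e where e: "e \<in> cut_edges E B X'" "h = ln e" by blast
      then have eE: "e \<in> E" by (auto simp: cut_edges_def)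
      have "A h \<inter> X \<noteq> {} \<and> \<not> A h \<subseteq> X"
        using edge_cases[OF eE]
      proof
        assume bT: "B e \<subseteq> T"
        then have "A h = B e" using e(2) lnT by (simp add: A_def)
        then show ?thesis using e(1) bT X'T by (auto simp: cut_edges_def)
      next
        assume "\<exists>s\<in>Sv. \<exists>t\<in>T. B e = {s, t} \<and> s \<noteq> t"
        then obtain s u where s: "s \<in> Sv" "B e = {s, u}" by blast
        have Ah: "A h = nb s" using e(2) ln_star[OF eE s(2,1)] by (simp add: A_def)
        have un: "u \<in> nb s" using s eE by (auto simp: nb_def)
        show ?thesis
        proof (cases "s \<in> X'")
          case True
          then have "u \<notin> X" using side[OF e(1) s(2,1)] by simp
          moreover have "nb s \<inter> X \<noteq> {}" using True X's[OF s(1)] by force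
          ultimately show ?thesis using Ah un by auto
        next
          case False
          then have "u \<in> X" using side[OF e(1) s(2,1)] by simp
          moreover have "\<not> nb s \<subseteq> X"
          proof
            assume "nb s \<subseteq> X"
            then have "nb s \<inter> X = nb s" by auto
            then show False using False X's[OF s(1)] nb3[OF s(1)] by simp
          qed
          ultimately show ?thesis using Ah un by auto
        qed
      qed
      then show "h \<in> {h \<in> H. A h \<inter> X \<noteq> {} \<and> \<not> A h \<subseteq> X}" using e(2) lnH[OF eE] by simp
    qed
    then have "card (ln ` cut_edges E B X') \<le> card {h \<in> H. A h \<inter> X \<noteq> {} \<and> \<not> A h \<subseteq> X}"
      by (rule card_mono[rotated]) (use finH in simp)
    then show ?thesis using 1 card_image[OF inj] by simp
  qed
  define Ce where "Ce = {e \<in> cut_edges E B {v}. c e < k}"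
  define C where "C = ln ` Ce"
  \<comment> \<open>A link at \<open>v\<close> inherits its colour from its unique edge at
    \<open>v\<close>.\<close>
  define cl where "cl h = c (inv_into {e \<in> E. v \<in> B e} ln h)" for h
  have CeS: "Ce \<subseteq> {e \<in> E. v \<in> B e}" by (auto simp: Ce_def cut_singleton)
  have cl: "cl (ln e) = c e" if "e \<in> E" "v \<in> B e" for e
    using inv_into_f_f[OF ln_inj[OF v_T], of e] that by (simp add: cl_def)
  interpret R: rooted_hypergraph T v H A C cl k
  proof unfold_locales
    show "finite T" "v \<in> T" "T \<noteq> {v}" "finite H" "k > 0"
      by (rule finite_T v_T T_v finH k_pos)+
    show "A h \<subseteq> T \<and> 2 \<le> card (A h) \<and> card (A h) \<le> 3" if "h \<in> H" for h by (rule AT[OF that])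
    show "5 * k + 4 \<le> card {h \<in> H. A h \<inter> X \<noteq> {} \<and> \<not> A h \<subseteq> X}" if "X \<subseteq> T" "X \<noteq> {}" "X \<noteq> T" for X
      by (rule hcut[OF that])
    show "card {h \<in> H. v \<in> A h} = 5 * k + 4" using deg[OF v_T] deg_v by simp
    show "C \<subseteq> {h \<in> H. v \<in> A h}" unfolding C_def ln_im[OF v_T, symmetric] by (rule image_mono[OF CeS])
    show "cl h < k" if hC: "h \<in> C" for h
    proof -
      obtain e where "e \<in> Ce" "h = ln e" using hC by (auto simp: C_def)
      then show ?thesis using cl[of e] by (auto simp: Ce_def cut_singleton)
    qed
    show "\<exists>h\<in>C. cl h = i" if i: "i < k" for i
    proof -
      obtain e where e: "e \<in> cut_edges E B {v}" "c e = i" using c_surj[OF i] by blast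
      then have "e \<in> Ce" "cl (ln e) = i" using i cl[of e] by (auto simp: Ce_def cut_singleton)
      then show ?thesis by (auto simp: C_def)
    qed
    have "card C = card Ce" unfolding C_def by (rule card_image, rule inj_on_subset[OF ln_inj[OF v_T] CeS])
    then show "card C \<le> 4 * k + 4" using c_few by (simp add: Ce_def)
  qed
  obtain \<sigma> c' where
    h1: "\<And>h. h \<in> H \<Longrightarrow> \<sigma> h \<subseteq> A h - {v}" and
    h2: "\<And>h. h \<in> C \<Longrightarrow> \<sigma> h \<noteq> {} \<and> c' h = cl h" and
    h3: "\<And>h. h \<in> H \<Longrightarrow> h \<notin> C \<Longrightarrow> \<sigma> h \<noteq> {} \<Longrightarrow> card (\<sigma> h) = 2 \<and> c' h < k" and
    h4: "\<And>i x y. i < k \<Longrightarrow> x \<in> T - {v} \<Longrightarrow> y \<in> T - {v} \<Longrightarrow> (x, y) \<in> linked \<sigma> {h \<in> H. \<sigma> h \<noteq> {} \<and> c' h = i}" and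
    h5: "\<And>x. x \<in> T - {v} \<Longrightarrow> card {h \<in> H. x \<in> A h} = 5 * k + 4 \<Longrightarrow> card {h \<in> H. x \<in> \<sigma> h} \<le> 4 * k + 4"
    by (rule R.hypergraph_packing) (rule that)
  \<comment> \<open>An edge off \<open>v\<close> takes the colour of its link if its terminals
    survive the trimming, and \<open>k\<close> otherwise. A star trimmed to two terminals thus
    becomes a path through its centre.\<close>
  define d where "d e = (if v \<in> B e then c e else if B e \<inter> T \<subseteq> \<sigma> (ln e) then c' (ln e) else k)" for e
  have meet: "B e \<inter> T \<noteq> {}" if "e \<in> E" for e using edge_tight_end[OF that] by blast
  have con: "connects {e \<in> E. d e = i \<and> v \<notin> B e} B (attached E B T v d i)" if i: "i < k" for i
    unfolding connects_def
  proof (intro allI impI)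
    let ?W = "attached E B T v d i" and ?R = "{e \<in> E. d e = i \<and> v \<notin> B e}"
    fix X assume X: "X \<inter> ?W \<noteq> {} \<and> \<not> ?W \<subseteq> X"
    show "cut_edges ?R B X \<noteq> {}"
    proof (cases "\<exists>p\<in>T - {v}. \<exists>q\<in>T - {v}. p \<in> X \<and> q \<notin> X")
      case True
      then obtain p q where pq: "p \<in> T - {v}" "q \<in> T - {v}" "p \<in> X" "q \<notin> X" by blast
      obtain h where hh: "h \<in> {h \<in> H. \<sigma> h \<noteq> {} \<and> c' h = i}" "\<sigma> h \<inter> X \<noteq> {}" "\<not> \<sigma> h \<subseteq> X"
        by (rule linked_crossing[OF h4[OF i pq(1,2)] pq(3,4)])
      then have h: "h \<in> H" "c' h = i" by auto
      obtain y z where yz: "y \<in> \<sigma> h" "y \<in> X" "z \<in> \<sigma> h" "z \<notin> X" using hh(2,3) by blast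
      have yzA: "y \<in> A h" "y \<noteq> v" "z \<in> A h" "z \<noteq> v" using h1[OF h(1)] yz by auto
      show ?thesis
      proof (cases h)
        case (Inl e)
        then have e: "e \<in> E" "B e \<subseteq> T" "y \<in> B e" "z \<in> B e" using h(1) yzA by (auto simp: H_def A_def)
        obtain w where w: "B e = {y, w}" "y \<noteq> w" using B_other[OF e(1,3)] .
        then have B: "B e = {y, z}" using e(4) yz by auto
        have "ln e = h" using lnT[OF e(2)] Inl by simp
        then have "d e = i" using B yz yzA h(2) by (auto simp: d_def)
        then have "e \<in> cut_edges ?R B X" using e(1) B yz yzA by (auto simp: cut_edges_def)
        then show ?thesis by blast
      next
        case (Inr s)
        then have s: "s \<in> Sv" "y \<in> nb s" "z \<in> nb s" using h(1) yzA by (auto simp: H_def A_def)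
        have half: "\<exists>e. e \<in> E \<and> B e = {s, u} \<and> v \<notin> B e \<and> d e = i"
          if u: "u \<in> \<sigma> h" "u \<in> nb s" "u \<noteq> v" for u
        proof -
          obtain e where e: "e \<in> E" "B e = {s, u}" using u(2) by (auto simp: nb_def)
          have sT: "s \<notin> T" "s \<noteq> v" using s(1) v_T by (auto simp: Sv_def)
          have ve: "v \<notin> B e" using e(2) sT u(3) by simp
          have "ln e = h" using ln_star[OF e s(1)] Inr by simp
          moreover have "B e \<inter> T \<subseteq> \<sigma> h" using e(2) sT u(1) by auto
          ultimately have "d e = i" using ve h(2) by (simp add: d_def)
          then show ?thesis using e ve by blast
        qed
        obtain ey where ey: "ey \<in> E" "B ey = {s, y}" "v \<notin> B ey" "d ey = i"
          using half[OF yz(1) s(2) yzA(2)] by blast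
        obtain ez where ez: "ez \<in> E" "B ez = {s, z}" "v \<notin> B ez" "d ez = i"
          using half[OF yz(3) s(3) yzA(4)] by blast
        note ee = ey ez
        show ?thesis
        proof (cases "s \<in> X")
          case True
          then have "ez \<in> cut_edges ?R B X" using ee yz by (auto simp: cut_edges_def)
          then show ?thesis by blast
        next
          case False
          then have "ey \<in> cut_edges ?R B X" using ee yz by (auto simp: cut_edges_def)
          then show ?thesis by blast
        qed
      qed
    next
      case False
      \<comment> \<open>All terminals but \<open>v\<close> lie on one side, so \<open>X\<close>
        separates them from a nonterminal end \<open>x\<close> of an edge at \<open>v\<close> of
        colour \<open>i\<close>. The star of \<open>x\<close> is a coloured link with a nonempty
        trimmed value, so an edge of this colour leads from \<open>x\<close> to a terminal other
        than \<open>v\<close>.\<close>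
      have "\<exists>t. t \<in> T - {v}" using v_T T_v by blast
      then obtain t where t: "t \<in> T - {v}" by blast
      have side: "u \<in> X \<longleftrightarrow> t \<in> X" if "u \<in> T - {v}" for u using False that t by blast
      have "\<exists>x\<in>?W. (x \<in> X) \<noteq> (t \<in> X)" using X by blast
      then obtain x where x: "x \<in> ?W" "(x \<in> X) \<noteq> (t \<in> X)" by blast
      then have "x \<notin> T - {v}" using side by blast
      then obtain e where e: "e \<in> E" "d e = i" "B e = {v, x}" using x(1) by (auto simp: attached_def)
      have "x \<noteq> v" using e(3) card_B[OF e(1)] by auto
      then have xS: "x \<in> Sv" using \<open>x \<notin> T - {v}\<close> e by (auto simp: Sv_def)
      have ce: "c e = i" using e by (simp add: d_def)
      have lx: "ln e = Inr x" using ln_star[OF e(1) _ xS, of v] e(3) by (simp add: insert_commute)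
      have "e \<in> Ce" using e ce i by (auto simp: Ce_def cut_singleton)
      then have hC: "Inr x \<in> C" using lx by (force simp: C_def)
      have hH: "Inr x \<in> H" using xS by (simp add: H_def)
      have "cl (Inr x) = i" using cl[of e] e ce lx by simp
      then have ci: "c' (Inr x) = i" "\<sigma> (Inr x) \<noteq> {}" using h2[OF hC] by auto
      then obtain y where y: "y \<in> \<sigma> (Inr x)" by blast
      then have yn: "y \<in> nb x" "y \<noteq> v" using h1[OF hH] by (auto simp: A_def)
      then obtain e' where e': "e' \<in> E" "B e' = {x, y}" by (auto simp: nb_def)
      have "ln e' = Inr x" by (rule ln_star[OF e' xS])
      moreover have "v \<notin> B e'" using e' yn \<open>x \<noteq> v\<close> by auto
      moreover have "B e' \<inter> T \<subseteq> {y}" using e' xS by (auto simp: Sv_def)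
      ultimately have "d e' = i" using y ci by (auto simp: d_def)
      moreover have "(y \<in> X) \<noteq> (x \<in> X)" using side[of y] nbT[OF xS] yn x(2) by blast
      ultimately have "e' \<in> cut_edges ?R B X" using e' \<open>v \<notin> B e'\<close> by (auto simp: cut_edges_def)
      then show ?thesis by blast
    qed
  qed
  have few: "card {e \<in> cut_edges E B {t}. d e < k} \<le> 4 * k + 4"
    if t: "t \<in> T - {v}" "card (cut_edges E B {t}) = 5 * k + 4" for t
  proof -
    have tT: "t \<in> T" "t \<noteq> v" using t by auto
    have "ln ` {e \<in> cut_edges E B {t}. d e < k} \<subseteq> {h \<in> H. t \<in> \<sigma> h}"
    proof
      fix h assume "h \<in> ln ` {e \<in> cut_edges E B {t}. d e < k}"
      then obtain e where e: "e \<in> E" "t \<in> B e" "d e < k" "h = ln e" by (auto simp: cut_singleton)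
      have "t \<in> \<sigma> h"
      proof (cases "v \<in> B e")
        case True
        obtain w where w: "B e = {v, w}" "v \<noteq> w" using B_other[OF e(1) True] .
        then have Bt: "B e = {v, t}" using e(2) tT by auto
        then have bT: "B e \<subseteq> T" using tT v_T by auto
        have "e \<in> Ce" using e True by (simp add: d_def Ce_def cut_singleton)
        then have "h \<in> C" using e by (auto simp: C_def)
        then have "\<sigma> h \<noteq> {}" using h2 by blast
        moreover have "\<sigma> h \<subseteq> {t}" using h1[OF lnH[OF e(1)]] lnT[OF bT] e(4) Bt by (auto simp: A_def)
        ultimately show ?thesis by blast
      next
        case False
        then have "B e \<inter> T \<subseteq> \<sigma> h" using e by (auto simp: d_def split: if_splits)
        then show ?thesis using e(2) tT by blast
      qed
      then show "h \<in> {h \<in> H. t \<in> \<sigma> h}" using lnH[OF e(1)] e(4) by simp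
    qed
    then have "card (ln ` {e \<in> cut_edges E B {t}. d e < k}) \<le> card {h \<in> H. t \<in> \<sigma> h}"
      by (rule card_mono[rotated]) (use finH in simp)
    moreover have "card (ln ` {e \<in> cut_edges E B {t}. d e < k}) = card {e \<in> cut_edges E B {t}. d e < k}"
      by (rule card_image, rule inj_on_subset[OF ln_inj[OF tT(1)]]) (auto simp: cut_singleton)
    moreover have "card {h \<in> H. t \<in> \<sigma> h} \<le> 4 * k + 4" using h5[OF t(1)] deg[OF tT(1)] t(2) by simp
    ultimately show ?thesis by linarith
  qed
  have "d e \<le> k" if e: "e \<in> E" for e
  proof (cases "v \<in> B e")
    case True
    then show ?thesis using c_le[of e] e by (simp add: d_def cut_singleton)
  next
    case False
    show ?thesis
    proof (cases "B e \<inter> T \<subseteq> \<sigma> (ln e)")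
      case True
      then have ne: "\<sigma> (ln e) \<noteq> {}" using meet[OF e] by blast
      have "c' (ln e) < k"
      proof (cases "ln e \<in> C")
        case True
        then show ?thesis using h2[OF True] R.c_less[OF True] by simp
      qed (use h3[OF lnH[OF e] _ ne] in simp)
      then show ?thesis using False True by (simp add: d_def)
    qed (use False in \<open>simp add: d_def\<close>)
  qed
  moreover have "d e = c e" if "e \<in> cut_edges E B {v}" for e using that by (simp add: d_def cut_singleton)
  ultimately have "extension E B T v c k d" unfolding extension_def using con few by blast
  then show ?thesis by blast
qed

end

section \<open>Induction on the number of edges\<close>

text \<open>Every reduction keeps \<open>v\<close> and \<open>k\<close>, whereas contractions change
  the terminals and the prescription; these are therefore generalised in the induction.\<close>

theorem extension_exists:
  "coloured_graph (E :: 'e set) B (T :: 'v set) v c k \<Longrightarrow> \<exists>d. extension E B T v c k d"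
proof (induction "card E" arbitrary: E B T c rule: less_induct)
  case less
  interpret coloured_graph E B T v c k by (rule less.prems)
  note IH = less.hyps
  show ?case
  proof (cases "\<exists>Z e1 e2. v \<notin> Z \<and> splits Z T \<and> card (cut_edges E B Z) = 5 * k + 4 \<and>
      e1 \<in> E \<and> B e1 \<subseteq> Z \<and> e2 \<in> E \<and> B e2 \<inter> Z = {}")
    case True
    then obtain Z e1 e2 where Z: "v \<notin> Z" "splits Z T" "card (cut_edges E B Z) = 5 * k + 4"
      "e1 \<in> E" "B e1 \<subseteq> Z" "e2 \<in> E" "B e2 \<inter> Z = {}" by blast
    show ?thesis by (rule extension_tight_cut[OF _ Z]) (erule (1) IH)
  next
    case triv: False
    show ?thesis
    proof (cases "\<exists>e\<in>E. \<forall>X. splits X T \<and> card (cut_edges E B X) = 5 * k + 4 \<longrightarrow> e \<notin> cut_edges E B X")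
      case True
      then obtain e where e: "e \<in> E" "\<And>X. splits X T \<Longrightarrow> card (cut_edges E B X) = 5 * k + 4 \<Longrightarrow> e \<notin> cut_edges E B X"
        by blast
      show ?thesis by (rule extension_delete[OF _ e(1)]) (erule (1) IH, erule (1) e(2))
    next
      case False
      interpret reduced_graph E B T v c k
        by unfold_locales (use triv False in blast)+
      show ?thesis
      proof (cases "\<exists>s. s \<notin> T \<and> card {e \<in> E. s \<in> B e} \<noteq> 0 \<and> card {e \<in> E. s \<in> B e} \<noteq> 3")
        case True
        then obtain s where s: "s \<notin> T" "card {e \<in> E. s \<in> B e} \<noteq> 0" "card {e \<in> E. s \<in> B e} \<noteq> 3" by blast
        obtain e1 e2 a b where e: "e1 \<in> E" "e2 \<in> E" "e1 \<noteq> e2" "B e1 = {s, a}" "B e2 = {s, b}" "a \<noteq> b"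
          and b: "b \<noteq> v"
          and big: "\<forall>X. s \<notin> X \<and> a \<in> X \<and> b \<in> X \<and> \<not> T \<subseteq> X \<longrightarrow> 5 * k + 6 \<le> card (cut_edges E B X)"
          using splitting_exists[OF s] by (elim exE conjE)
        show ?thesis
          by (rule extension_split[OF _ e s(1) neighbour_tight(1)[OF e(1,4) s(1)]
                neighbour_tight(1)[OF e(2,5) s(1)] b]) (erule (1) IH, use big in auto)
      next
        case False
        show ?thesis by (rule extension_base) (use False in blast)
      qed
    qed
  qed
qed

section \<open>Steiner trees\<close>

definition component_of :: "('v, 'e) mgraph \<Rightarrow> 'v \<Rightarrow> ('v, 'e) mgraph" where
  "component_of D u = \<lparr>vertices = {w. (u, w) \<in> (adjacency D)\<^sup>*},
     edges = {e \<in> edges D. ends D e \<subseteq> {w. (u, w) \<in> (adjacency D)\<^sup>*}}, ends = ends D\<rparr>"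

lemma adjacency_sym: "sym (adjacency D)"
  by (auto simp: sym_def adjacency_def insert_commute)

lemma reachable_sym: "(x, y) \<in> (adjacency D)\<^sup>* \<Longrightarrow> (y, x) \<in> (adjacency D)\<^sup>*"
  using sym_rtrancl[OF adjacency_sym] by (meson symD)

lemma mgraph_ends: "is_mgraph D \<Longrightarrow> e \<in> edges D \<Longrightarrow> ends D e \<subseteq> vertices D"
  unfolding is_mgraph_def by fastforce

lemma reachable_vertices:
  assumes "is_mgraph D" "u \<in> vertices D" "(u, w) \<in> (adjacency D)\<^sup>*"
  shows "w \<in> vertices D"
  using assms(3)
proof (induction rule: rtrancl_induct)
  case (step y z)
  then obtain e where "e \<in> edges D" "ends D e = {y, z}" by (auto simp: adjacency_def)
  then show ?case using mgraph_ends[OF assms(1)] by blast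
qed (rule assms(2))

lemma
  assumes D: "is_mgraph D" and u: "u \<in> vertices D"
  shows component_of_subgraph: "msubgraph (component_of D u) D"
    and component_of_connected: "mconnected (component_of D u)"
    and component_of_component: "is_component (component_of D u) D"
proof -
  let ?K = "component_of D u" and ?V = "{w. (u, w) \<in> (adjacency D)\<^sup>*}"
  have VD: "?V \<subseteq> vertices D" using reachable_vertices[OF D u] by blast
  have fin: "finite (vertices D)" "finite (edges D)" using D by (auto simp: is_mgraph_def)
  have "is_mgraph ?K" unfolding is_mgraph_def
  proof (intro conjI ballI)
    show "finite (vertices ?K)" "finite (edges ?K)"
      using finite_subset[OF VD fin(1)] fin(2) by (simp_all add: component_of_def)
    show "vertices ?K \<noteq> {}" by (auto simp: component_of_def)
    fix e assume e: "e \<in> edges ?K"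
    then have eD: "e \<in> edges D" "ends D e \<subseteq> ?V" by (auto simp: component_of_def)
    then obtain p q where "ends D e = {p, q}" using D unfolding is_mgraph_def by meson
    then show "\<exists>p\<in>vertices ?K. \<exists>q\<in>vertices ?K. ends ?K e = {p, q}"
      using eD by (auto simp: component_of_def)
  qed
  then show sub: "msubgraph ?K D" using VD by (auto simp: msubgraph_def component_of_def)
  have reach: "(u, w) \<in> (adjacency ?K)\<^sup>*" if "(u, w) \<in> (adjacency D)\<^sup>*" for w
    using that
  proof (induction rule: rtrancl_induct)
    case (step y z)
    then obtain e where e: "e \<in> edges D" "ends D e = {y, z}" by (auto simp: adjacency_def)
    have "y \<in> ?V" "z \<in> ?V" using step.hyps by (auto intro: rtrancl_into_rtrancl)
    then have "(y, z) \<in> adjacency ?K" using e by (auto simp: adjacency_def component_of_def)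
    then show ?case using step.IH by (rule rtrancl_into_rtrancl[rotated])
  qed simp
  show con: "mconnected ?K" unfolding mconnected_def
  proof (intro ballI)
    fix x y assume "x \<in> vertices ?K" "y \<in> vertices ?K"
    then have "(u, x) \<in> (adjacency ?K)\<^sup>*" "(u, y) \<in> (adjacency ?K)\<^sup>*"
      using reach by (simp_all add: component_of_def)
    then show "(x, y) \<in> (adjacency ?K)\<^sup>*" using reachable_sym rtrancl_trans by metis
  qed
  have "L = ?K" if L: "msubgraph L D" "mconnected L" "msubgraph ?K L" for L
  proof -
    have eL: "edges L \<subseteq> edges D" "ends L = ends D" using L(1) by (auto simp: msubgraph_def)
    have KL: "?V \<subseteq> vertices L" "edges ?K \<subseteq> edges L" using L(3) by (auto simp: msubgraph_def component_of_def)
    have uL: "u \<in> vertices L" using KL by auto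
    have "adjacency L \<subseteq> adjacency D" using eL by (auto simp: adjacency_def)
    then have "(adjacency L)\<^sup>* \<subseteq> (adjacency D)\<^sup>*" by (rule rtrancl_mono)
    then have "vertices L \<subseteq> ?V" using L(2) uL unfolding mconnected_def by blast
    then have V: "vertices L = ?V" using KL by blast
    have "is_mgraph L" using L(1) by (simp add: msubgraph_def)
    then have "edges L \<subseteq> edges ?K"
      using mgraph_ends[of L] eL V by (fastforce simp: component_of_def)
    then have "edges L = edges ?K" using KL by blast
    then show "L = ?K" using V eL(2) by (intro mgraph.equality) (simp_all add: component_of_def)
  qed
  then show "is_component ?K D" unfolding is_component_def using sub con by blast
qed

section \<open>Minimal connecting edge sets\<close>

text \<open>The rest of the cycle leads from one end of its first edge to the other and so has to
  cross between the two sides again.\<close>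

lemma cycle_crosses_twice:
  assumes cyc: "is_cycle G vs es" and X: "ends G (es ! 0) \<inter> X \<noteq> {}" "\<not> ends G (es ! 0) \<subseteq> X"
  obtains f where "f \<in> set es" "f \<noteq> es ! 0" "ends G f \<inter> X \<noteq> {}" "\<not> ends G f \<subseteq> X"
proof -
  let ?n = "length vs"
  have n: "?n > 0" "length es = ?n" "distinct es"
    and en: "\<And>i. i < ?n \<Longrightarrow> ends G (es ! i) = {vs ! i, vs ! (Suc i mod ?n)}"
    using cyc by (auto simp: is_cycle_def)
  have "\<exists>j. 1 \<le> j \<and> j < ?n \<and> ends G (es ! j) \<inter> X \<noteq> {} \<and> \<not> ends G (es ! j) \<subseteq> X"
  proof (rule ccontr)
    assume m: "\<not> ?thesis"
    have side: "vs ! (Suc j mod ?n) \<in> X \<longleftrightarrow> vs ! (1 mod ?n) \<in> X" if "j < ?n" for j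
      using that
    proof (induction j)
      case (Suc j)
      have "\<not> (ends G (es ! Suc j) \<inter> X \<noteq> {} \<and> \<not> ends G (es ! Suc j) \<subseteq> X)" using m Suc.prems by auto
      then have "vs ! Suc j \<in> X \<longleftrightarrow> vs ! (Suc (Suc j) mod ?n) \<in> X" using en[OF Suc.prems] by auto
      then show ?case using Suc by simp
    qed simp
    have "vs ! 0 \<in> X \<longleftrightarrow> vs ! (1 mod ?n) \<in> X" using side[of "?n - 1"] n by simp
    moreover have e0: "ends G (es ! 0) = {vs ! 0, vs ! (1 mod ?n)}" using en[OF n(1)] by simp
    ultimately show False using X unfolding e0 by blast
  qed
  then obtain j where j: "1 \<le> j" "j < ?n" "ends G (es ! j) \<inter> X \<noteq> {}" "\<not> ends G (es ! j) \<subseteq> X" by blast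
  have "es ! j \<noteq> es ! 0" using n j nth_eq_iff_index_eq[of es j 0] by simp
  then show thesis using that[of "es ! j"] j n by simp
qed

lemma steiner_tree_exists:
  assumes G: "is_mgraph G" and T: "T \<subseteq> vertices G" "t0 \<in> T" and R: "R \<subseteq> edges G" and con: "connects R (ends G) T"
  obtains H where "steiner_tree G T H" "edges H \<subseteq> R"
proof -
  have finR: "finite R" using R G finite_subset by (auto simp: is_mgraph_def)
  define Q where "Q = {S. S \<subseteq> R \<and> connects S (ends G) T}"
  have "finite Q" "R \<in> Q" using finR con by (auto simp: Q_def)
  then obtain S where S: "S \<in> Q" "\<And>S'. S' \<in> Q \<Longrightarrow> S' \<subseteq> S \<Longrightarrow> S = S'"
    using finite_has_minimal[of Q] by blast
  have SR: "S \<subseteq> R" and cS: "connects S (ends G) T" using S(1) by (auto simp: Q_def)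
  define D where "D = G\<lparr>edges := S\<rparr>"
  have D: "is_mgraph D" using G SR R finite_subset[OF SR finR] by (auto simp: is_mgraph_def D_def)
  have t0D: "t0 \<in> vertices D" using T by (auto simp: D_def)
  define H where "H = component_of D t0"
  note c = component_of_subgraph[OF D t0D, folded H_def] component_of_connected[OF D t0D, folded H_def]
  have HD: "edges H \<subseteq> S" "ends H = ends G" "is_mgraph H" "vertices H \<subseteq> vertices G"
    using c(1) by (auto simp: msubgraph_def D_def)
  have "T \<subseteq> vertices H"
  proof (rule ccontr)
    assume "\<not> T \<subseteq> vertices H"
    then obtain t where t: "t \<in> T" "t \<notin> vertices H" by blast
    have t0H: "t0 \<in> vertices H" by (simp add: H_def component_of_def)
    obtain e where e: "e \<in> S" "ends G e \<inter> vertices H \<noteq> {}" "\<not> ends G e \<subseteq> vertices H"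
      by (rule connectsE[OF cS T(2) t(1) t0H t(2)])
    then obtain p where p: "p \<in> ends G e" "p \<in> vertices H" by blast
    obtain q where q: "q \<in> ends G e" "q \<notin> vertices H" using e(3) by blast
    obtain x y where xy: "ends G e = {x, y}" using G e(1) SR R unfolding is_mgraph_def by (meson subsetD)
    have "p \<noteq> q" using p q by auto
    then have "ends D e = {p, q}" using p(1) q(1) xy by (auto simp: D_def)
    then have "(p, q) \<in> adjacency D" using e(1) by (auto simp: adjacency_def D_def)
    then have "q \<in> vertices H" using p(2) by (auto simp: H_def component_of_def intro: rtrancl_into_rtrancl)
    then show False using q(2) by simp
  qed
  moreover have "\<nexists>vs es. is_cycle H vs es"
  proof
    assume "\<exists>vs es. is_cycle H vs es"
    then obtain vs es where cyc: "is_cycle H vs es" by blast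
    have ne: "vs \<noteq> []" "length es = length vs" "set es \<subseteq> edges H" using cyc by (auto simp: is_cycle_def)
    have e0: "es ! 0 \<in> set es" using ne by (metis length_greater_0_conv nth_mem)
    have "connects (S - {es ! 0}) (ends G) T"
      unfolding connects_def
    proof (intro allI impI)
      fix X assume "X \<inter> T \<noteq> {} \<and> \<not> T \<subseteq> X"
      then have "cut_edges S (ends G) X \<noteq> {}" using cS unfolding connects_def by blast
      then obtain f where f: "f \<in> S" "ends G f \<inter> X \<noteq> {}" "\<not> ends G f \<subseteq> X" by (auto simp: cut_edges_def)
      have "\<exists>g\<in>S. g \<noteq> es ! 0 \<and> ends G g \<inter> X \<noteq> {} \<and> \<not> ends G g \<subseteq> X"
      proof (cases "f = es ! 0")
        case True
        have x: "ends H (es ! 0) \<inter> X \<noteq> {}" "\<not> ends H (es ! 0) \<subseteq> X" using f True HD(2) by auto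
        obtain g where "g \<in> set es" "g \<noteq> es ! 0" "ends H g \<inter> X \<noteq> {}" "\<not> ends H g \<subseteq> X"
          by (rule cycle_crosses_twice[OF cyc x])
        then show ?thesis using HD(1,2) ne(3) by (intro bexI[of _ g]) auto
      qed (use f in blast)
      then show "cut_edges (S - {es ! 0}) (ends G) X \<noteq> {}" by (auto simp: cut_edges_def)
    qed
    then have "S - {es ! 0} \<in> Q" using SR by (auto simp: Q_def)
    then have "S = S - {es ! 0}" using S(2) by blast
    moreover have "es ! 0 \<in> S" using e0 ne(3) HD(1) by blast
    ultimately show False by blast
  qed
  ultimately have "steiner_tree G T H"
    using c(2) HD SR R by (auto simp: steiner_tree_def is_tree_def msubgraph_def)
  then show thesis using that HD(1) SR by blast
qed

section \<open>Adding a root and translating the cut condition\<close>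

text \<open>Once the boundary is deleted, no walk from \<open>t0\<close> enters \<open>X\<close>, so
  the components of \<open>t\<close> and \<open>t0\<close> differ.\<close>

lemma separating_boundary:
  assumes G: "is_mgraph G" and X: "X \<subseteq> vertices G" "t \<in> X" "t0 \<in> vertices G - X" and T: "t \<in> T" "t0 \<in> T"
  shows "edge_cut G (edge_boundary G X)" "cut_separates G (edge_boundary G X) T"
proof -
  let ?C = "edge_boundary G X"
  let ?D = "delete_edges G ?C"
  show "edge_cut G ?C" unfolding edge_cut_def using X by (intro exI[of _ X]) auto
  have D: "is_mgraph ?D" using G by (auto simp: is_mgraph_def delete_edges_def)
  have u: "t \<in> vertices ?D" "t0 \<in> vertices ?D" using X by (auto simp: delete_edges_def)
  have stay: "w \<notin> X" if "(t0, w) \<in> (adjacency ?D)\<^sup>*" for w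
    using that
  proof (induction rule: rtrancl_induct)
    case (step y z)
    then obtain e where e: "e \<in> edges G" "e \<notin> ?C" "ends G e = {y, z}"
      by (auto simp: adjacency_def delete_edges_def)
    show ?case
    proof
      assume "z \<in> X"
      moreover have "ends G e = {z, y}" using e(3) by (simp add: insert_commute)
      ultimately have "e \<in> ?C" unfolding edge_boundary_def using e(1) step.IH by blast
      then show False using e(2) by simp
    qed
  qed (use X in simp)
  have tK: "t \<in> vertices (component_of ?D t)" "t0 \<in> vertices (component_of ?D t0)"
    by (simp_all add: component_of_def)
  have "t \<notin> vertices (component_of ?D t0)" using stay X(2) by (auto simp: component_of_def)
  then have "component_of ?D t \<noteq> component_of ?D t0" using tK by metis
  then show "cut_separates G ?C T" unfolding cut_separates_def
    using component_of_component[OF D u(1)] component_of_component[OF D u(2)] tK T by blast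
qed

theorem theorem1p4:
  fixes k :: nat and G :: "('v, 'e) mgraph" and T :: "'v set"
  assumes "k \<ge> 1"
    and "is_mgraph G"
    and "T \<subseteq> vertices G"
    and "\<And>C. edge_cut G C \<Longrightarrow> cut_separates G C T \<Longrightarrow> card C \<ge> 5 * k + 4"
  shows "\<exists>F :: nat \<Rightarrow> ('v, 'e) mgraph.
           (\<forall>i<k. steiner_tree G T (F i)) \<and>
           (\<forall>i<k. \<forall>j<k. i \<noteq> j \<longrightarrow> edges (F i) \<inter> edges (F j) = {})"
proof -
  note G = assms(2)
  have "\<exists>R. (\<forall>i<k. R i \<subseteq> edges G \<and> connects (R i) (ends G) T) \<and>
      (\<forall>i<k. \<forall>j<k. i \<noteq> j \<longrightarrow> R i \<inter> R j = {})"
  proof (cases "T = {}")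
    case True
    then show ?thesis by (intro exI[of _ "\<lambda>i. {}"]) (auto simp: connects_def)
  next
    case False
    then obtain t0 where t0: "t0 \<in> T" by blast
    \<comment> \<open>A new terminal \<open>None\<close> is joined to \<open>t0\<close> by \<open>5 * k + 4\<close> edges, one of each colour below \<open>k\<close>.\<close>
    define E where "E = Inl ` {e \<in> edges G. card (ends G e) = 2} \<union> Inr ` {..<5 * k + 4}"
    define B where "B x = (case x of Inl e \<Rightarrow> Some ` ends G e | Inr j \<Rightarrow> {None, Some t0})" for x :: "'e + nat"
    define c where "c x = (case x of Inl e \<Rightarrow> k | Inr j \<Rightarrow> min j k)" for x :: "'e + nat"
    define T' where "T' = insert None (Some ` T)"
    have fG: "finite (vertices G)" "finite (edges G)" using G by (auto simp: is_mgraph_def)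
    have fE: "finite E" using fG by (simp add: E_def)
    have cr: "card (Inr ` {..<n} :: ('e + nat) set) = n" for n by (simp add: card_image)
    have cN: "cut_edges E B {None} = Inr ` {..<5 * k + 4}"
      by (auto simp: cut_edges_def E_def B_def)
    have main: "5 * k + 4 \<le> card (cut_edges E B X)" if X: "splits X T'" "None \<notin> X" for X
    proof (cases "Some t0 \<in> X")
      case True
      then have "Inr ` {..<5 * k + 4} \<subseteq> cut_edges E B X" using X(2) by (auto simp: cut_edges_def E_def B_def)
      then have "card (Inr ` {..<5 * k + 4} :: ('e + nat) set) \<le> card (cut_edges E B X)"
        by (rule card_mono[OF finite_subset[OF cut_edges_subset fE]])
      then show ?thesis unfolding cr .
    next
      case False
      \<comment> \<open>The root and \<open>t0\<close> are outside \<open>X\<close>, so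
        \<open>X\<close> contains another terminal. The trace of \<open>X\<close> on the vertices of
        \<open>G\<close> separates this terminal from \<open>t0\<close>, and the hypothesis on
        edge-cuts applies to its boundary.\<close>
      obtain t where t: "t \<in> T" "Some t \<in> X" using X by (auto simp: splits_def T'_def)
      define Y where "Y = {x \<in> vertices G. Some x \<in> X}"
      have Y: "Y \<subseteq> vertices G" "t \<in> Y" "t0 \<in> vertices G - Y" using t t0 assms(3) False by (auto simp: Y_def)
      have "5 * k + 4 \<le> card (edge_boundary G Y)"
        by (rule assms(4)[OF separating_boundary[OF G Y t(1) t0]])
      also have "card (edge_boundary G Y) = card (Inl ` edge_boundary G Y :: ('e + nat) set)"
        by (simp add: card_image)
      also have "\<dots> \<le> card (cut_edges E B X)"
      proof (rule card_mono[OF finite_subset[OF cut_edges_subset fE]])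
        show "Inl ` edge_boundary G Y \<subseteq> cut_edges E B X"
        proof
          fix x :: "'e + nat" assume "x \<in> Inl ` edge_boundary G Y"
          then obtain e p q where e: "x = Inl e" "e \<in> edges G" "ends G e = {p, q}" "p \<in> Y" "q \<notin> Y"
            by (auto simp: edge_boundary_def)
          have "q \<in> vertices G" using mgraph_ends[OF G e(2)] e(3) by simp
          then have "Some q \<notin> X" "Some p \<in> X" "p \<noteq> q" using e(4,5) by (auto simp: Y_def)
          then show "x \<in> cut_edges E B X" using e by (auto simp: cut_edges_def E_def B_def)
        qed
      qed
      finally show ?thesis .
    qed
    have cg: "coloured_graph E B T' None c k"
    proof (unfold_locales, unfold cN)
      show "finite E" by (rule fE)
      show "finite T'" using assms(3) fG finite_subset by (auto simp: T'_def)
      show "card (B e) = 2" if "e \<in> E" for e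
        using that by (auto simp: E_def B_def card_image)
      show "None \<in> T'" "T' \<noteq> {None}" using t0 by (auto simp: T'_def)
      show "k > 0" using assms(1) by simp
      show "5 * k + 4 \<le> card (cut_edges E B X)" if X: "splits X T'" for X
      proof (cases "None \<in> X")
        case True
        then show ?thesis using main[of "- X"] X by (simp add: splits_compl cut_edges_compl)
      qed (use main X in blast)
      show "card (Inr ` {..<5 * k + 4} :: ('e + nat) set) = 5 * k + 4" by (rule cr)
      show "c e \<le> k" if "e \<in> Inr ` {..<5 * k + 4}" for e using that by (auto simp: c_def)
      show "\<exists>e\<in>Inr ` {..<5 * k + 4}. c e = i" if "i < k" for i
        using that by (intro bexI[of _ "Inr i"]) (auto simp: c_def)
      have "{e \<in> Inr ` {..<5 * k + 4}. c e < k} \<subseteq> Inr ` {..<k}" by (auto simp: c_def)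
      then have "card {e \<in> Inr ` {..<5 * k + 4}. c e < k} \<le> card (Inr ` {..<k} :: ('e + nat) set)"
        by (rule card_mono[rotated]) simp
      then show "card {e \<in> Inr ` {..<5 * k + 4}. c e < k} \<le> 4 * k + 4" unfolding cr by simp
    qed
    obtain d where d: "extension E B T' None c k d" using extension_exists[OF cg] ..
    \<comment> \<open>The edges at \<open>None\<close> are left out: the class connects the old
      terminals without them.\<close>
    define R where "R i = {e \<in> edges G. card (ends G e) = 2 \<and> d (Inl e) = i}" for i
    have "connects (R i) (ends G) T" if i: "i < k" for i
      unfolding connects_def
    proof (intro allI impI)
      fix X assume "X \<inter> T \<noteq> {} \<and> \<not> T \<subseteq> X"
      then obtain p q where pq: "p \<in> T" "q \<in> T" "p \<in> X" "q \<notin> X" by blast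
      have a: "Some p \<in> attached E B T' None d i" "Some q \<in> attached E B T' None d i"
        using pq by (auto simp: attached_def T'_def)
      have x: "Some p \<in> Some ` X" "Some q \<notin> Some ` X" using pq by auto
      obtain f where f: "f \<in> {e \<in> E. d e = i \<and> None \<notin> B e}" "B f \<inter> Some ` X \<noteq> {}" "\<not> B f \<subseteq> Some ` X"
        by (rule connectsE[OF extension_connects[OF d i] a x])
      then obtain e where e: "f = Inl e" "e \<in> edges G" "card (ends G e) = 2" by (auto simp: E_def B_def)
      then have "e \<in> cut_edges (R i) (ends G) X" using f by (auto simp: cut_edges_def R_def B_def)
      then show "cut_edges (R i) (ends G) X \<noteq> {}" by blast
    qed
    then show ?thesis by (intro exI[of _ R]) (auto simp: R_def)
  qed
  then obtain R where R: "\<forall>i<k. R i \<subseteq> edges G \<and> connects (R i) (ends G) T"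
    and disj: "\<forall>i<k. \<forall>j<k. i \<noteq> j \<longrightarrow> R i \<inter> R j = {}" by (elim exE conjE)
  have "\<exists>H. steiner_tree G T H \<and> edges H \<subseteq> R i" if i: "i < k" for i
  proof (cases "T = {}")
    case True
    \<comment> \<open>With no terminals there is no start vertex for
      \<open>steiner_tree_exists\<close>; a single vertex without edges serves for every
      index.\<close>
    obtain u where u: "u \<in> vertices G" using G by (auto simp: is_mgraph_def)
    have "steiner_tree G T \<lparr>vertices = {u}, edges = {}, ends = ends G\<rparr>"
      using u True by (auto simp: steiner_tree_def msubgraph_def is_tree_def is_mgraph_def mconnected_def is_cycle_def)
    then show ?thesis by fastforce
  next
    case False
    then obtain t0 where t0: "t0 \<in> T" by blast
    have Ri: "R i \<subseteq> edges G" "connects (R i) (ends G) T" using R i by auto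
    obtain H where "steiner_tree G T H" "edges H \<subseteq> R i"
      by (rule steiner_tree_exists[OF G assms(3) t0 Ri])
    then show ?thesis by blast
  qed
  then have "\<forall>i. \<exists>H. i < k \<longrightarrow> steiner_tree G T H \<and> edges H \<subseteq> R i" by simp
  from choice[OF this] obtain F where F: "\<forall>i. i < k \<longrightarrow> steiner_tree G T (F i) \<and> edges (F i) \<subseteq> R i" ..
  have "edges (F i) \<inter> edges (F j) = {}" if "i < k" "j < k" "i \<noteq> j" for i j
  proof -
    have "edges (F i) \<subseteq> R i" "edges (F j) \<subseteq> R j" "R i \<inter> R j = {}" using F disj that by auto
    then show ?thesis by blast
  qed
  then show ?thesis using F by (intro exI[of _ F]) simp
qed

end
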